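(* Let $\mu_0\in(0,1]$, let $(X_n)_{n=1}^\infty$ be $[0,1]$-valued random variables, and consider $\mathcal P^{\le}=\{P:\mathbb E_P[X_1]\le\mu_0\}$ and $\mathcal Q^{>}=\{Q:\mathbb E_Q[X_1]>\mu_0\}$. Let $(\gamma_n)_{n=1}^\infty$ be a $[0,1/\mu_0]$-valued predictable sequence, let $$W_n^{\le}:=\prod_{i=1}^n\left(1+\gamma_i(X_i-\mu_0)\right),$$ and suppose that $(\gamma_n)$ is chosen such that $W_n^\le$ has sublinear portfolio regret, i.e. there is a deterministic sequence $r_n=o(n)$ with $$\max_{\gamma\in[0,1/\mu_0]}\sum_{i=1}^n\log(1+\gamma(X_i-\mu_0))-\log(W_n^\le)\le r_n\quad\text{for all }n.$$ Then for any $Q\in\mathcal Q^>$, $$\lim_{n\to\infty}\frac1n\log(W_n^\le)=\max_{\gamma\in[0,1/\mu_0]}\mathbb E_Q[\log(1+\gamma(X_1-\mu_0))]\quad Q\text{-almost surely,}$$ and for any $\mathcal P^\le$-$e$-process $(W_n')$ and any $Q\in\mathcal Q^>$, $$\limsup_{n\to\infty}\frac1n\log(W_n')\le\max_{\gamma\in[0,1/\mu_0]}\mathbb E_Q[\log(1+\gamma(X_1-\mu_0))]\quad Q\text{-almost surely.}$$ Furthermore, for any $Q\in\mathcal Q^>$, letting $\gamma_Q^\star\in\arg\max_{\gamma\in[0,1/\mu_0]}\mathbb E_Q[\log(1+\gamma(X_1-\mu_0))]$ and $\tau_\alpha:=\inf\{n\in\mathbb N:W_n^\le\ge1/\alpha\}$,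 $$\lim_{\alpha\to0^+}\frac{\mathbb E_Q[\tau_\alpha]}{\log(1/\alpha)}=\frac1{\mathbb E_Q[\log(1+\gamma_Q^\star(X_1-\mu_0))]},$$ and for every $\alpha\in(0,1)$ and every stopping time $\tau_\alpha'$ with $\sup_{P\in\mathcal P^\le}P(\tau_\alpha'<\infty)\le\alpha$, $$\frac{\mathbb E_Q[\tau_\alpha']}{\log(1/\alpha)}\ge\frac1{\mathbb E_Q[\log(1+\gamma_Q^\star(X_1-\mu_0))]}.$$
   Context: Under every distribution considered (in $\mathcal P^\le$ or $\mathcal Q^>$), $(X_n)$ is i.i.d. with values in $[0,1]$; $\mathcal P^\le$ and $\mathcal Q^>$ consist of all such distributions with the stated mean constraint. $\mathcal F_n=\sigma(X_1,\dots,X_n)$, $\mathcal F_0$ trivial; $(\gamma_n)$ predictable means $\gamma_n$ is $\mathcal F_{n-1}$-measurable; stopping times are with respect to $(\mathcal F_n)$ and take values in $\mathbb N\cup\{\infty\}$. A test $P$-supermartingale is a nonnegative adapted process $(M_n)$ with $\mathbb E_P[M_n\mid\mathcal F_{n-1}]\le M_{n-1}$ $P$-a.s. for $n\ge2$ and $\mathbb E_P[M_1]\le1$. A $\mathcal P^\le$-$e$-process is a nonnegative adapted process $(W_n')$ such that for each $P\in\mathcal P^\le$ there is a test $P$-supermartingale $(M_n^{(P)})$ with $W_n'\le M_n^{(P)}$ for all $n$, $P$-a.s. Conventions: $\inf\emptyset=\infty$, $\log0=-\infty$. *)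

theory Defs
  imports "HOL-Probability.Probability" "HOL-Library.Landau_Symbols"
begin

text \<open>The natural filtration of \<open>(X\<^sub>n)\<close>, \<open>n \<ge> 1\<close>. It is indexed by \<^typ>\<open>enat\<close> so that the library's
  \<^const>\<open>stopping_time\<close>, whose times have the index type of the filtration, covers times with
  values in \<open>\<nat> \<union> {\<infinity>}\<close>; the requirement at \<open>t = \<infinity>\<close> is void.\<close>

definition nat_filtration :: "'a measure \<Rightarrow> (nat \<Rightarrow> 'a \<Rightarrow> real) \<Rightarrow> enat \<Rightarrow> 'a measure" where
  "nat_filtration M X t =
     sigma (space M) {X i -` B \<inter> space M | i B. 1 \<le> i \<and> enat i \<le> t \<and> B \<in> sets borel}"

definition iid_laws :: "'a measure \<Rightarrow> (nat \<Rightarrow> 'a \<Rightarrow> real) \<Rightarrow> 'a measure set" where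
  "iid_laws M X = {P. prob_space P \<and> sets P = sets M
     \<and> prob_space.indep_vars P (\<lambda>_. borel) X {1..}
     \<and> (\<forall>n\<ge>1. distr P borel (X n) = distr P borel (X 1))}"

text \<open>The measure of \<open>M\<close> is irrelevant; \<open>M\<close> only supplies the measurable space on which all
  probability measures live. The last clause says that this space is large enough for
  \<^const>\<open>iid_laws\<close> to comprise \<^emph>\<open>all\<close> i.i.d. distributions on \<open>[0,1]\<close>: without it
  the null class below could be too small, or even empty. The lemma
  \<open>bounded_observations_canonical\<close> shows that the coordinate process on \<open>[0,1]\<^sup>\<nat>\<close> qualifies.\<close>

definition bounded_observations :: "'a measure \<Rightarrow> (nat \<Rightarrow> 'a \<Rightarrow> real) \<Rightarrow> bool" where
  "bounded_observations M X \<longleftrightarrow>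
     (\<forall>n\<ge>1. X n \<in> borel_measurable M \<and> (\<forall>\<omega>\<in>space M. X n \<omega> \<in> {0..1})) \<and>
     (\<forall>\<nu>. prob_space \<nu> \<and> sets \<nu> = sets borel \<and> (AE x in \<nu>. x \<in> {0..1}) \<longrightarrow>
        (\<exists>P\<in>iid_laws M X. distr P borel (X 1) = \<nu>))"

definition null_class :: "'a measure \<Rightarrow> (nat \<Rightarrow> 'a \<Rightarrow> real) \<Rightarrow> real \<Rightarrow> 'a measure set" where
  "null_class M X \<mu>0 = {P \<in> iid_laws M X. (\<integral>\<omega>. X 1 \<omega> \<partial>P) \<le> \<mu>0}"

definition alt_class :: "'a measure \<Rightarrow> (nat \<Rightarrow> 'a \<Rightarrow> real) \<Rightarrow> real \<Rightarrow> 'a measure set" where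
  "alt_class M X \<mu>0 = {Q \<in> iid_laws M X. (\<integral>\<omega>. X 1 \<omega> \<partial>Q) > \<mu>0}"

text \<open>The logarithm on \<open>[0,\<infinity>)\<close> with \<open>log 0 = -\<infinity>\<close> (arguments below are never negative).\<close>

definition elog :: "real \<Rightarrow> ereal" where
  "elog x = (if x \<le> 0 then -\<infinity> else ereal (ln x))"

text \<open>Expectation of an extended-real random variable whose positive or negative part is
  integrable. Below it is applied to \<open>log (1 + \<gamma> (X\<^sub>1 - \<mu>\<^sub>0))\<close>, which is bounded above but may have
  expectation \<open>-\<infinity>\<close> if \<open>\<gamma> = 1/\<mu>\<^sub>0\<close>.\<close>

definition eexpectation :: "'a measure \<Rightarrow> ('a \<Rightarrow> ereal) \<Rightarrow> ereal" where
  "eexpectation P f =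
     enn2ereal (\<integral>\<^sup>+\<omega>. e2ennreal (f \<omega>) \<partial>P) - enn2ereal (\<integral>\<^sup>+\<omega>. e2ennreal (- f \<omega>) \<partial>P)"

definition log_growth :: "'a measure \<Rightarrow> (nat \<Rightarrow> 'a \<Rightarrow> real) \<Rightarrow> real \<Rightarrow> real \<Rightarrow> ereal" where
  "log_growth Q X \<mu>0 g = eexpectation Q (\<lambda>\<omega>. elog (1 + g * (X 1 \<omega> - \<mu>0)))"

definition wealth :: "(nat \<Rightarrow> 'a \<Rightarrow> real) \<Rightarrow> real \<Rightarrow> (nat \<Rightarrow> 'a \<Rightarrow> real) \<Rightarrow> nat \<Rightarrow> 'a \<Rightarrow> real" where
  "wealth X \<mu>0 \<gamma> n \<omega> = (\<Prod>i=1..n. 1 + \<gamma> i \<omega> * (X i \<omega> - \<mu>0))"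

definition sublinear_portfolio_regret ::
  "'a measure \<Rightarrow> (nat \<Rightarrow> 'a \<Rightarrow> real) \<Rightarrow> real \<Rightarrow> (nat \<Rightarrow> 'a \<Rightarrow> real) \<Rightarrow> bool" where
  "sublinear_portfolio_regret M X \<mu>0 \<gamma> \<longleftrightarrow>
     (\<exists>r::nat \<Rightarrow> real. r \<in> o(\<lambda>n. real n) \<and>
        (\<forall>n\<ge>1. \<forall>\<omega>\<in>space M.
           (SUP g\<in>{0..1/\<mu>0}. \<Sum>i=1..n. elog (1 + g * (X i \<omega> - \<mu>0))) - elog (wealth X \<mu>0 \<gamma> n \<omega>)
             \<le> ereal (r n)))"

definition adapted_process ::
  "'a measure \<Rightarrow> (nat \<Rightarrow> 'a \<Rightarrow> real) \<Rightarrow> (nat \<Rightarrow> 'a \<Rightarrow> real) \<Rightarrow> bool" where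
  "adapted_process M X Y \<longleftrightarrow> (\<forall>n\<ge>1. Y n \<in> borel_measurable (nat_filtration M X (enat n)))"

definition predictable_process ::
  "'a measure \<Rightarrow> (nat \<Rightarrow> 'a \<Rightarrow> real) \<Rightarrow> (nat \<Rightarrow> 'a \<Rightarrow> real) \<Rightarrow> bool" where
  "predictable_process M X Y \<longleftrightarrow>
     (\<forall>n\<ge>1. Y n \<in> borel_measurable (nat_filtration M X (enat (n - 1))))"

definition nonneg_process :: "'a measure \<Rightarrow> (nat \<Rightarrow> 'a \<Rightarrow> real) \<Rightarrow> bool" where
  "nonneg_process M Y \<longleftrightarrow> (\<forall>n\<ge>1. \<forall>\<omega>\<in>space M. 0 \<le> Y n \<omega>)"

definition test_supermartingale ::
  "'a measure \<Rightarrow> (nat \<Rightarrow> 'a \<Rightarrow> real) \<Rightarrow> 'a measure \<Rightarrow> (nat \<Rightarrow> 'a \<Rightarrow> real) \<Rightarrow> bool" where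
  "test_supermartingale M X P Y \<longleftrightarrow>
     nonneg_process M Y \<and> adapted_process M X Y \<and>
     (\<integral>\<^sup>+\<omega>. ennreal (Y 1 \<omega>) \<partial>P) \<le> 1 \<and>
     (\<forall>n\<ge>2. AE \<omega> in P.
        nn_cond_exp P (nat_filtration M X (enat (n - 1))) (\<lambda>\<omega>. ennreal (Y n \<omega>)) \<omega>
          \<le> ennreal (Y (n - 1) \<omega>))"

definition e_process ::
  "'a measure \<Rightarrow> (nat \<Rightarrow> 'a \<Rightarrow> real) \<Rightarrow> real \<Rightarrow> (nat \<Rightarrow> 'a \<Rightarrow> real) \<Rightarrow> bool" where
  "e_process M X \<mu>0 W' \<longleftrightarrow>
     nonneg_process M W' \<and> adapted_process M X W' \<and>
     (\<forall>P\<in>null_class M X \<mu>0. \<exists>Y. test_supermartingale M X P Y \<and>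
        (AE \<omega> in P. \<forall>n\<ge>1. W' n \<omega> \<le> Y n \<omega>))"

definition hitting_time ::
  "(nat \<Rightarrow> 'a \<Rightarrow> real) \<Rightarrow> real \<Rightarrow> (nat \<Rightarrow> 'a \<Rightarrow> real) \<Rightarrow> real \<Rightarrow> 'a \<Rightarrow> enat" where
  "hitting_time X \<mu>0 \<gamma> \<alpha> \<omega> = Inf {enat n | n. 1 \<le> n \<and> wealth X \<mu>0 \<gamma> n \<omega> \<ge> 1 / \<alpha>}"

text \<open>\<open>E\<^sub>Q[\<tau>] / log (1/\<alpha>)\<close>, possibly \<open>\<infinity>\<close>.\<close>

definition scaled_mean_time :: "'a measure \<Rightarrow> real \<Rightarrow> ('a \<Rightarrow> enat) \<Rightarrow> ereal" where
  "scaled_mean_time Q \<alpha> \<tau> =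
     enn2ereal (\<integral>\<^sup>+\<omega>. ennreal_of_enat (\<tau> \<omega>) \<partial>Q) / ereal (ln (1 / \<alpha>))"

lemma bounded_observations_canonical:
  "bounded_observations (Pi\<^sub>M (UNIV :: nat set) (\<lambda>_. restrict_space borel {0..1::real})) (\<lambda>n \<omega>. \<omega> n)"
  (is "bounded_observations ?M ?X")
proof -
  have meas: "?X n \<in> borel_measurable ?M" for n
  proof -
    have "?X n \<in> ?M \<rightarrow>\<^sub>M restrict_space borel {0..1::real}"
      by (rule measurable_component_singleton) simp
    then show ?thesis by (simp add: measurable_restrict_space2_iff)
  qed
  have range: "?X n \<omega> \<in> {0..1}" if "\<omega> \<in> space ?M" for n \<omega>
    using that by (auto simp: space_PiM space_restrict_space PiE_iff)
  have "\<exists>P\<in>iid_laws ?M ?X. distr P borel (?X 1) = \<nu>"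
    if \<nu>: "prob_space \<nu>" "sets \<nu> = sets borel" "AE x in \<nu>. x \<in> {0..1}" for \<nu>
  proof -
    interpret \<nu>: prob_space \<nu> by (rule \<nu>(1))
    define N where "N = restrict_space \<nu> {0..1}"
    have I: "{0..1} \<in> sets \<nu>" "space \<nu> = UNIV"
      using \<nu>(2) sets_eq_imp_space_eq[OF \<nu>(2)] by auto
    have N: "prob_space N"
    proof
      have "emeasure \<nu> {0..1} = 1"
        using \<nu>.prob_eq_1[OF I(1)] \<nu>(3) by (simp add: \<nu>.emeasure_eq_measure)
      then show "emeasure N (space N) = 1"
        using I by (simp add: N_def emeasure_restrict_space space_restrict_space)
    qed
    have sN: "sets N = sets (restrict_space borel {0..1})"
      unfolding N_def by (rule sets_restrict_space_cong[OF \<nu>(2)])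
    have idN: "(\<lambda>x. x) \<in> N \<rightarrow>\<^sub>M borel"
      unfolding N_def using \<nu>(2) by (intro measurable_restrict_space1) (simp cong: measurable_cong_sets)
    have dN: "distr N borel (\<lambda>x. x) = \<nu>"
    proof (rule measure_eqI)
      fix A assume "A \<in> sets (distr N borel (\<lambda>x. x))"
      then have A: "A \<in> sets borel" by simp
      have "emeasure (distr N borel (\<lambda>x. x)) A = emeasure \<nu> (A \<inter> {0..1})"
      proof -
        have "emeasure (distr N borel (\<lambda>x. x)) A = emeasure N (A \<inter> {0..1})"
          using emeasure_distr[OF idN A] I by (simp add: N_def space_restrict_space)
        then show ?thesis using I by (simp add: N_def emeasure_restrict_space)
      qed
      also have "\<dots> = emeasure \<nu> A"
        using \<nu>(3) A I \<nu>(2) by (intro emeasure_eq_AE) auto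
      finally show "emeasure (distr N borel (\<lambda>x. x)) A = emeasure \<nu> A" .
    qed (simp add: \<nu>(2))
    define P where "P = Pi\<^sub>M (UNIV :: nat set) (\<lambda>_. N)"
    interpret P: prob_space P unfolding P_def by (intro prob_space_PiM N)
    have sP: "sets P = sets ?M" unfolding P_def by (intro sets_PiM_cong refl sN)
    have comp: "?X n \<in> P \<rightarrow>\<^sub>M N" for n unfolding P_def by simp
    have dcomp: "distr P N (?X n) = N" for n
      unfolding P_def by (rule distr_PiM_component) (use N in auto)
    have "P.indep_vars (\<lambda>_. N) ?X UNIV"
      by (subst P.indep_vars_iff_distr_eq_PiM)
        (use comp in \<open>simp_all add: dcomp\<close>, simp add: P_def restrict_def distr_id)
    then have "P.indep_vars (\<lambda>_. borel) ?X UNIV"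
      using P.indep_vars_compose2[of "\<lambda>_. N" ?X UNIV "\<lambda>_ x. x" "\<lambda>_. borel"] idN by simp
    then have ind: "P.indep_vars (\<lambda>_. borel) ?X {1..}"
      by (rule P.indep_vars_subset) simp
    have dist: "distr P borel (?X n) = \<nu>" for n
      using distr_distr[OF idN comp, of n] by (simp add: dcomp dN comp_def)
    have "P \<in> iid_laws ?M ?X"
      unfolding iid_laws_def using P.prob_space_axioms sP ind dist by simp
    with dist show ?thesis by blast
  qed
  with meas range show ?thesis unfolding bounded_observations_def by blast
qed

end

theory Submission
  imports Defs
begin

text \<open>
  Everything rests on one pair of laws. Let \<open>q\<close> be the law of \<open>X\<^sub>1\<close> under \<open>Q\<close>, let \<open>g\<close> maximise
  \<open>E\<^sub>Q[ln (1 + g (X\<^sub>1 - \<mu>0))]\<close> over \<open>[0, 1/\<mu>0]\<close>, let \<open>L\<close> be the maximum and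
  \<open>f x = 1 + g (x - \<mu>0)\<close>. A maximiser exists because the objective is upper semicontinuous (Fatou),
  and \<open>L > 0\<close> because a small bet already grows when the mean exceeds \<open>\<mu>0\<close>.

  First-order optimality of \<open>g\<close> says that no other bet beats it in expected ratio:
  \<open>E\<^sub>Q[(1 + h (X\<^sub>1 - \<mu>0)) / f X\<^sub>1] \<le> 1\<close> for all \<open>h\<close> (lemma \<open>numeraire\<close>). For \<open>h = 0\<close> this bounds
  the mass of \<open>q / f\<close> by 1; for \<open>h = 1/\<mu>0\<close> it bounds its first moment by \<open>\<mu>0\<close>. Putting the missing
  mass at 0 yields a probability law on \<open>[0,1]\<close> with mean at most \<open>\<mu>0\<close> (\<open>dual_law\<close>),
  and \<open>q\<close> has density \<open>f\<close> with respect to it. Let \<open>P\<close> be the null distribution with this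
  marginal. On \<open>\<F>\<^sub>n\<close>, \<open>Q\<close> has density \<open>V\<^sub>n = \<Prod>\<^sub>i\<^sub>\<le>\<^sub>n f X\<^sub>i\<close> with respect to \<open>P\<close>: the wealth of the
  best constant bet is the likelihood ratio against a single null distribution.

  Upper bound on growth. If \<open>Y\<^sub>n \<ge> 0\<close> is adapted and \<open>E\<^sub>P[Y\<^sub>n] \<le> 1\<close>, then \<open>E\<^sub>Q[Y\<^sub>n / V\<^sub>n] \<le> 1\<close>, so by Markov and
  Borel--Cantelli \<open>Y\<^sub>n < e\<^bsup>n\<delta>\<^esup> V\<^sub>n\<close> eventually, and \<open>ln V\<^sub>n / n\<close> is eventually below \<open>L + 2\<delta>\<close> by the law of large numbers.
  Both e-processes and the wealth itself are such \<open>Y\<close> (\<open>limsup_growth_le\<close>). Lower bound on growth. The regret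
  condition compares the wealth with any constant bet in hindsight, in particular with
  \<open>(1 - t) g\<close>, whose log returns are bounded (\<open>liminf_growth_ge\<close>).

  Stopping times. Let \<open>\<tau>\<close> satisfy \<open>P(\<tau> < \<infinity>) \<le> \<alpha>\<close>. The change of measure gives
  \<open>E\<^sub>Q[1 / V\<^sub>\<tau>] \<le> \<alpha>\<close>, hence \<open>E\<^sub>Q[ln V\<^sub>\<tau>] \<ge> ln (1/\<alpha>)\<close> by Jensen, while Wald's identity says
  \<open>E\<^sub>Q[ln V\<^sub>\<tau>] = L E\<^sub>Q[\<tau>]\<close> if \<open>E\<^sub>Q[\<tau>]\<close> is finite (\<open>mean_stopping_time_ge\<close>). By Ville's inequality this applies to the hitting time
  \<open>\<tau>\<^sub>\<alpha>\<close> of \<open>1/\<alpha>\<close>. Conversely, for \<open>b < L\<close> and large \<open>n \<ge> ln (1/\<alpha>) / b\<close>, the event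
  \<open>\<tau>\<^sub>\<alpha> > n\<close> is a large deviation of a bounded i.i.d. sum, so Hoeffding's inequality gives
  \<open>E\<^sub>Q[\<tau>\<^sub>\<alpha>] \<le> ln (1/\<alpha>) / b + C\<close> with \<open>C\<close> independent of \<open>\<alpha>\<close> (\<open>mean_hitting_time_le\<close>).

  Exponential tails make all strong laws below instances of Hoeffding's inequality plus
  Borel--Cantelli; the one unbounded variable, \<open>ln (f X\<^sub>1)\<close>, is reached by truncation from below
  or by shrinking the bet.
\<close>

section \<open>Preliminaries\<close>

text \<open>The tail-sum formula for expectations of stopping times comes from this pointwise identity.\<close>
lemma ennreal_of_enat_eq_suminf: "ennreal_of_enat t = (\<Sum>i. if enat i < t then 1 else 0)"
proof (cases t)
  case (enat n)
  have "(\<Sum>i. if enat i < t then 1 else 0 :: ennreal) = (\<Sum>i<n. if enat i < t then 1 else 0)"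
    by (rule suminf_finite) (auto simp: enat)
  also have "\<dots> = (\<Sum>i<n. 1)" by (intro sum.cong refl) (auto simp: enat)
  finally show ?thesis by (simp add: enat ennreal_of_nat_eq_real_of_nat)
next
  case infinity
  have "(\<Sum>i. 1 :: ennreal) = top" by (simp add: suminf_eq_SUP ennreal_SUP_of_nat_eq_top)
  then show ?thesis by (simp add: infinity)
qed

lemma markov_inequality_space:
  fixes u :: "'a \<Rightarrow> ennreal"
  assumes u[measurable]: "u \<in> borel_measurable N"
  shows "emeasure N {x \<in> space N. 1 \<le> c * u x} \<le> c * (\<integral>\<^sup>+x. u x \<partial>N)"
proof -
  have "emeasure N {x \<in> space N. 1 \<le> c * u x} \<le> c * (\<integral>\<^sup>+x. u x * indicator (space N) x \<partial>N)"
    by (rule nn_integral_Markov_inequality) measurable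
  also have "(\<integral>\<^sup>+x. u x * indicator (space N) x \<partial>N) = (\<integral>\<^sup>+x. u x \<partial>N)"
    by (intro nn_integral_cong) simp
  finally show ?thesis .
qed

section \<open>Expectations of logarithms\<close>

lemma eexpectation_elog_eq:
  assumes "prob_space N" and f[measurable]: "f \<in> borel_measurable N"
    and pos: "AE x in N. 0 < f x" and int: "integrable N (\<lambda>x. ln (f x))"
  shows "eexpectation N (\<lambda>x. elog (f x)) = ereal (\<integral>x. ln (f x) \<partial>N)"
proof -
  interpret prob_space N by fact
  have p: "(\<integral>\<^sup>+x. e2ennreal (elog (f x)) \<partial>N) = (\<integral>\<^sup>+x. ennreal (ln (f x)) \<partial>N)"
    by (intro nn_integral_cong_AE eventually_mono[OF pos]) (auto simp: elog_def ennreal.abs_eq)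
  have n: "(\<integral>\<^sup>+x. e2ennreal (- elog (f x)) \<partial>N) = (\<integral>\<^sup>+x. ennreal (- ln (f x)) \<partial>N)"
    by (intro nn_integral_cong_AE eventually_mono[OF pos]) (auto simp: elog_def ennreal.abs_eq)
  have fin: "(\<integral>\<^sup>+x. ennreal (ln (f x)) \<partial>N) \<noteq> \<infinity>" "(\<integral>\<^sup>+x. ennreal (- ln (f x)) \<partial>N) \<noteq> \<infinity>"
    using int unfolding real_integrable_def by auto
  obtain a b where ab: "(\<integral>\<^sup>+x. ennreal (ln (f x)) \<partial>N) = ennreal a" "0 \<le> a"
     "(\<integral>\<^sup>+x. ennreal (- ln (f x)) \<partial>N) = ennreal b" "0 \<le> b"
    using fin by (metis ennreal_cases infinity_ennreal_def)
  show ?thesis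
    unfolding eexpectation_def p n real_lebesgue_integral_def[OF int] ab using ab(2,4)
    by (simp add: enn2ereal_ennreal)
qed

text \<open>Since \<open>f\<close> is bounded above, the positive part of \<open>ln f\<close> is integrable, so the only way for the
  extended expectation to be finite is that the negative part is integrable too; in particular
  \<open>f\<close> cannot vanish with positive probability.\<close>
lemma eexpectation_elog_finiteD:
  assumes "prob_space N" and f[measurable]: "f \<in> borel_measurable N"
    and le: "AE x in N. f x \<le> C" and fin: "eexpectation N (\<lambda>x. elog (f x)) \<noteq> -\<infinity>"
  shows "AE x in N. 0 < f x" and "integrable N (\<lambda>x. ln (f x))"
proof -
  interpret prob_space N by fact
  define K where "K = max C 1"
  have K: "1 \<le> K" "AE x in N. f x \<le> K" using le by (auto simp: K_def max_def)
  have [measurable]: "(\<lambda>x. elog (f x)) \<in> borel_measurable N"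
    unfolding elog_def by measurable
  have "(\<integral>\<^sup>+x. e2ennreal (elog (f x)) \<partial>N) \<le> (\<integral>\<^sup>+x. ennreal (ln K) \<partial>N)"
  proof (intro nn_integral_mono_AE eventually_mono[OF K(2)])
    fix x assume "f x \<le> K"
    then show "e2ennreal (elog (f x)) \<le> ennreal (ln K)"
      using K(1) by (auto simp: elog_def e2ennreal_neg ennreal.abs_eq[symmetric] intro!: e2ennreal_mono)
  qed
  also have "\<dots> < \<infinity>" by (simp add: emeasure_space_1)
  finally have pf: "(\<integral>\<^sup>+x. e2ennreal (elog (f x)) \<partial>N) < \<infinity>" .
  have nf: "(\<integral>\<^sup>+x. e2ennreal (- elog (f x)) \<partial>N) \<noteq> \<infinity>"
  proof
    assume "(\<integral>\<^sup>+x. e2ennreal (- elog (f x)) \<partial>N) = \<infinity>"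
    moreover obtain a where "(\<integral>\<^sup>+x. e2ennreal (elog (f x)) \<partial>N) = ennreal a" "0 \<le> a"
      using pf by (metis ennreal_cases infinity_ennreal_def less_irrefl)
    ultimately show False using fin by (simp add: eexpectation_def enn2ereal_ennreal)
  qed
  have "AE x in N. e2ennreal (- elog (f x)) \<noteq> \<infinity>"
    by (rule nn_integral_noteq_infinite[OF _ nf]) measurable
  then show pos: "AE x in N. 0 < f x"
    by eventually_elim (auto simp: elog_def split: if_splits)
  have "(\<integral>\<^sup>+x. e2ennreal (elog (f x)) \<partial>N) = (\<integral>\<^sup>+x. ennreal (ln (f x)) \<partial>N)"
    by (intro nn_integral_cong_AE eventually_mono[OF pos]) (auto simp: elog_def ennreal.abs_eq)
  moreover have "(\<integral>\<^sup>+x. e2ennreal (- elog (f x)) \<partial>N) = (\<integral>\<^sup>+x. ennreal (- ln (f x)) \<partial>N)"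
    by (intro nn_integral_cong_AE eventually_mono[OF pos]) (auto simp: elog_def ennreal.abs_eq)
  ultimately show "integrable N (\<lambda>x. ln (f x))"
    unfolding real_integrable_def using pf nf by auto
qed

lemma integrable_ln_bounds:
  fixes f :: "'a \<Rightarrow> real"
  assumes "prob_space N" "f \<in> borel_measurable N" "0 < a" "AE x in N. a \<le> f x \<and> f x \<le> b"
  shows "integrable N (\<lambda>x. ln (f x))"
proof -
  interpret prob_space N by fact
  show ?thesis
  proof (rule integrable_const_bound)
    show "AE x in N. norm (ln (f x)) \<le> max \<bar>ln a\<bar> \<bar>ln b\<bar>"
      using assms(4)
    proof eventually_elim
      case (elim x)
      then have "ln a \<le> ln (f x)" "ln (f x) \<le> ln b" using assms(3) by auto
      then show ?case by auto
    qed
  qed (use assms in measurable)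
qed

section \<open>Maximising the expected logarithmic growth\<close>

locale favorable_law = prob_space q for q :: "real measure" +
  fixes \<mu>0 :: real
  assumes sets_q [measurable_cong]: "sets q = sets borel"
    and unit_q: "AE x in q. x \<in> {0..1}"
    and mu0_pos: "0 < \<mu>0"
    and mean_q: "\<mu>0 < (\<integral>x. x \<partial>q)"
begin

abbreviation payoff :: "real \<Rightarrow> real \<Rightarrow> real" where
  "payoff g x \<equiv> 1 + g * (x - \<mu>0)"

abbreviation growth :: "real \<Rightarrow> ereal" where
  "growth g \<equiv> eexpectation q (\<lambda>x. elog (payoff g x))"

abbreviation bets :: "real set" where "bets \<equiv> {0..1/\<mu>0}"

lemma integrable_id: "integrable q (\<lambda>x. x)"
  by (rule integrable_const_bound[where B=1], rule eventually_mono[OF unit_q]) auto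

lemma mu0_less_1: "\<mu>0 < 1"
proof -
  have "(\<integral>x. x \<partial>q) \<le> (\<integral>x. 1 \<partial>q)"
    by (intro integral_mono_AE integrable_id eventually_mono[OF unit_q]) auto
  then show ?thesis using mean_q by (simp add: prob_space)
qed

lemma payoff_nonneg: "g \<in> bets \<Longrightarrow> x \<in> {0..1} \<Longrightarrow> 0 \<le> payoff g x"
proof -
  assume g: "g \<in> bets" and x: "x \<in> {0..1}"
  have "g * \<mu>0 \<le> 1" "0 \<le> g * x" using g x mu0_pos by (auto simp: field_simps)
  then show ?thesis by (simp add: algebra_simps)
qed

lemma payoff_le: "g \<in> bets \<Longrightarrow> x \<in> {0..1} \<Longrightarrow> payoff g x \<le> 1 / \<mu>0"
proof -
  assume g: "g \<in> bets" and x: "x \<in> {0..1}"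
  have "g * (x - \<mu>0) \<le> g * (1 - \<mu>0)" using g x by (intro mult_left_mono) auto
  also have "\<dots> \<le> 1/\<mu>0 * (1 - \<mu>0)" using g mu0_less_1 by (intro mult_right_mono) auto
  finally show ?thesis using mu0_pos by (simp add: field_simps)
qed

lemma growth_finiteD:
  assumes "g \<in> bets" "growth g \<noteq> -\<infinity>"
  shows "AE x in q. 0 < payoff g x" "integrable q (\<lambda>x. ln (payoff g x))"
    "growth g = ereal (\<integral>x. ln (payoff g x) \<partial>q)"
proof -
  have le: "AE x in q. payoff g x \<le> 1/\<mu>0"
    using unit_q by eventually_elim (rule payoff_le[OF assms(1)])
  show *: "AE x in q. 0 < payoff g x" "integrable q (\<lambda>x. ln (payoff g x))"
    by (rule eexpectation_elog_finiteD[OF prob_space_axioms _ le assms(2)], measurable)+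
  show "growth g = ereal (\<integral>x. ln (payoff g x) \<partial>q)"
    by (rule eexpectation_elog_eq[OF prob_space_axioms _ *]) measurable
qed

text \<open>The shortfall of the log return from its largest possible value \<open>ln (1/\<mu>0)\<close>. Being
  nonnegative, it is open to Fatou's lemma, also at the endpoint \<open>g = 1/\<mu>0\<close>, where the log return may be
  \<open>-\<infinity>\<close>.\<close>
definition loss :: "real \<Rightarrow> real \<Rightarrow> ennreal" where
  "loss g x = (if payoff g x \<le> 0 then \<infinity> else ennreal (ln (1/\<mu>0) - ln (payoff g x)))"

lemma loss_measurable [measurable]: "loss g \<in> borel_measurable borel"
  unfolding loss_def[abs_def] by measurable

lemma growth_eq_loss:
  assumes g: "g \<in> bets"
  shows "growth g = ereal (ln (1/\<mu>0)) - enn2ereal (\<integral>\<^sup>+x. loss g x \<partial>q)"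
proof -
  let ?c = "ln (1/\<mu>0)"
  have key: "growth g = ereal ?c - enn2ereal (\<integral>\<^sup>+x. loss g x \<partial>q)"
    and key2: "(\<integral>\<^sup>+x. loss g x \<partial>q) \<noteq> \<infinity>"
    if pos: "AE x in q. 0 < payoff g x" and int: "integrable q (\<lambda>x. ln (payoff g x))"
  proof -
    have "(\<integral>\<^sup>+x. loss g x \<partial>q) = (\<integral>\<^sup>+x. ennreal (?c - ln (payoff g x)) \<partial>q)"
      by (intro nn_integral_cong_AE eventually_mono[OF pos]) (auto simp: loss_def)
    also have "\<dots> = ennreal (\<integral>x. ?c - ln (payoff g x) \<partial>q)"
    proof (rule nn_integral_eq_integral)
      show "AE x in q. 0 \<le> ?c - ln (payoff g x)" using unit_q pos
      proof eventually_elim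
        case (elim x) then show ?case using payoff_le[OF g elim(1)] mu0_pos by simp
      qed
    qed (use int in auto)
    finally have E: "(\<integral>\<^sup>+x. loss g x \<partial>q) = ennreal (?c - (\<integral>x. ln (payoff g x) \<partial>q))"
      using int by (simp add: prob_space)
    have "(\<integral>x. ln (payoff g x) \<partial>q) \<le> (\<integral>x. ?c \<partial>q)"
    proof (intro integral_mono_AE int)
      show "AE x in q. ln (payoff g x) \<le> ?c" using unit_q pos
      proof eventually_elim
        case (elim x) then show ?case using payoff_le[OF g elim(1)] mu0_pos by simp
      qed
    qed simp
    then have "(\<integral>x. ln (payoff g x) \<partial>q) \<le> ?c" by (simp add: prob_space)
    moreover have "growth g = ereal (\<integral>x. ln (payoff g x) \<partial>q)"
      by (rule eexpectation_elog_eq[OF prob_space_axioms _ pos int]) measurable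
    ultimately show "growth g = ereal ?c - enn2ereal (\<integral>\<^sup>+x. loss g x \<partial>q)"
      unfolding E by (simp add: enn2ereal_ennreal)
    show "(\<integral>\<^sup>+x. loss g x \<partial>q) \<noteq> \<infinity>" unfolding E by simp
  qed
  show ?thesis
  proof (cases "(\<integral>\<^sup>+x. loss g x \<partial>q) = \<infinity>")
    case True
    have "growth g = -\<infinity>"
      using growth_finiteD[OF g] key2 True by blast
    then show ?thesis using True by simp
  next
    case False
    have pos: "AE x in q. 0 < payoff g x"
      using nn_integral_noteq_infinite[OF _ False] by (auto simp: loss_def elim!: eventually_mono split: if_splits)
    have "integrable q (\<lambda>x. ?c - ln (payoff g x))"
    proof (rule integrableI_nonneg)
      show "AE x in q. 0 \<le> ?c - ln (payoff g x)" using unit_q pos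
      proof eventually_elim
        case (elim x) then show ?case using payoff_le[OF g elim(1)] mu0_pos by simp
      qed
      have "(\<integral>\<^sup>+x. ennreal (?c - ln (payoff g x)) \<partial>q) = (\<integral>\<^sup>+x. loss g x \<partial>q)"
        by (intro nn_integral_cong_AE eventually_mono[OF pos]) (auto simp: loss_def)
      then show "(\<integral>\<^sup>+x. ennreal (?c - ln (payoff g x)) \<partial>q) < \<infinity>" using False by (simp add: less_top)
    qed measurable
    then have "integrable q (\<lambda>x. ?c - (?c - ln (payoff g x)))"
      by (rule Bochner_Integration.integrable_diff[rotated]) simp
    also have "(\<lambda>x. ?c - (?c - ln (payoff g x))) = (\<lambda>x. ln (payoff g x))" by auto
    finally show ?thesis by (rule key[OF pos])
  qed
qed

lemma loss_tendsto:
  assumes x: "x \<in> {0..1}" and gk: "\<And>k. gk k \<in> bets" and lim: "gk \<longlonglongrightarrow> g"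
  shows "(\<lambda>k. loss (gk k) x) \<longlonglongrightarrow> loss g x"
proof -
  have u: "(\<lambda>k. payoff (gk k) x) \<longlonglongrightarrow> payoff g x" by (intro tendsto_intros lim)
  have u0: "0 \<le> payoff (gk k) x" for k using payoff_nonneg[OF gk x] .
  then have g0: "0 \<le> payoff g x" using u LIMSEQ_le_const by blast
  show ?thesis
  proof (cases "payoff g x = 0")
    case False
    then have pos: "0 < payoff g x" using g0 by simp
    have "(\<lambda>k. ennreal (ln (1/\<mu>0) - ln (payoff (gk k) x))) \<longlonglongrightarrow> ennreal (ln (1/\<mu>0) - ln (payoff g x))"
      by (intro tendsto_intros u False tendsto_ennrealI)
    moreover have "eventually (\<lambda>k. ennreal (ln (1/\<mu>0) - ln (payoff (gk k) x)) = loss (gk k) x) sequentially"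
      using order_tendstoD(1)[OF u pos] by eventually_elim (auto simp: loss_def)
    ultimately show ?thesis using pos by (simp add: loss_def tendsto_cong)
  next
    case True
    have "(\<lambda>k. loss (gk k) x) \<longlonglongrightarrow> \<infinity>"
      unfolding tendsto_PInfty
    proof (rule tendsto_top_iff_ennreal[THEN iffD2, unfolded infinity_ennreal_def[symmetric], rule_format])
      fix l :: real assume "0 \<le> l"
      have "eventually (\<lambda>k. payoff (gk k) x < exp (ln (1/\<mu>0) - l - 1)) sequentially"
        using order_tendstoD(2)[OF u] True by simp
      then show "eventually (\<lambda>k. ennreal l < loss (gk k) x) sequentially"
      proof eventually_elim
        case (elim k)
        show ?case
        proof (cases "payoff (gk k) x = 0")
          case False
          then have "payoff (gk k) x > 0" using u0[of k] by simp
          then have "ln (payoff (gk k) x) < ln (1/\<mu>0) - l - 1"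
            using elim by (metis exp_gt_zero ln_exp ln_less_cancel_iff)
          then show ?thesis using False u0[of k] \<open>0 \<le> l\<close> by (auto simp: loss_def ennreal_less_iff)
        qed (simp add: loss_def)
      qed
    qed
    then show ?thesis using True by (simp add: loss_def)
  qed
qed

text \<open>A minimising sequence of bets for the expected loss has a convergent subsequence, and by Fatou's
  lemma the expected loss is lower semicontinuous along it.\<close>
lemma growth_arg_max_ex: "\<exists>g. is_arg_max growth (\<lambda>g. g \<in> bets) g"
proof -
  define H where "H g = (\<integral>\<^sup>+x. loss g x \<partial>q)" for g
  have ne: "H ` bets \<noteq> {}" using mu0_pos by auto
  obtain u where u: "\<And>n. u n \<in> H ` bets" "u \<longlonglongrightarrow> Inf (H ` bets)"
    using Inf_as_limit[OF ne] by blast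
  then have "\<forall>n. \<exists>g. g \<in> bets \<and> u n = H g" by blast
  then obtain gk where gk: "\<And>n. gk n \<in> bets" "\<And>n. u n = H (gk n)" by metis
  have "seq_compact bets" by (simp add: compact_imp_seq_compact)
  then obtain g r where g: "g \<in> bets" and r: "strict_mono r" and lim: "(gk \<circ> r) \<longlonglongrightarrow> g"
    using gk(1) unfolding seq_compact_def by metis
  have "H g \<le> (\<integral>\<^sup>+x. liminf (\<lambda>k. loss (gk (r k)) x) \<partial>q)"
    unfolding H_def
  proof (intro nn_integral_mono_AE eventually_mono[OF unit_q])
    fix x :: real assume "x \<in> {0..1}"
    then have "(\<lambda>k. loss ((gk \<circ> r) k) x) \<longlonglongrightarrow> loss g x"
      using gk(1) by (intro loss_tendsto lim) auto
    then show "loss g x \<le> liminf (\<lambda>k. loss (gk (r k)) x)"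
      using lim_imp_Liminf[OF trivial_limit_sequentially] by fastforce
  qed
  also have "\<dots> \<le> liminf (\<lambda>k. H (gk (r k)))"
    unfolding H_def by (rule nn_integral_liminf) measurable
  also have "liminf (\<lambda>k. H (gk (r k))) = Inf (H ` bets)"
    using LIMSEQ_subseq_LIMSEQ[OF u(2) r] gk(2)
    by (intro lim_imp_Liminf) (simp_all add: o_def)
  finally have "H g \<le> H g'" if "g' \<in> bets" for g'
    using that by (meson INF_lower order_trans)
  then have "growth g' \<le> growth g" if "g' \<in> bets" for g'
    using that g unfolding growth_eq_loss[OF that] growth_eq_loss[OF g] H_def
    by (intro ereal_minus_mono) (auto simp: less_eq_ennreal.rep_eq)
  then show ?thesis using g unfolding is_arg_max_linorder by blast
qed

lemma growth_eq_integral: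
  assumes g: "g \<in> bets" and "0 < a" and lower: "\<And>x. x \<in> {0..1} \<Longrightarrow> a \<le> payoff g x"
  shows "integrable q (\<lambda>x. ln (payoff g x))"
    and "growth g = ereal (\<integral>x. ln (payoff g x) \<partial>q)"
proof -
  have ab: "AE x in q. a \<le> payoff g x \<and> payoff g x \<le> 1/\<mu>0"
    using unit_q by eventually_elim (use lower payoff_le[OF g] in blast)
  show int: "integrable q (\<lambda>x. ln (payoff g x))"
    by (rule integrable_ln_bounds[OF prob_space_axioms _ \<open>0 < a\<close> ab]) measurable
  show "growth g = ereal (\<integral>x. ln (payoff g x) \<partial>q)"
    by (rule eexpectation_elog_eq[OF prob_space_axioms _ _ int], measurable)
      (use ab \<open>0 < a\<close> in \<open>auto elim!: eventually_mono\<close>)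
qed

text \<open>The derivative of the growth at \<open>g = 0\<close> is the mean excess \<open>d\<close>, which is positive; the
  second-order bound \<open>ln (1 + u) \<ge> u - 2 u\<^sup>2\<close> makes this quantitative.\<close>
lemma ex_growth_pos: "\<exists>g\<in>bets. 0 < growth g"
proof -
  define d where "d = (\<integral>x. x \<partial>q) - \<mu>0"
  define g where "g = min (1/2) (d/4)"
  have d: "0 < d" using mean_q by (simp add: d_def)
  have g: "0 < g" "g \<le> 1/2" "g \<le> d/4" using d by (auto simp: g_def)
  have "1 \<le> 1/\<mu>0" using mu0_pos mu0_less_1 by simp
  then have gb: "g \<in> bets" using g by auto
  have u: "\<bar>g * (x - \<mu>0)\<bar> \<le> g" if "x \<in> {0..1}" for x
  proof -
    have "\<bar>x - \<mu>0\<bar> \<le> 1" using that mu0_pos mu0_less_1 by auto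
    then have "g * \<bar>x - \<mu>0\<bar> \<le> g * 1" using g by (intro mult_left_mono) auto
    then show ?thesis using g by (simp add: abs_mult)
  qed
  have lower: "1/2 \<le> payoff g x" if "x \<in> {0..1}" for x
    using u[OF that] g by (auto simp: abs_le_iff)
  have lb: "g * (x - \<mu>0) - 2 * g\<^sup>2 \<le> ln (payoff g x)" if "x \<in> {0..1}" for x
  proof -
    have "\<bar>ln (1 + g * (x - \<mu>0)) - g * (x - \<mu>0)\<bar> \<le> 2 * (g * (x - \<mu>0))\<^sup>2"
      using u[OF that] g by (intro abs_ln_one_plus_x_minus_x_bound) auto
    moreover have "(g * (x - \<mu>0))\<^sup>2 \<le> g\<^sup>2" using u[OF that] by (metis abs_le_square_iff abs_of_pos g(1))
    ultimately show ?thesis by linarith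
  qed
  note int = growth_eq_integral[OF gb _ lower, simplified]
  have "g * d - 2 * g\<^sup>2 = (\<integral>x. g * (x - \<mu>0) - 2 * g\<^sup>2 \<partial>q)"
    using integrable_id by (simp add: prob_space d_def algebra_simps)
  also have "\<dots> \<le> (\<integral>x. ln (payoff g x) \<partial>q)"
    by (intro integral_mono_AE int(1) eventually_mono[OF unit_q] lb) (use integrable_id in auto)
  finally have "g * (d - 2 * g) \<le> (\<integral>x. ln (payoff g x) \<partial>q)"
    by (simp add: power2_eq_square algebra_simps)
  moreover have "0 < g * (d - 2 * g)" using g d by (intro mult_pos_pos) auto
  ultimately show ?thesis using int(2) gb by (intro bexI[of _ g]) auto
qed

end

section \<open>The numeraire property and the dual null law\<close>

locale optimal_bet = favorable_law +
  fixes g :: real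
  assumes arg_max: "is_arg_max growth (\<lambda>g. g \<in> bets) g"
begin

lemma g_bets: "g \<in> bets" and growth_le: "g' \<in> bets \<Longrightarrow> growth g' \<le> growth g"
  using arg_max by (auto simp: is_arg_max_linorder)

definition rate :: real where "rate = (\<integral>x. ln (payoff g x) \<partial>q)"

lemma growth_pos: "0 < growth g"
proof -
  obtain g' where "g' \<in> bets" "0 < growth g'" using ex_growth_pos by blast
  then show ?thesis using growth_le[of g'] by simp
qed

lemma payoff_pos: "AE x in q. 0 < payoff g x"
  and integrable_ln_payoff: "integrable q (\<lambda>x. ln (payoff g x))"
  and growth_eq_rate: "growth g = ereal rate"
proof -
  have fin: "growth g \<noteq> -\<infinity>" using growth_pos by auto
  show "AE x in q. 0 < payoff g x" "integrable q (\<lambda>x. ln (payoff g x))" "growth g = ereal rate"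
    using growth_finiteD[OF g_bets fin] by (simp_all only: rate_def)
qed

lemma rate_pos: "0 < rate"
  using growth_pos growth_eq_rate by simp

lemma payoff_convex:
  "payoff ((1 - t) * g + t * g') x = (1 - t) * payoff g x + t * payoff g' x"
  by (simp add: algebra_simps)

text \<open>Moving from \<open>g\<close> a fraction \<open>t\<close> towards \<open>g'\<close> multiplies the payoff by \<open>1 - t + t R\<close>, where
  \<open>R\<close> is the ratio of payoffs, and by optimality this does not increase the expected logarithm. The
  difference quotients \<open>\<phi>\<close> converge to \<open>R - 1\<close> as \<open>t\<close> tends to 0 and are bounded below by \<open>-2\<close>,
  so Fatou's lemma turns \<open>E[\<phi>] \<le> 0\<close> into \<open>E[R] \<le> 1\<close>.\<close>
lemma numeraire:
  assumes g': "g' \<in> bets"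
  shows "(\<integral>\<^sup>+x. ennreal (payoff g' x / payoff g x) \<partial>q) \<le> 1"
proof -
  define t :: "nat \<Rightarrow> real" where "t k = 1 / (real k + 2)" for k
  define R where "R x = payoff g' x / payoff g x" for x
  define \<phi> where "\<phi> k x = ln (1 - t k + t k * R x) / t k" for k x
  have t: "0 < t k" "t k \<le> 1/2" for k by (auto simp: t_def field_simps)
  have t0: "t \<longlonglongrightarrow> 0" unfolding t_def
    using LIMSEQ_ignore_initial_segment[OF lim_1_over_n, of 2] by (simp add: add.commute)
  have good: "AE x in q. x \<in> {0..1} \<and> 0 < payoff g x" using unit_q payoff_pos by eventually_elim auto
  have R0: "0 \<le> R x" if "x \<in> {0..1} \<and> 0 < payoff g x" for x
    using that payoff_nonneg[OF g', of x] by (auto simp: R_def)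
  have lim: "(\<lambda>k. \<phi> k x) \<longlonglongrightarrow> R x - 1" for x
  proof -
    have "((\<lambda>s. ln (1 + s * (R x - 1))) has_real_derivative (R x - 1)) (at 0)"
      by (auto intro!: derivative_eq_intros)
    then have "((\<lambda>s. ln (1 + s * (R x - 1)) / s) \<longlongrightarrow> R x - 1) (at 0)"
      by (simp add: DERIV_def)
    moreover have "filterlim t (at 0) sequentially"
      unfolding filterlim_at using t0 t(1) by (auto intro!: always_eventually simp: less_imp_neq[THEN not_sym])
    ultimately have "(\<lambda>k. ln (1 + t k * (R x - 1)) / t k) \<longlonglongrightarrow> R x - 1"
      by (rule filterlim_compose)
    then show ?thesis by (simp add: \<phi>_def algebra_simps)
  qed
  have lower: "- 2 \<le> \<phi> k x" if "x \<in> {0..1} \<and> 0 < payoff g x" for k x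
  proof -
    have "- 2 * t k \<le> ln (1 - t k)"
    proof -
      have "- t k - 2 * (t k)\<^sup>2 \<le> ln (1 - t k)"
        using t[of k] by (intro ln_one_minus_pos_lower_bound) auto
      moreover have "2 * (t k)\<^sup>2 \<le> t k" using t[of k] by (simp add: power2_eq_square)
      ultimately show ?thesis by linarith
    qed
    also have "\<dots> \<le> ln (1 - t k + t k * R x)"
      using t[of k] R0[OF that] by (subst ln_le_cancel_iff) (auto intro: add_pos_nonneg)
    finally show ?thesis using t[of k] by (simp add: \<phi>_def field_simps)
  qed
  have intphi: "integrable q (\<phi> k) \<and> (\<integral>x. \<phi> k x \<partial>q) \<le> 0" for k
  proof -
    define h where "h = (1 - t k) * g + t k * g'"
    have hb: "h \<in> bets"
      using convex_alt[THEN iffD1, OF convex_real_interval(5)[of 0 "1/\<mu>0"]] g_bets g' t[of k]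
      by (auto simp: h_def)
    have hx: "payoff h x = payoff g x * (1 - t k + t k * R x)" if "0 < payoff g x" for x
      using that unfolding h_def payoff_convex R_def by (simp add: field_simps)
    have pos: "0 < 1 - t k + t k * R x" if "x \<in> {0..1} \<and> 0 < payoff g x" for x
      using R0[OF that] t[of k] by (simp add: add_pos_nonneg)
    have hpos: "AE x in q. 0 < payoff h x"
      using good by eventually_elim (use hx pos in auto)
    have eq: "AE x in q. ln (payoff h x) = ln (payoff g x) + t k * \<phi> k x"
      using good
    proof eventually_elim
      case (elim x)
      then show ?case using hx pos[OF elim] t[of k] by (simp add: ln_mult \<phi>_def)
    qed
    have bound: "\<bar>ln (payoff h x)\<bar> \<le> \<bar>ln (payoff g x)\<bar> + (2 * t k + \<bar>ln (1/\<mu>0)\<bar>)"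
      if x: "x \<in> {0..1} \<and> 0 < payoff g x"
        and eqx: "ln (payoff h x) = ln (payoff g x) + t k * \<phi> k x" and hp: "0 < payoff h x" for x
    proof -
      have "t k * (-2) \<le> t k * \<phi> k x" using lower[OF x, of k] t[of k] by (intro mult_left_mono) auto
      moreover have "ln (payoff h x) \<le> ln (1/\<mu>0)"
        using payoff_le[OF hb, of x] x hp by (intro ln_mono) auto
      ultimately show ?thesis using eqx t[of k] by linarith
    qed
    have int_h: "integrable q (\<lambda>x. ln (payoff h x))"
    proof (rule Bochner_Integration.integrable_bound)
      show "integrable q (\<lambda>x. \<bar>ln (payoff g x)\<bar> + (2 * t k + \<bar>ln (1/\<mu>0)\<bar>))"
        using integrable_ln_payoff by (intro Bochner_Integration.integrable_add integrable_abs) auto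
      show "AE x in q. norm (ln (payoff h x)) \<le> norm (\<bar>ln (payoff g x)\<bar> + (2 * t k + \<bar>ln (1/\<mu>0)\<bar>))"
        using good eq hpos
      proof eventually_elim
        case (elim x)
        then show ?case using bound[OF elim] by (simp del: ln_div)
      qed
    qed measurable
    have "growth h = ereal (\<integral>x. ln (payoff h x) \<partial>q)"
      by (rule eexpectation_elog_eq[OF prob_space_axioms _ hpos int_h]) measurable
    then have le: "(\<integral>x. ln (payoff h x) \<partial>q) \<le> rate"
      using growth_le[OF hb] growth_eq_rate by simp
    have phi_eq: "AE x in q. (ln (payoff h x) - ln (payoff g x)) / t k = \<phi> k x"
      using eq by eventually_elim (use t[of k] in \<open>simp add: field_simps\<close>)
    have phi_meas: "\<phi> k \<in> borel_measurable q"
      unfolding \<phi>_def R_def by measurable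
    have int0: "integrable q (\<lambda>x. (ln (payoff h x) - ln (payoff g x)) / t k)"
      using int_h integrable_ln_payoff by (intro integrable_divide_zero Bochner_Integration.integrable_diff) auto
    have "(\<integral>x. \<phi> k x \<partial>q) = (\<integral>x. (ln (payoff h x) - ln (payoff g x)) / t k \<partial>q)"
      using phi_eq by (intro integral_cong_AE) (auto simp: phi_meas)
    also have "\<dots> = ((\<integral>x. ln (payoff h x) \<partial>q) - rate) / t k"
      unfolding rate_def integral_divide_zero
      by (subst Bochner_Integration.integral_diff[OF int_h integrable_ln_payoff]) (rule refl)
    also have "\<dots> \<le> 0" using le t[of k] by (simp add: divide_le_0_iff)
    finally have "(\<integral>x. \<phi> k x \<partial>q) \<le> 0" .
    moreover have "integrable q (\<phi> k)"
      by (rule integrable_cong_AE_imp[OF int0 phi_meas phi_eq])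
    ultimately show ?thesis by simp
  qed
  have [measurable]: "\<phi> k \<in> borel_measurable q" for k
    using intphi by blast
  have [measurable]: "R \<in> borel_measurable q" unfolding R_def by measurable
  have "(\<integral>\<^sup>+x. ennreal (R x + 1) \<partial>q) = (\<integral>\<^sup>+x. liminf (\<lambda>k. ennreal (\<phi> k x + 2)) \<partial>q)"
  proof (intro nn_integral_cong)
    fix x
    have "(\<lambda>k. \<phi> k x + 2) \<longlonglongrightarrow> R x - 1 + 2" by (intro tendsto_intros lim)
    then have "(\<lambda>k. ennreal (\<phi> k x + 2)) \<longlonglongrightarrow> ennreal (R x + 1)"
      by (intro tendsto_ennrealI) (simp add: algebra_simps)
    then show "ennreal (R x + 1) = liminf (\<lambda>k. ennreal (\<phi> k x + 2))"
      using lim_imp_Liminf[OF trivial_limit_sequentially] by metis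
  qed
  also have "\<dots> \<le> liminf (\<lambda>k. \<integral>\<^sup>+x. ennreal (\<phi> k x + 2) \<partial>q)"
    by (rule nn_integral_liminf) measurable
  also have "\<dots> \<le> liminf (\<lambda>k::nat. 2 :: ennreal)"
  proof (intro Liminf_mono always_eventually allI)
    fix k
    have "(\<integral>\<^sup>+x. ennreal (\<phi> k x + 2) \<partial>q) = ennreal (\<integral>x. \<phi> k x + 2 \<partial>q)"
    proof (rule nn_integral_eq_integral)
      show "AE x in q. 0 \<le> \<phi> k x + 2"
        using good
      proof eventually_elim
        case (elim x) then show ?case using lower[OF elim, of k] by simp
      qed
    qed (use intphi in auto)
    also have "(\<integral>x. \<phi> k x + 2 \<partial>q) = (\<integral>x. \<phi> k x \<partial>q) + 2"
      using intphi by (simp add: prob_space)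
    also have "ennreal \<dots> \<le> ennreal 2" using intphi by (intro ennreal_leI) simp
    finally show "(\<integral>\<^sup>+x. ennreal (\<phi> k x + 2) \<partial>q) \<le> 2" by simp
  qed
  also have "\<dots> = 2" by (simp add: Liminf_const)
  finally have "(\<integral>\<^sup>+x. ennreal (R x + 1) \<partial>q) \<le> 2" .
  moreover have "(\<integral>\<^sup>+x. ennreal (R x + 1) \<partial>q) = (\<integral>\<^sup>+x. ennreal (R x) + 1 \<partial>q)"
    by (intro nn_integral_cong_AE eventually_mono[OF good]) (use R0 in \<open>simp add: ennreal_plus\<close>)
  moreover have "\<dots> = (\<integral>\<^sup>+x. ennreal (R x) \<partial>q) + 1"
    by (subst nn_integral_add) (simp_all add: emeasure_space_1)
  ultimately have le: "1 + (\<integral>\<^sup>+x. ennreal (R x) \<partial>q) \<le> 1 + 1" by (simp add: add.commute)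
  have "1 = (top :: ennreal) \<or> (\<integral>\<^sup>+x. ennreal (R x) \<partial>q) \<le> 1"
    using le unfolding ennreal_add_left_cancel_le infinity_ennreal_def .
  then show ?thesis by (simp add: R_def)
qed

text \<open>The density of \<open>q\<close> with respect to the dual law, and its reciprocal.\<close>
abbreviation f :: "real \<Rightarrow> ennreal" where "f x \<equiv> ennreal (payoff g x)"

abbreviation w :: "real \<Rightarrow> ennreal" where "w x \<equiv> ennreal (1 / payoff g x)"

definition deficit :: ennreal where "deficit = 1 - (\<integral>\<^sup>+x. w x \<partial>q)"

lemma w_le: "(\<integral>\<^sup>+x. w x \<partial>q) \<le> 1"
  using numeraire[of 0] mu0_pos by simp

text \<open>The ratio of the payoff of a bet \<open>h\<close> to that of \<open>g\<close> has expectation affine in \<open>h\<close>, at most 1 at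
  both ends of the interval and equal to 1 at \<open>h = g\<close>. So it is 1 at \<open>h = 0\<close>, unless \<open>g\<close> is the right
  endpoint, which pays nothing at \<open>x = 0\<close>. Either way mass placed at 0 is invisible to the density \<open>f\<close>.\<close>
lemma deficit_eq_0: "deficit = 0 \<or> payoff g 0 = 0"
proof -
  define s where "s = g * \<mu>0"
  have s: "0 \<le> s" "s \<le> 1" using g_bets mu0_pos by (auto simp: s_def field_simps)
  have split: "payoff g x / payoff g x = (1 - s) * (1 / payoff g x) + s * (payoff (1/\<mu>0) x / payoff g x)" for x
  proof -
    have "payoff g x = (1 - s) + s * payoff (1/\<mu>0) x"
      using mu0_pos by (simp add: s_def field_simps)
    then show ?thesis by (metis (no_types, opaque_lifting) add_divide_distrib mult.right_neutral times_divide_eq_right)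
  qed
  have nn: "0 \<le> payoff (1/\<mu>0) x / payoff g x" if "x \<in> {0..1}" "0 < payoff g x" for x
    using that payoff_nonneg[of "1/\<mu>0" x] mu0_pos by simp
  have "1 = (\<integral>\<^sup>+x. ennreal (payoff g x / payoff g x) \<partial>q)"
  proof -
    have "(\<integral>\<^sup>+x. ennreal (payoff g x / payoff g x) \<partial>q) = (\<integral>\<^sup>+x. 1 \<partial>q)"
      by (intro nn_integral_cong_AE eventually_mono[OF payoff_pos]) simp
    then show ?thesis by (simp add: emeasure_space_1)
  qed
  also have "\<dots> = (\<integral>\<^sup>+x. ennreal (1 - s) * w x + ennreal s * ennreal (payoff (1/\<mu>0) x / payoff g x) \<partial>q)"
  proof (intro nn_integral_cong_AE)
    show "AE x in q. ennreal (payoff g x / payoff g x) =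
        ennreal (1 - s) * w x + ennreal s * ennreal (payoff (1/\<mu>0) x / payoff g x)"
      using unit_q payoff_pos
    proof eventually_elim
      case (elim x)
      have plus: "ennreal ((1 - s) * A + s * B) = ennreal (1 - s) * ennreal A + ennreal s * ennreal B"
        if "0 \<le> A" "0 \<le> B" for A B :: real
        using that s by (simp add: ennreal_mult)
      show ?case unfolding split[of x] using nn[OF elim] elim by (intro plus) auto
    qed
  qed
  also have "\<dots> = ennreal (1 - s) * (\<integral>\<^sup>+x. w x \<partial>q) + ennreal s * (\<integral>\<^sup>+x. ennreal (payoff (1/\<mu>0) x / payoff g x) \<partial>q)"
    by (subst nn_integral_add) (simp_all add: nn_integral_cmult)
  also have "\<dots> \<le> ennreal (1 - s) * (\<integral>\<^sup>+x. w x \<partial>q) + ennreal s * 1"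
    using numeraire[of "1/\<mu>0"] mu0_pos by (intro add_left_mono mult_left_mono) auto
  finally have le: "1 \<le> ennreal (1 - s) * (\<integral>\<^sup>+x. w x \<partial>q) + ennreal s" by simp
  obtain W where W: "(\<integral>\<^sup>+x. w x \<partial>q) = ennreal W" "0 \<le> W" "W \<le> 1"
    using w_le by (cases "\<integral>\<^sup>+x. w x \<partial>q") (auto simp: top_unique)
  have "1 \<le> (1 - s) * W + s"
    using le s W by (simp add: ennreal_mult[symmetric] ennreal_plus[symmetric] del: ennreal_plus)
  then have "(1 - s) * (1 - W) \<le> 0" by (simp add: algebra_simps)
  then have "s = 1 \<or> W = 1" using s W by (auto simp: mult_le_0_iff)
  then show ?thesis by (auto simp: deficit_def W s_def)
qed

text \<open>The measure \<open>w q + deficit \<delta>\<^sub>0\<close>. Each point is duplicated by a Boolean tag: one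
  copy carries the weight \<open>w\<close>, the other sends the constant weight \<open>deficit\<close> to 0. Written as an image of a
  density, the sum of two measures inherits its integrals from the library.\<close>
definition dual_law :: "real measure" where
  "dual_law = distr (density (q \<Otimes>\<^sub>M count_space (UNIV :: bool set)) (\<lambda>(x, b). if b then w x else deficit))
     borel (\<lambda>(x, b). if b then x else 0)"

lemma sets_dual_law [simp, measurable_cong]: "sets dual_law = sets borel"
  by (simp add: dual_law_def)

lemma nn_integral_dual_law:
  assumes [measurable]: "h \<in> borel_measurable borel"
  shows "(\<integral>\<^sup>+x. h x \<partial>dual_law) = (\<integral>\<^sup>+x. w x * h x \<partial>q) + deficit * h 0"
proof -
  interpret B: sigma_finite_measure "count_space (UNIV :: bool set)"
    by (rule sigma_finite_measure_count_space_finite) simp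
  have "(\<integral>\<^sup>+x. h x \<partial>dual_law) = (\<integral>\<^sup>+z. (case z of (x, b) \<Rightarrow> if b then w x else deficit) *
      h (case z of (x, b) \<Rightarrow> if b then x else 0) \<partial>(q \<Otimes>\<^sub>M count_space UNIV))"
    unfolding dual_law_def by (subst nn_integral_distr, simp, simp) (subst nn_integral_density, auto)
  also have "\<dots> = (\<integral>\<^sup>+x. \<integral>\<^sup>+b. (if b then w x else deficit) * h (if b then x else 0) \<partial>count_space UNIV \<partial>q)"
    by (subst B.nn_integral_fst[symmetric]) auto
  also have "\<dots> = (\<integral>\<^sup>+x. w x * h x + deficit * h 0 \<partial>q)"
    by (simp add: nn_integral_count_space_finite UNIV_bool add.commute)
  also have "\<dots> = (\<integral>\<^sup>+x. w x * h x \<partial>q) + deficit * h 0"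
    by (subst nn_integral_add) (simp_all add: emeasure_space_1)
  finally show ?thesis .
qed

lemma prob_space_dual_law: "prob_space dual_law"
proof
  have "emeasure dual_law (space dual_law) = (\<integral>\<^sup>+x. 1 \<partial>dual_law)" by simp
  also have "\<dots> = (\<integral>\<^sup>+x. w x \<partial>q) + deficit" by (subst nn_integral_dual_law) simp_all
  also have "\<dots> = 1" unfolding deficit_def using w_le by (rule add_diff_inverse_ennreal)
  finally show "emeasure dual_law (space dual_law) = 1" .
qed

lemma unit_dual_law: "AE x in dual_law. x \<in> {0..1}"
proof -
  have "(\<integral>\<^sup>+x. indicator (-{0..1}) x \<partial>dual_law) = (\<integral>\<^sup>+x. w x * indicator (-{0..1}) x \<partial>q)"
    by (subst nn_integral_dual_law) simp_all
  also have "\<dots> = (\<integral>\<^sup>+x. 0 \<partial>q)"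
    by (intro nn_integral_cong_AE eventually_mono[OF unit_q]) simp
  finally have "emeasure dual_law (-{0..1}) = 0" by simp
  then show ?thesis
    by (subst AE_iff_measurable[where N="-{0..1}"]) (auto simp: dual_law_def)
qed

text \<open>The bet \<open>1/\<mu>0\<close> pays \<open>x / \<mu>0\<close>, so the first moment of \<open>w q\<close> is \<open>\<mu>0\<close> times an expectation bounded by
  the numeraire property; mass at 0 adds nothing.\<close>
lemma mean_dual_law: "(\<integral>x. x \<partial>dual_law) \<le> \<mu>0"
proof -
  have "(\<integral>\<^sup>+x. ennreal x \<partial>dual_law) = (\<integral>\<^sup>+x. w x * ennreal x \<partial>q)"
    by (subst nn_integral_dual_law) simp_all
  also have "\<dots> = (\<integral>\<^sup>+x. ennreal \<mu>0 * ennreal (payoff (1/\<mu>0) x / payoff g x) \<partial>q)"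
  proof (intro nn_integral_cong_AE)
    show "AE x in q. w x * ennreal x = ennreal \<mu>0 * ennreal (payoff (1/\<mu>0) x / payoff g x)"
      using unit_q payoff_pos
    proof eventually_elim
      case (elim x)
      have "payoff (1/\<mu>0) x = x / \<mu>0" using mu0_pos by (simp add: field_simps)
      then have "1 / payoff g x * x = \<mu>0 * (payoff (1/\<mu>0) x / payoff g x)"
        using mu0_pos by simp
      then show ?case using elim mu0_pos by (simp add: ennreal_mult''[symmetric] ennreal_mult'[symmetric])
    qed
  qed
  also have "\<dots> = ennreal \<mu>0 * (\<integral>\<^sup>+x. ennreal (payoff (1/\<mu>0) x / payoff g x) \<partial>q)"
    by (simp add: nn_integral_cmult)
  also have "\<dots> \<le> ennreal \<mu>0 * 1"
    using numeraire[of "1/\<mu>0"] mu0_pos by (intro mult_left_mono) auto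
  finally have "(\<integral>\<^sup>+x. ennreal x \<partial>dual_law) \<le> ennreal \<mu>0" by simp
  moreover have "(\<integral>x. x \<partial>dual_law) = enn2real (\<integral>\<^sup>+x. ennreal x \<partial>dual_law)"
    by (intro integral_eq_nn_integral eventually_mono[OF unit_dual_law]) auto
  ultimately show ?thesis using mu0_pos by (simp add: enn2real_leI)
qed

lemma density_dual_law: "q = density dual_law f"
proof (rule measure_eqI)
  fix A assume "A \<in> sets q"
  then have [measurable]: "A \<in> sets borel" by (simp add: sets_q)
  have "emeasure (density dual_law f) A = (\<integral>\<^sup>+x. f x * indicator A x \<partial>dual_law)"
    by (rule emeasure_density) simp_all
  also have "\<dots> = (\<integral>\<^sup>+x. w x * (f x * indicator A x) \<partial>q) + deficit * (f 0 * indicator A 0)"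
    by (rule nn_integral_dual_law) simp
  also have "deficit * (f 0 * indicator A 0) = 0" using deficit_eq_0 by auto
  also have "(\<integral>\<^sup>+x. w x * (f x * indicator A x) \<partial>q) = (\<integral>\<^sup>+x. indicator A x \<partial>q)"
  proof (intro nn_integral_cong_AE eventually_mono[OF payoff_pos])
    fix x assume "0 < payoff g x"
    then have "w x * f x = 1" by (simp add: ennreal_mult'[symmetric])
    then show "w x * (f x * indicator A x) = indicator A x" by (simp add: mult.assoc[symmetric])
  qed
  finally show "emeasure q A = emeasure (density dual_law f) A"
    using \<open>A \<in> sets q\<close> by simp
qed (simp add: sets_q)

text \<open>For \<open>\<epsilon> \<le> 1\<close> truncation only decreases the absolute value of the log return, so dominated
  convergence applies. Truncated log returns are bounded, as Hoeffding's inequality requires.\<close>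
lemma truncated_rate:
  assumes "0 < \<delta>"
  obtains \<epsilon> where "0 < \<epsilon>" "\<epsilon> \<le> 1" "(\<integral>x. ln (max (payoff g x) \<epsilon>) \<partial>q) \<le> rate + \<delta>"
proof -
  define e :: "nat \<Rightarrow> real" where "e k = 1 / (real k + 1)" for k
  have e: "0 < e k" "e k \<le> 1" for k by (auto simp: e_def)
  have e0: "e \<longlonglongrightarrow> 0"
    unfolding e_def using LIMSEQ_ignore_initial_segment[OF lim_1_over_n, of 1] by (simp add: add.commute)
  have "(\<lambda>k. \<integral>x. ln (max (payoff g x) (e k)) \<partial>q) \<longlonglongrightarrow> (\<integral>x. ln (payoff g x) \<partial>q)"
  proof (rule integral_dominated_convergence[where w="\<lambda>x. \<bar>ln (payoff g x)\<bar>"])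
    show "AE x in q. (\<lambda>k. ln (max (payoff g x) (e k))) \<longlonglongrightarrow> ln (payoff g x)"
      using payoff_pos
    proof eventually_elim
      case (elim x)
      have "(\<lambda>k. ln (max (payoff g x) (e k))) \<longlonglongrightarrow> ln (max (payoff g x) 0)"
        by (intro tendsto_ln tendsto_max tendsto_const e0) (use elim in simp)
      then show ?case using elim by simp
    qed
    show "AE x in q. norm (ln (max (payoff g x) (e k))) \<le> \<bar>ln (payoff g x)\<bar>" for k
      using payoff_pos
    proof eventually_elim
      case (elim x)
      show ?case
      proof (cases "e k \<le> payoff g x")
        case False
        then have "ln (payoff g x) \<le> ln (e k)" "ln (e k) \<le> 0" using elim e[of k] by auto
        then show ?thesis using False by (simp add: max_def)
      qed (simp add: max_def)
    qed
  qed (use integrable_ln_payoff in auto)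
  then have "eventually (\<lambda>k. (\<integral>x. ln (max (payoff g x) (e k)) \<partial>q) < rate + \<delta>) sequentially"
    using assms by (intro order_tendstoD) (auto simp: rate_def)
  then obtain k where "(\<integral>x. ln (max (payoff g x) (e k)) \<partial>q) < rate + \<delta>"
    by (auto simp: eventually_sequentially)
  then show ?thesis using that[of "e k"] e by simp
qed

text \<open>The payoff of \<open>(1 - t) g\<close> is \<open>(1 - t)\<close> times that of \<open>g\<close> plus \<open>t\<close>. The summand \<open>t\<close> keeps the log
  return bounded, even when \<open>g = 1/\<mu>0\<close>, and the factor costs at most \<open>-ln (1 - t)\<close> of the growth rate.\<close>
lemma shrunken_bet:
  assumes t: "0 < t" "t < 1"
  shows "(1 - t) * g \<in> bets"
    and "x \<in> {0..1} \<Longrightarrow> t \<le> payoff ((1 - t) * g) x"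
    and "rate + ln (1 - t) \<le> (\<integral>x. ln (payoff ((1 - t) * g) x) \<partial>q)"
proof -
  have "(1 - t) * g \<le> 1 * (1/\<mu>0)" using t g_bets by (intro mult_mono) auto
  then show hb: "(1 - t) * g \<in> bets" using t g_bets by auto
  have eq: "payoff ((1 - t) * g) x = (1 - t) * payoff g x + t" for x
    using payoff_convex[of t 0 x] by simp
  show lower: "t \<le> payoff ((1 - t) * g) x" if "x \<in> {0..1}" for x
    using payoff_nonneg[OF g_bets that] t unfolding eq by simp
  have "rate + ln (1 - t) = (\<integral>x. ln (payoff g x) + ln (1 - t) \<partial>q)"
    using integrable_ln_payoff by (simp add: rate_def prob_space)
  also have "\<dots> \<le> (\<integral>x. ln (payoff ((1 - t) * g) x) \<partial>q)"
  proof (rule integral_mono_AE)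
    show "integrable q (\<lambda>x. ln (payoff ((1 - t) * g) x))"
      by (rule growth_eq_integral(1)[OF hb t(1) lower])
    show "AE x in q. ln (payoff g x) + ln (1 - t) \<le> ln (payoff ((1 - t) * g) x)"
      using payoff_pos
    proof eventually_elim
      case (elim x)
      have "ln (payoff g x) + ln (1 - t) = ln ((1 - t) * payoff g x)"
        using elim t by (simp add: ln_mult)
      also have "\<dots> \<le> ln (payoff ((1 - t) * g) x)"
        unfolding eq using elim t by (intro ln_mono) (auto intro: mult_pos_pos)
      finally show ?case .
    qed
  qed (use integrable_ln_payoff in auto)
  finally show "rate + ln (1 - t) \<le> (\<integral>x. ln (payoff ((1 - t) * g) x) \<partial>q)" .
qed

end

section \<open>Change of law, independence and concentration for i.i.d. observations\<close>

text \<open>The natural filtration at finite times is written \<open>F n\<close>; laws \<open>P\<close> and \<open>Q\<close> vary over a fixed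
  measurable space.\<close>
locale unit_observations =
  fixes M :: "'a measure" and X :: "nat \<Rightarrow> 'a \<Rightarrow> real"
  assumes X_meas: "1 \<le> n \<Longrightarrow> X n \<in> borel_measurable M"
    and X_unit: "1 \<le> n \<Longrightarrow> \<omega> \<in> space M \<Longrightarrow> X n \<omega> \<in> {0..1}"
begin

abbreviation F :: "nat \<Rightarrow> 'a measure" where "F n \<equiv> nat_filtration M X (enat n)"

text \<open>Cylinders form an intersection-stable generator of \<open>F n\<close> on which i.i.d. laws factorise.\<close>
definition cyl :: "nat \<Rightarrow> (nat \<Rightarrow> real set) \<Rightarrow> 'a set" where
  "cyl n B = {\<omega> \<in> space M. \<forall>i\<in>{1..n}. X i \<omega> \<in> B i}"

lemma space_F [simp]: "space (F n) = space M"
  by (auto simp: nat_filtration_def intro!: space_measure_of)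

lemma sets_F: "sets (F n) = sigma_sets (space M) {X i -` B \<inter> space M | i B. i \<in> {1..n} \<and> B \<in> sets borel}"
proof -
  have "{X i -` B \<inter> space M |i B. 1 \<le> i \<and> enat i \<le> enat n \<and> B \<in> sets borel}
     = {X i -` B \<inter> space M | i B. i \<in> {1..n} \<and> B \<in> sets borel}" by auto
  then show ?thesis unfolding nat_filtration_def
    by (subst sets_measure_of) auto
qed

lemma sets_F_mono: "m \<le> n \<Longrightarrow> sets (F m) \<subseteq> sets (F n)"
  unfolding sets_F by (intro sigma_sets_mono') (auto 4 4 intro: le_trans)

lemma sets_F_subset: "sets (F n) \<subseteq> sets M"
  unfolding sets_F using X_meas by (intro sets.sigma_sets_subset) auto

lemma F_mono: "Z \<in> measurable (F m) N \<Longrightarrow> m \<le> n \<Longrightarrow> Z \<in> measurable (F n) N"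
  by (auto simp: measurable_def dest: sets_F_mono)

lemma F_measurable_M: "Z \<in> measurable (F m) N \<Longrightarrow> Z \<in> measurable M N"
  using sets_F_subset by (auto simp: measurable_def)

lemma X_F: "1 \<le> i \<Longrightarrow> i \<le> n \<Longrightarrow> X i \<in> borel_measurable (F n)"
  unfolding measurable_def by (auto simp: sets_F intro!: sigma_sets.Basic)

lemma sets_F_cyl: "sets (F n) = sigma_sets (space M) {cyl n B | B. \<forall>i. B i \<in> sets borel}"
  unfolding sets_F
proof (intro equalityI sigma_sets_mono subsetI)
  fix A assume "A \<in> {X i -` B \<inter> space M | i B. i \<in> {1..n} \<and> B \<in> sets borel}"
  then obtain i B where "A = X i -` B \<inter> space M" "i \<in> {1..n}" "B \<in> sets borel" by auto
  then have "A = cyl n (\<lambda>j. if j = i then B else UNIV)" "B \<in> sets borel" by (auto simp: cyl_def)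
  then show "A \<in> sigma_sets (space M) {cyl n B | B. \<forall>i. B i \<in> sets borel}"
    by (intro sigma_sets.Basic) auto
next
  fix A assume "A \<in> {cyl n B | B. \<forall>i. B i \<in> sets borel}"
  then obtain B where A: "A = cyl n B" and B[measurable]: "\<And>i. B i \<in> sets borel" by auto
  have "{\<omega> \<in> space (F n). \<forall>i\<in>{1..n}. X i \<omega> \<in> B i} \<in> sets (F n)"
  proof (rule sets.sets_Collect_finite_All)
    fix i assume "i \<in> {1..n}"
    then have [measurable]: "X i \<in> borel_measurable (F n)" by (auto intro: X_F)
    show "{\<omega> \<in> space (F n). X i \<omega> \<in> B i} \<in> sets (F n)" by measurable
  qed auto
  then show "A \<in> sigma_sets (space M) {X i -` B \<inter> space M | i B. i \<in> {1..n} \<and> B \<in> sets borel}"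
    by (simp add: A cyl_def sets_F)
qed

lemma iid_lawsD:
  assumes "P \<in> iid_laws M X"
  shows "prob_space P" "sets P = sets M" "space P = space M"
    "prob_space.indep_vars P (\<lambda>_. borel) X {1..}"
    "1 \<le> n \<Longrightarrow> distr P borel (X n) = distr P borel (X 1)"
    "1 \<le> n \<Longrightarrow> X n \<in> borel_measurable P"
    "subalgebra P (F m)"
proof -
  show "prob_space P" and sP: "sets P = sets M"
    and "prob_space.indep_vars P (\<lambda>_. borel) X {1..}"
    and "1 \<le> n \<Longrightarrow> distr P borel (X n) = distr P borel (X 1)"
    using assms unfolding iid_laws_def by blast+
  show sp: "space P = space M" by (rule sets_eq_imp_space_eq[OF sP])
  show "X n \<in> borel_measurable P" if "1 \<le> n"
    using X_meas[OF that] measurable_cong_sets[OF sP refl] by blast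
  show "subalgebra P (F m)"
    using sets_F_subset[of m] by (simp add: subalgebra_def sp sP)
qed

lemma F_measurable_P: "P \<in> iid_laws M X \<Longrightarrow> Z \<in> measurable (F m) N \<Longrightarrow> Z \<in> measurable P N"
  using F_measurable_M[of Z m N] measurable_cong_sets[OF iid_lawsD(2) refl] by blast

lemma nn_integral_prod_iid:
  fixes \<phi> :: "nat \<Rightarrow> real \<Rightarrow> ennreal"
  assumes P: "P \<in> iid_laws M X" and \<phi>[measurable]: "\<And>i. \<phi> i \<in> borel_measurable borel"
  shows "(\<integral>\<^sup>+\<omega>. (\<Prod>i=1..n. \<phi> i (X i \<omega>)) \<partial>P) = (\<Prod>i=1..n. \<integral>\<^sup>+x. \<phi> i x \<partial>distr P borel (X 1))"
proof -
  interpret prob_space P using iid_lawsD(1)[OF P] .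
  have "indep_vars (\<lambda>_. borel) X {1..n}"
    using iid_lawsD(4)[OF P] by (rule indep_vars_subset) auto
  then have ind: "indep_vars (\<lambda>_. borel) (\<lambda>i \<omega>. \<phi> i (X i \<omega>)) {1..n}"
    by (rule indep_vars_compose2) simp
  have "(\<integral>\<^sup>+\<omega>. (\<Prod>i=1..n. \<phi> i (X i \<omega>)) \<partial>P) = (\<Prod>i=1..n. \<integral>\<^sup>+\<omega>. \<phi> i (X i \<omega>) \<partial>P)"
    by (intro indep_vars_nn_integral ind) auto
  also have "\<dots> = (\<Prod>i=1..n. \<integral>\<^sup>+x. \<phi> i x \<partial>distr P borel (X i))"
    using iid_lawsD(6)[OF P] by (intro prod.cong refl) (simp add: nn_integral_distr)
  also have "\<dots> = (\<Prod>i=1..n. \<integral>\<^sup>+x. \<phi> i x \<partial>distr P borel (X 1))"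
    by (intro prod.cong refl, subst iid_lawsD(5)[OF P]) auto
  finally show ?thesis .
qed

lemma indicator_cyl:
  "\<omega> \<in> space M \<Longrightarrow> indicator (cyl n B) \<omega> = (\<Prod>i=1..n. indicator (B i) (X i \<omega>) :: ennreal)"
  by (auto simp: cyl_def indicator_def prod_zero_iff)

text \<open>A density \<open>f\<close> between the marginals becomes the product density on \<open>F n\<close>: both measures
  agree on cylinders, hence on the generated sigma-algebra.\<close>
lemma nn_integral_change_of_law:
  fixes f :: "real \<Rightarrow> ennreal"
  assumes P: "P \<in> iid_laws M X" and Q: "Q \<in> iid_laws M X"
    and f[measurable]: "f \<in> borel_measurable borel"
    and dens: "distr Q borel (X 1) = density (distr P borel (X 1)) f"
    and h: "h \<in> borel_measurable (F n)"
  shows "(\<integral>\<^sup>+\<omega>. h \<omega> \<partial>Q) = (\<integral>\<^sup>+\<omega>. h \<omega> * (\<Prod>i=1..n. f (X i \<omega>)) \<partial>P)"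
proof -
  define D where "D \<omega> = (\<Prod>i=1..n. f (X i \<omega>))" for \<omega>
  have DF: "D \<in> borel_measurable (F n)"
    unfolding D_def using X_F by (intro borel_measurable_prod_ennreal measurable_compose[OF _ f]) auto
  have DP[measurable]: "D \<in> borel_measurable P" by (rule F_measurable_P[OF P DF])
  have hP[measurable]: "h \<in> borel_measurable P" by (rule F_measurable_P[OF P h])
  have subQ: "subalgebra Q (F n)" and subD: "subalgebra (density P D) (F n)"
    using iid_lawsD(7)[OF P] iid_lawsD(7)[OF Q] by (auto simp: subalgebra_def)
  interpret Q: prob_space Q using iid_lawsD(1)[OF Q] .
  let ?E = "{cyl n B | B. \<forall>i. B i \<in> sets borel}"
  have "restr_to_subalg Q (F n) = restr_to_subalg (density P D) (F n)"
  proof (rule measure_eqI_generator_eq[where E="?E" and \<Omega>="space M" and A="\<lambda>_. space M"])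
    show "Int_stable ?E"
    proof (rule Int_stableI)
      fix a b assume "a \<in> ?E" "b \<in> ?E"
      then obtain A B where AB: "a = cyl n A" "b = cyl n B" "\<forall>i. A i \<in> sets borel" "\<forall>i. B i \<in> sets borel"
        by auto
      have "a \<inter> b = cyl n (\<lambda>i. A i \<inter> B i)" by (auto simp: AB cyl_def)
      then show "a \<inter> b \<in> ?E" using AB by blast
    qed
    show "?E \<subseteq> Pow (space M)" by (auto simp: cyl_def)
    show "sets (restr_to_subalg Q (F n)) = sigma_sets (space M) ?E"
      by (simp add: sets_restr_to_subalg[OF subQ] sets_F_cyl)
    show "sets (restr_to_subalg (density P D) (F n)) = sigma_sets (space M) ?E"
      by (simp add: sets_restr_to_subalg[OF subD] sets_F_cyl)
    have "space M = cyl n (\<lambda>_. UNIV)" by (simp add: cyl_def)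
    then show "range (\<lambda>_::nat. space M) \<subseteq> ?E" by auto
    show "emeasure (restr_to_subalg Q (F n)) (space M) \<noteq> \<infinity>"
      using Q.emeasure_space_1 iid_lawsD(3)[OF Q]
        emeasure_restr_to_subalg[OF subQ, of "space M"] sets.top[of "F n"] by simp
    fix X' assume "X' \<in> ?E"
    then obtain B where X': "X' = cyl n B" and B[measurable]: "\<And>i. B i \<in> sets borel" by auto
    have XF: "X' \<in> sets (F n)" unfolding sets_F_cyl using \<open>X' \<in> ?E\<close> by blast
    then have XM: "X' \<in> sets M" using sets_F_subset by auto
    have "emeasure (restr_to_subalg Q (F n)) X' = (\<integral>\<^sup>+\<omega>. indicator X' \<omega> \<partial>Q)"
      using XM iid_lawsD(2)[OF Q] by (simp add: emeasure_restr_to_subalg[OF subQ XF])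
    also have "\<dots> = (\<integral>\<^sup>+\<omega>. (\<Prod>i=1..n. indicator (B i) (X i \<omega>)) \<partial>Q)"
      using iid_lawsD(3)[OF Q] by (intro nn_integral_cong) (simp add: X' indicator_cyl)
    also have "\<dots> = (\<Prod>i=1..n. \<integral>\<^sup>+x. indicator (B i) x \<partial>distr Q borel (X 1))"
      by (rule nn_integral_prod_iid[OF Q]) simp
    also have "\<dots> = (\<Prod>i=1..n. \<integral>\<^sup>+x. f x * indicator (B i) x \<partial>distr P borel (X 1))"
      unfolding dens by (intro prod.cong refl) (simp add: nn_integral_density del: nn_integral_indicator)
    also have "\<dots> = (\<integral>\<^sup>+\<omega>. (\<Prod>i=1..n. f (X i \<omega>) * indicator (B i) (X i \<omega>)) \<partial>P)"
      by (rule nn_integral_prod_iid[OF P, symmetric]) simp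
    also have "\<dots> = (\<integral>\<^sup>+\<omega>. D \<omega> * indicator X' \<omega> \<partial>P)"
      using iid_lawsD(3)[OF P] by (intro nn_integral_cong) (simp add: X' indicator_cyl D_def prod.distrib)
    also have "\<dots> = emeasure (restr_to_subalg (density P D) (F n)) X'"
      using XM iid_lawsD(2)[OF P] by (simp add: emeasure_restr_to_subalg[OF subD XF] emeasure_density)
    finally show "emeasure (restr_to_subalg Q (F n)) X' = emeasure (restr_to_subalg (density P D) (F n)) X'" .
  qed simp
  then have "(\<integral>\<^sup>+\<omega>. h \<omega> \<partial>restr_to_subalg Q (F n)) = (\<integral>\<^sup>+\<omega>. h \<omega> \<partial>restr_to_subalg (density P D) (F n))"
    by simp
  then have "(\<integral>\<^sup>+\<omega>. h \<omega> \<partial>Q) = (\<integral>\<^sup>+\<omega>. h \<omega> \<partial>density P D)"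
    by (simp add: nn_integral_subalgebra2[OF subQ h] nn_integral_subalgebra2[OF subD h])
  then show ?thesis
    unfolding D_def[symmetric] by (simp add: nn_integral_density mult.commute)
qed

text \<open>The past up to time \<open>n\<close> is generated by a group of coordinates disjoint from \<open>{n + 1}\<close>.\<close>
lemma indep_var_next:
  assumes P: "P \<in> iid_laws M X" and Z: "Z \<in> borel_measurable (F n)"
    and \<phi>[measurable]: "\<phi> \<in> borel_measurable borel"
  shows "prob_space.indep_var P borel Z borel (\<lambda>\<omega>. \<phi> (X (Suc n) \<omega>) :: real)"
proof -
  interpret prob_space P using iid_lawsD(1)[OF P] .
  let ?E = "\<lambda>i. {X i -` B \<inter> space P | B. B \<in> sets borel}"
  let ?I = "case_bool {1..n} {Suc n}"
  have "indep_sets ?E {1..}" using iid_lawsD(4)[OF P] by (simp add: indep_vars_def2)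
  then have "indep_sets ?E (\<Union>b\<in>UNIV. ?I b)"
    by (rule indep_sets_mono_index[rotated]) (auto split: bool.splits)
  then have ind: "indep_sets (\<lambda>b. sigma_sets (space P) (\<Union>i\<in>?I b. ?E i)) UNIV"
  proof (rule indep_sets_collect_sigma)
    show "Int_stable (?E i)" for i
    proof (rule Int_stableI)
      fix a b assume "a \<in> ?E i" "b \<in> ?E i"
      then obtain A B where "a = X i -` A \<inter> space P" "b = X i -` B \<inter> space P"
        "A \<in> sets borel" "B \<in> sets borel" by blast
      then have "a \<inter> b = X i -` (A \<inter> B) \<inter> space P" "A \<inter> B \<in> sets borel" by auto
      then show "a \<inter> b \<in> ?E i" by blast
    qed
    show "disjoint_family ?I" by (auto simp: disjoint_family_on_def split: bool.splits)
  qed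
  have FE: "sets (F n) = sigma_sets (space P) (\<Union>i\<in>{1..n}. ?E i)"
    unfolding sets_F iid_lawsD(3)[OF P] by (rule arg_cong[where f="sigma_sets (space M)"]) blast
  have XE: "{X (Suc n) -` B \<inter> space P | B. B \<in> sets borel} \<subseteq> sigma_sets (space P) (\<Union>i\<in>{Suc n}. ?E i)"
    by (auto intro: sigma_sets.Basic)
  have "indep_set (sigma_sets (space P) {Z -` A \<inter> space P | A. A \<in> sets borel})
     (sigma_sets (space P) {(\<lambda>\<omega>. \<phi> (X (Suc n) \<omega>)) -` A \<inter> space P | A. A \<in> sets borel})"
    unfolding indep_set_def
  proof (rule indep_sets_mono_sets[OF ind])
    fix b :: bool
    have 1: "sigma_sets (space P) {Z -` A \<inter> space P | A. A \<in> sets borel} \<subseteq> sigma_sets (space P) (\<Union>i\<in>{1..n}. ?E i)"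
    proof -
      have "{Z -` A \<inter> space P | A. A \<in> sets borel} \<subseteq> sets (F n)"
        using measurable_sets[OF Z] by (auto simp: iid_lawsD(3)[OF P])
      then have "sigma_sets (space P) {Z -` A \<inter> space P | A. A \<in> sets borel} \<subseteq> sets (F n)"
        using sets.sigma_sets_subset[of _ "F n"] by (simp add: iid_lawsD(3)[OF P])
      then show ?thesis by (simp only: FE)
    qed
    have 2: "sigma_sets (space P) {(\<lambda>\<omega>. \<phi> (X (Suc n) \<omega>)) -` A \<inter> space P | A. A \<in> sets borel}
        \<subseteq> sigma_sets (space P) (\<Union>i\<in>{Suc n}. ?E i)"
    proof (intro sigma_sets_mono subsetI)
      fix a assume "a \<in> {(\<lambda>\<omega>. \<phi> (X (Suc n) \<omega>)) -` A \<inter> space P | A. A \<in> sets borel}"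
      then obtain A where A: "A \<in> sets borel" "a = (\<lambda>\<omega>. \<phi> (X (Suc n) \<omega>)) -` A \<inter> space P" by auto
      then have "a = X (Suc n) -` (\<phi> -` A) \<inter> space P" "\<phi> -` A \<in> sets borel"
        using measurable_sets[OF \<phi>, of A] by auto
      then show "a \<in> sigma_sets (space P) (\<Union>i\<in>{Suc n}. ?E i)" using XE by blast
    qed
    show "case_bool (sigma_sets (space P) {Z -` A \<inter> space P | A. A \<in> sets borel})
     (sigma_sets (space P) {(\<lambda>\<omega>. \<phi> (X (Suc n) \<omega>)) -` A \<inter> space P | A. A \<in> sets borel}) b
      \<subseteq> sigma_sets (space P) (\<Union> (?E ` ?I b))"
      using 1 2 by (cases b) simp_all
  qed
  moreover have "Z \<in> borel_measurable P" by (rule F_measurable_P[OF P Z])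
  moreover have "(\<lambda>\<omega>. \<phi> (X (Suc n) \<omega>)) \<in> borel_measurable P"
    using iid_lawsD(6)[OF P, of "Suc n"] by simp
  ultimately show ?thesis unfolding indep_var_eq by blast
qed

lemma expectation_next:
  fixes \<phi> :: "real \<Rightarrow> real"
  assumes P: "P \<in> iid_laws M X" and Z: "Z \<in> borel_measurable (F n)"
    and \<phi>[measurable]: "\<phi> \<in> borel_measurable borel"
    and intZ: "integrable P Z" and int\<phi>: "integrable (distr P borel (X 1)) \<phi>"
  shows "integrable P (\<lambda>\<omega>. Z \<omega> * \<phi> (X (Suc n) \<omega>))"
    and "(\<integral>\<omega>. Z \<omega> * \<phi> (X (Suc n) \<omega>) \<partial>P) = (\<integral>\<omega>. Z \<omega> \<partial>P) * (\<integral>x. \<phi> x \<partial>distr P borel (X 1))"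
proof -
  interpret prob_space P using iid_lawsD(1)[OF P] .
  have X: "X (Suc n) \<in> borel_measurable P" using iid_lawsD(6)[OF P] by simp
  have d: "distr P borel (X (Suc n)) = distr P borel (X 1)" by (rule iid_lawsD(5)[OF P]) simp
  have i: "integrable P (\<lambda>\<omega>. \<phi> (X (Suc n) \<omega>))"
    using int\<phi> X unfolding d[symmetric] by (simp add: integrable_distr_eq)
  show "integrable P (\<lambda>\<omega>. Z \<omega> * \<phi> (X (Suc n) \<omega>))"
    by (rule indep_var_integrable[OF indep_var_next[OF P Z \<phi>] intZ i])
  have "(\<integral>\<omega>. Z \<omega> * \<phi> (X (Suc n) \<omega>) \<partial>P) = (\<integral>\<omega>. Z \<omega> \<partial>P) * (\<integral>\<omega>. \<phi> (X (Suc n) \<omega>) \<partial>P)"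
    by (rule indep_var_lebesgue_integral[OF indep_var_next[OF P Z \<phi>] intZ i])
  then show "(\<integral>\<omega>. Z \<omega> * \<phi> (X (Suc n) \<omega>) \<partial>P) = (\<integral>\<omega>. Z \<omega> \<partial>P) * (\<integral>x. \<phi> x \<partial>distr P borel (X 1))"
    using X unfolding d[symmetric] by (simp add: integral_distr)
qed

lemma law_unit:
  assumes "P \<in> iid_laws M X" shows "AE x in distr P borel (X 1). x \<in> {0..1}"
  using X_unit[of 1] iid_lawsD(3,6)[OF assms] by (subst AE_distr_iff) auto

text \<open>Only the geometric decay of the deviation probabilities matters later, not the constants.\<close>
lemma hoeffding_iid:
  fixes \<phi> :: "real \<Rightarrow> real"
  assumes Q: "Q \<in> iid_laws M X" and \<phi>[measurable]: "\<phi> \<in> borel_measurable borel"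
    and bound: "\<And>x. x \<in> {0..1} \<Longrightarrow> \<bar>\<phi> x\<bar> \<le> C" and \<delta>: "0 < \<delta>"
  obtains r where "0 < r" "r < 1"
    "\<And>n. measure Q {\<omega> \<in> space Q. real n * \<delta> \<le> \<bar>(\<Sum>i=1..n. \<phi> (X i \<omega>)) - real n * (\<integral>x. \<phi> x \<partial>distr Q borel (X 1))\<bar>} \<le> 2 * r ^ n"
proof -
  interpret prob_space Q using iid_lawsD(1)[OF Q] .
  let ?q = "distr Q borel (X 1)"
  have Xm: "X n \<in> borel_measurable Q" if "1 \<le> n" for n using iid_lawsD(6)[OF Q that] .
  define a b where "a = - \<bar>C\<bar> - 1" and "b = \<bar>C\<bar> + 1"
  have ab: "a < b" by (simp add: a_def b_def)
  define r where "r = exp (- 2 * \<delta>\<^sup>2 / (b - a)\<^sup>2)"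
  have ind: "indep_vars (\<lambda>_. borel) (\<lambda>i \<omega>. \<phi> (X i \<omega>)) {1..n}" for n
    by (rule indep_vars_compose2[OF indep_vars_subset[OF iid_lawsD(4)[OF Q]]]) auto
  have ident: "distr Q borel (\<lambda>\<omega>. \<phi> (X i \<omega>)) = distr Q borel (\<lambda>\<omega>. \<phi> (X 1 \<omega>))" if "1 \<le> i" for i
  proof -
    have "distr Q borel (\<lambda>\<omega>. \<phi> (X i \<omega>)) = distr (distr Q borel (X i)) borel \<phi>"
      using Xm[OF that] by (simp add: distr_distr o_def)
    also have "distr Q borel (X i) = ?q" by (rule iid_lawsD(5)[OF Q that])
    also have "distr ?q borel \<phi> = distr Q borel (\<lambda>\<omega>. \<phi> (X 1 \<omega>))"
      using Xm[of 1] by (simp add: distr_distr o_def)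
    finally show ?thesis .
  qed
  have mean: "expectation (\<lambda>\<omega>. \<phi> (X 1 \<omega>)) = (\<integral>x. \<phi> x \<partial>?q)"
    using Xm[of 1] by (subst integral_distr) auto
  have "measure Q {\<omega> \<in> space Q. real n * \<delta> \<le> \<bar>(\<Sum>i=1..n. \<phi> (X i \<omega>)) - real n * (\<integral>x. \<phi> x \<partial>?q)\<bar>} \<le> 2 * r ^ n" for n
  proof (cases "n = 0")
    case True
    have "measure Q A \<le> 1" for A by (rule prob_le_1)
    then show ?thesis using True by (smt (verit) power_0)
  next
    case False
    interpret H: Hoeffding_ineq_iid Q "{1..n}" "\<lambda>i \<omega>. \<phi> (X i \<omega>)" "\<lambda>\<omega>. \<phi> (X 1 \<omega>)" a b
      "expectation (\<lambda>\<omega>. \<phi> (X 1 \<omega>))"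
    proof unfold_locales
      show "(\<lambda>\<omega>. \<phi> (X 1 \<omega>)) \<in> borel_measurable Q" using Xm[of 1] by simp
      show "AE \<omega> in Q. \<phi> (X 1 \<omega>) \<in> {a..b}"
      proof (intro AE_I2)
        fix \<omega> assume "\<omega> \<in> space Q"
        then have "\<bar>\<phi> (X 1 \<omega>)\<bar> \<le> C" using X_unit[of 1 \<omega>] iid_lawsD(3)[OF Q] by (intro bound) simp
        then show "\<phi> (X 1 \<omega>) \<in> {a..b}" by (auto simp: a_def b_def)
      qed
      show "indep_vars (\<lambda>_. borel) (\<lambda>i \<omega>. \<phi> (X i \<omega>)) {1..n}" by (rule ind)
      show "distr Q borel (\<lambda>\<omega>. \<phi> (X i \<omega>)) = distr Q borel (\<lambda>\<omega>. \<phi> (X 1 \<omega>))" if "i \<in> {1..n}" for i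
        by (rule ident) (use that in simp)
    qed simp_all
    have "measure Q {\<omega> \<in> space Q. real n * \<delta> \<le> \<bar>(\<Sum>i=1..n. \<phi> (X i \<omega>)) - real n * (\<integral>x. \<phi> x \<partial>?q)\<bar>}
       \<le> 2 * exp (- 2 * (real n * \<delta>)\<^sup>2 / (real n * (b - a)\<^sup>2))"
      using H.Hoeffding_ineq_abs_ge[of "real n * \<delta>"] \<delta> ab False unfolding mean by simp
    also have "- 2 * (real n * \<delta>)\<^sup>2 / (real n * (b - a)\<^sup>2) = real n * (- 2 * \<delta>\<^sup>2 / (b - a)\<^sup>2)"
      using False by (simp add: power2_eq_square)
    also have "exp \<dots> = r ^ n" unfolding r_def by (simp only: exp_of_nat_mult)
    finally show ?thesis .
  qed
  moreover have "0 < r" "r < 1" using \<delta> ab by (auto simp: r_def)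
  ultimately show ?thesis using that by blast
qed

lemma strong_law_bounded:
  fixes \<phi> :: "real \<Rightarrow> real"
  assumes Q: "Q \<in> iid_laws M X" and \<phi>[measurable]: "\<phi> \<in> borel_measurable borel"
    and bound: "\<And>x. x \<in> {0..1} \<Longrightarrow> \<bar>\<phi> x\<bar> \<le> C" and \<delta>: "0 < \<delta>"
  shows "AE \<omega> in Q. \<forall>\<^sub>F n in sequentially.
    \<bar>(\<Sum>i=1..n. \<phi> (X i \<omega>)) - real n * (\<integral>x. \<phi> x \<partial>distr Q borel (X 1))\<bar> < real n * \<delta>"
proof -
  interpret prob_space Q using iid_lawsD(1)[OF Q] .
  define A where "A n = {\<omega> \<in> space Q. real n * \<delta> \<le> \<bar>(\<Sum>i=1..n. \<phi> (X i \<omega>)) - real n * (\<integral>x. \<phi> x \<partial>distr Q borel (X 1))\<bar>}" for n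
  obtain r where r: "0 < r" "r < 1" "\<And>n. measure Q (A n) \<le> 2 * r ^ n"
    using hoeffding_iid[OF Q \<phi> bound \<delta>, folded A_def] by blast
  have "(\<lambda>\<omega>. \<Sum>i=1..n. \<phi> (X i \<omega>)) \<in> borel_measurable Q" for n
    using iid_lawsD(6)[OF Q] by (intro borel_measurable_sum measurable_compose[OF _ \<phi>]) auto
  note [measurable] = this
  have "A n \<in> sets Q" for n unfolding A_def by measurable
  moreover have "summable (\<lambda>n. measure Q (A n))"
    by (rule summable_comparison_test'[of "\<lambda>n. 2 * r ^ n"]) (use r in \<open>auto intro!: summable_mult summable_geometric\<close>)
  ultimately have "AE \<omega> in Q. \<forall>\<^sub>F n in sequentially. \<omega> \<in> space Q - A n"
    by (intro borel_cantelli_AE1) (auto simp: emeasure_eq_measure)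
  then show ?thesis
    by eventually_elim (auto elim!: eventually_mono simp: A_def not_le)
qed

end

section \<open>Wealth processes under the null\<close>

locale betting = unit_observations +
  fixes \<mu>0 :: real
  assumes mu0: "0 < \<mu>0" "\<mu>0 \<le> 1"
begin

definition strategy :: "(nat \<Rightarrow> 'a \<Rightarrow> real) \<Rightarrow> bool" where
  "strategy \<gamma> \<longleftrightarrow> predictable_process M X \<gamma> \<and> (\<forall>n\<ge>1. \<forall>\<omega>\<in>space M. \<gamma> n \<omega> \<in> {0..1/\<mu>0})"

lemma strategyD:
  assumes "strategy \<gamma>"
  shows "\<gamma> (Suc n) \<in> borel_measurable (F n)"
    and "1 \<le> n \<Longrightarrow> \<omega> \<in> space M \<Longrightarrow> 0 \<le> \<gamma> n \<omega>"
    and "1 \<le> n \<Longrightarrow> \<omega> \<in> space M \<Longrightarrow> \<gamma> n \<omega> \<le> 1/\<mu>0"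
proof -
  have "\<gamma> (Suc n) \<in> borel_measurable (F (Suc n - 1))"
    using assms unfolding strategy_def predictable_process_def by (metis le_add1 plus_1_eq_Suc)
  then show "\<gamma> (Suc n) \<in> borel_measurable (F n)" by simp
qed (use assms in \<open>auto simp: strategy_def\<close>)

lemma factor_bounds:
  assumes "strategy \<gamma>" "1 \<le> n" "\<omega> \<in> space M"
  shows "0 \<le> 1 + \<gamma> n \<omega> * (X n \<omega> - \<mu>0)" and "1 + \<gamma> n \<omega> * (X n \<omega> - \<mu>0) \<le> 1 / \<mu>0"
proof -
  have g: "0 \<le> \<gamma> n \<omega>" "\<gamma> n \<omega> \<le> 1/\<mu>0" and x: "0 \<le> X n \<omega>" "X n \<omega> \<le> 1"
    using strategyD[OF assms(1)] X_unit assms(2,3) by auto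
  have "\<gamma> n \<omega> * \<mu>0 \<le> 1" "0 \<le> \<gamma> n \<omega> * X n \<omega>" using g x mu0 by (auto simp: field_simps)
  then show "0 \<le> 1 + \<gamma> n \<omega> * (X n \<omega> - \<mu>0)" by (simp add: algebra_simps)
  have "\<gamma> n \<omega> * (X n \<omega> - \<mu>0) \<le> \<gamma> n \<omega> * (1 - \<mu>0)" using g x by (intro mult_left_mono) auto
  also have "\<dots> \<le> 1/\<mu>0 * (1 - \<mu>0)" using g mu0 by (intro mult_right_mono) auto
  finally show "1 + \<gamma> n \<omega> * (X n \<omega> - \<mu>0) \<le> 1 / \<mu>0" using mu0 by (simp add: field_simps)
qed

lemma wealth_Suc: "wealth X \<mu>0 \<gamma> (Suc n) \<omega> = wealth X \<mu>0 \<gamma> n \<omega> * (1 + \<gamma> (Suc n) \<omega> * (X (Suc n) \<omega> - \<mu>0))"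
  by (simp add: wealth_def)

lemma wealth_nonneg: "strategy \<gamma> \<Longrightarrow> \<omega> \<in> space M \<Longrightarrow> 0 \<le> wealth X \<mu>0 \<gamma> n \<omega>"
  unfolding wealth_def by (intro prod_nonneg) (auto intro: factor_bounds(1))

lemma wealth_le: "strategy \<gamma> \<Longrightarrow> \<omega> \<in> space M \<Longrightarrow> wealth X \<mu>0 \<gamma> n \<omega> \<le> (1/\<mu>0) ^ n"
proof -
  assume *: "strategy \<gamma>" "\<omega> \<in> space M"
  have "wealth X \<mu>0 \<gamma> n \<omega> \<le> (\<Prod>i=1..n. 1/\<mu>0)"
    unfolding wealth_def by (intro prod_mono) (use factor_bounds[OF *(1) _ *(2)] in auto)
  then show ?thesis by simp
qed

lemma wealth_F: "strategy \<gamma> \<Longrightarrow> wealth X \<mu>0 \<gamma> n \<in> borel_measurable (F n)"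
proof (induction n)
  case 0
  then show ?case by (simp add: wealth_def[abs_def])
next
  case (Suc n)
  have [measurable]: "wealth X \<mu>0 \<gamma> n \<in> borel_measurable (F (Suc n))"
    "\<gamma> (Suc n) \<in> borel_measurable (F (Suc n))" "X (Suc n) \<in> borel_measurable (F (Suc n))"
    using F_mono[OF Suc.IH[OF Suc.prems], of "Suc n"] F_mono[OF strategyD(1)[OF Suc.prems, of n], of "Suc n"] X_F
    by auto
  show ?case unfolding wealth_Suc[abs_def] by measurable
qed

lemma null_classD:
  assumes "P \<in> null_class M X \<mu>0"
  shows "P \<in> iid_laws M X" "(\<integral>\<omega>. X 1 \<omega> \<partial>P) \<le> \<mu>0"
  using assms by (auto simp: null_class_def)

text \<open>The factor \<open>1 + \<gamma>\<^sub>n (X\<^sub>n - \<mu>0)\<close> is affine in \<open>X\<^sub>n\<close> with a nonnegative slope known at time \<open>n - 1\<close>,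
  so replacing \<open>X\<^sub>n\<close> by its mean, and the mean by \<open>\<mu>0\<close>, can only increase the expectation.\<close>
lemma expectation_wealth_le:
  assumes \<gamma>: "strategy \<gamma>" and P: "P \<in> null_class M X \<mu>0"
  shows "(\<integral>\<omega>. wealth X \<mu>0 \<gamma> n \<omega> \<partial>P) \<le> 1"
proof (induction n)
  case 0
  interpret prob_space P using iid_lawsD(1) null_classD[OF P] by blast
  show ?case by (simp add: wealth_def prob_space)
next
  case (Suc n)
  have iid: "P \<in> iid_laws M X" using null_classD[OF P] by simp
  interpret prob_space P using iid_lawsD(1)[OF iid] .
  have sp: "space P = space M" using iid_lawsD(3)[OF iid] .
  let ?W = "wealth X \<mu>0 \<gamma> n" and ?g = "\<gamma> (Suc n)"
  have W: "?W \<in> borel_measurable (F n)" and g: "?g \<in> borel_measurable (F n)"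
    using wealth_F[OF \<gamma>] strategyD(1)[OF \<gamma>] by auto
  note [measurable] = F_measurable_P[OF iid W] F_measurable_P[OF iid g]
  have Wb: "0 \<le> ?W \<omega>" "?W \<omega> \<le> (1/\<mu>0)^n" and gb: "0 \<le> ?g \<omega>" "?g \<omega> \<le> 1/\<mu>0"
    if "\<omega> \<in> space P" for \<omega>
    using that wealth_nonneg[OF \<gamma>] wealth_le[OF \<gamma>] strategyD(2,3)[OF \<gamma>, of "Suc n"] by (auto simp: sp)
  have intW: "integrable P ?W"
    by (rule integrable_const_bound[where B="(1/\<mu>0)^n"]) (use Wb in auto)
  have intWg: "integrable P (\<lambda>\<omega>. ?W \<omega> * ?g \<omega>)"
  proof (rule integrable_const_bound[where B="(1/\<mu>0)^n * (1/\<mu>0)"])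
    have "\<bar>?W \<omega> * ?g \<omega>\<bar> \<le> (1/\<mu>0)^n * (1/\<mu>0)" if "\<omega> \<in> space P" for \<omega>
      unfolding abs_mult using Wb[OF that] gb[OF that] by (intro mult_mono) auto
    then show "AE \<omega> in P. norm (?W \<omega> * ?g \<omega>) \<le> (1/\<mu>0)^n * (1/\<mu>0)" by (intro AE_I2) simp
  qed measurable
  have XM: "X 1 \<in> borel_measurable P" using iid_lawsD(6)[OF iid] by simp
  have intX: "integrable P (X 1)"
    using X_unit[of 1] sp by (intro integrable_const_bound[where B=1] XM) auto
  have intid: "integrable (distr P borel (X 1)) (\<lambda>x. x)"
    and EX: "(\<integral>x. x \<partial>distr P borel (X 1)) = (\<integral>\<omega>. X 1 \<omega> \<partial>P)"
    using XM intX by (simp_all add: integrable_distr_eq integral_distr)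
  have WgF: "(\<lambda>\<omega>. ?W \<omega> * ?g \<omega>) \<in> borel_measurable (F n)" using W g by measurable
  note nxt = expectation_next[OF iid WgF _ intWg intid, unfolded EX]
  have "(\<integral>\<omega>. wealth X \<mu>0 \<gamma> (Suc n) \<omega> \<partial>P)
      = (\<integral>\<omega>. (?W \<omega> - \<mu>0 * (?W \<omega> * ?g \<omega>)) + ?W \<omega> * ?g \<omega> * X (Suc n) \<omega> \<partial>P)"
    by (simp add: wealth_Suc algebra_simps)
  also have "\<dots> = (\<integral>\<omega>. ?W \<omega> \<partial>P) - \<mu>0 * (\<integral>\<omega>. ?W \<omega> * ?g \<omega> \<partial>P) + (\<integral>\<omega>. ?W \<omega> * ?g \<omega> \<partial>P) * (\<integral>\<omega>. X 1 \<omega> \<partial>P)"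
    using intW intWg nxt by simp
  also have "\<dots> \<le> (\<integral>\<omega>. ?W \<omega> \<partial>P)"
  proof -
    have "0 \<le> (\<integral>\<omega>. ?W \<omega> * ?g \<omega> \<partial>P)" using Wb gb by (intro integral_nonneg_AE AE_I2) auto
    then have "(\<integral>\<omega>. ?W \<omega> * ?g \<omega> \<partial>P) * (\<integral>\<omega>. X 1 \<omega> \<partial>P) \<le> (\<integral>\<omega>. ?W \<omega> * ?g \<omega> \<partial>P) * \<mu>0"
      using null_classD(2)[OF P] by (rule mult_left_mono[rotated])
    then show ?thesis by (simp add: algebra_simps)
  qed
  also have "\<dots> \<le> 1" by (rule Suc.IH)
  finally show ?case .
qed

lemma nn_integral_wealth_le:
  assumes \<gamma>: "strategy \<gamma>" and P: "P \<in> null_class M X \<mu>0"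
  shows "(\<integral>\<^sup>+\<omega>. ennreal (wealth X \<mu>0 \<gamma> n \<omega>) \<partial>P) \<le> 1"
proof -
  have iid: "P \<in> iid_laws M X" using null_classD[OF P] by simp
  interpret prob_space P using iid_lawsD(1)[OF iid] .
  have b: "0 \<le> wealth X \<mu>0 \<gamma> n \<omega> \<and> wealth X \<mu>0 \<gamma> n \<omega> \<le> (1/\<mu>0)^n" if "\<omega> \<in> space P" for \<omega>
    using that wealth_nonneg[OF \<gamma>] wealth_le[OF \<gamma>] iid_lawsD(3)[OF iid] by simp
  have "integrable P (wealth X \<mu>0 \<gamma> n)"
    using b by (intro integrable_const_bound[where B="(1/\<mu>0)^n"] F_measurable_P[OF iid wealth_F[OF \<gamma>]]) auto
  then have "(\<integral>\<^sup>+\<omega>. ennreal (wealth X \<mu>0 \<gamma> n \<omega>) \<partial>P) = ennreal (\<integral>\<omega>. wealth X \<mu>0 \<gamma> n \<omega> \<partial>P)"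
    using b by (intro nn_integral_eq_integral AE_I2) auto
  also have "\<dots> \<le> ennreal 1" by (intro ennreal_leI expectation_wealth_le assms)
  finally show ?thesis by simp
qed

lemma nn_integral_e_process_le:
  assumes W': "e_process M X \<mu>0 W'" and P: "P \<in> null_class M X \<mu>0" and n: "1 \<le> n"
  shows "(\<integral>\<^sup>+\<omega>. ennreal (W' n \<omega>) \<partial>P) \<le> 1"
proof -
  have iid: "P \<in> iid_laws M X" using null_classD[OF P] by simp
  interpret prob_space P using iid_lawsD(1)[OF iid] .
  obtain Y where Y: "test_supermartingale M X P Y" and le: "AE \<omega> in P. \<forall>n\<ge>1. W' n \<omega> \<le> Y n \<omega>"
    using W' P unfolding e_process_def by blast
  have YP: "Y n \<in> borel_measurable P" if "1 \<le> n" for n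
    using that Y F_measurable_P[OF iid] unfolding test_supermartingale_def adapted_process_def by blast
  have "(\<integral>\<^sup>+\<omega>. ennreal (Y n \<omega>) \<partial>P) \<le> 1" using n
  proof (induction n rule: nat_induct_at_least)
    case base
    then show ?case using Y by (simp add: test_supermartingale_def)
  next
    case (Suc n)
    interpret F: finite_measure_subalgebra P "F n"
      by unfold_locales (rule iid_lawsD(7)[OF iid])
    have AE: "AE \<omega> in P. nn_cond_exp P (F n) (\<lambda>\<omega>. ennreal (Y (Suc n) \<omega>)) \<omega> \<le> ennreal (Y n \<omega>)"
    proof -
      have "2 \<le> Suc n" using Suc.hyps by simp
      then have "AE \<omega> in P. nn_cond_exp P (F (Suc n - 1)) (\<lambda>\<omega>. ennreal (Y (Suc n) \<omega>)) \<omega> \<le> ennreal (Y (Suc n - 1) \<omega>)"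
        using Y unfolding test_supermartingale_def by blast
      then show ?thesis by simp
    qed
    have "(\<integral>\<^sup>+\<omega>. ennreal (Y (Suc n) \<omega>) \<partial>P) = (\<integral>\<^sup>+\<omega>. nn_cond_exp P (F n) (\<lambda>\<omega>. ennreal (Y (Suc n) \<omega>)) \<omega> \<partial>P)"
      using F.nn_cond_exp_intg[of "\<lambda>_. 1" "\<lambda>\<omega>. ennreal (Y (Suc n) \<omega>)"] YP[of "Suc n"] by simp
    also have "\<dots> \<le> (\<integral>\<^sup>+\<omega>. ennreal (Y n \<omega>) \<partial>P)"
      by (rule nn_integral_mono_AE[OF AE])
    finally show ?case using Suc.IH by simp
  qed
  moreover have "(\<integral>\<^sup>+\<omega>. ennreal (W' n \<omega>) \<partial>P) \<le> (\<integral>\<^sup>+\<omega>. ennreal (Y n \<omega>) \<partial>P)"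
    using le n by (intro nn_integral_mono_AE) (auto elim!: eventually_mono intro!: ennreal_leI)
  ultimately show ?thesis by simp
qed

lemma hitting_time_le_iff:
  "hitting_time X \<mu>0 \<gamma> \<alpha> \<omega> \<le> enat n \<longleftrightarrow> (\<exists>k\<in>{1..n}. 1/\<alpha> \<le> wealth X \<mu>0 \<gamma> k \<omega>)"
proof
  let ?S = "{enat n | n. 1 \<le> n \<and> wealth X \<mu>0 \<gamma> n \<omega> \<ge> 1 / \<alpha>}"
  assume le: "hitting_time X \<mu>0 \<gamma> \<alpha> \<omega> \<le> enat n"
  then have "?S \<noteq> {}" unfolding hitting_time_def by (metis Inf_enat_def enat_ord_code(5) infinity_ileE)
  then have "Inf ?S \<in> ?S" unfolding Inf_enat_def by (simp only: if_False) (metis (mono_tags, lifting) LeastI ex_in_conv)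
  then show "\<exists>k\<in>{1..n}. 1/\<alpha> \<le> wealth X \<mu>0 \<gamma> k \<omega>"
    using le unfolding hitting_time_def[symmetric] by auto
next
  assume "\<exists>k\<in>{1..n}. 1/\<alpha> \<le> wealth X \<mu>0 \<gamma> k \<omega>"
  then obtain k where k: "1 \<le> k" "k \<le> n" "1/\<alpha> \<le> wealth X \<mu>0 \<gamma> k \<omega>" by auto
  have "hitting_time X \<mu>0 \<gamma> \<alpha> \<omega> \<le> enat k"
    unfolding hitting_time_def by (rule Inf_lower) (use k in auto)
  then show "hitting_time X \<mu>0 \<gamma> \<alpha> \<omega> \<le> enat n" using k(2) by (meson enat_ord_simps(1) order_trans)
qed

lemma hitting_time_stopping:
  assumes \<gamma>: "strategy \<gamma>"
  shows "stopping_time (nat_filtration M X) (hitting_time X \<mu>0 \<gamma> \<alpha>)"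
  unfolding stopping_time_def
proof
  fix t :: enat
  show "Measurable.pred (nat_filtration M X t) (\<lambda>\<omega>. hitting_time X \<mu>0 \<gamma> \<alpha> \<omega> \<le> t)"
  proof (cases t)
    case (enat n)
    have "Measurable.pred (F n) (\<lambda>\<omega>. \<exists>k\<in>{1..n}. 1/\<alpha> \<le> wealth X \<mu>0 \<gamma> k \<omega>)"
    proof (intro pred_intros_finite)
      fix k assume "k \<in> {1..n}"
      then have [measurable]: "wealth X \<mu>0 \<gamma> k \<in> borel_measurable (F n)"
        using F_mono[OF wealth_F[OF \<gamma>], of k n] by simp
      show "Measurable.pred (F n) (\<lambda>\<omega>. 1/\<alpha> \<le> wealth X \<mu>0 \<gamma> k \<omega>)" by measurable
    qed simp
    then show ?thesis by (simp add: enat hitting_time_le_iff)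
  qed simp
qed

lemma stopping_time_sets:
  assumes "stopping_time (nat_filtration M X) \<tau>"
  shows "{\<omega> \<in> space M. \<tau> \<omega> \<le> enat n} \<in> sets (F n)"
    and "{\<omega> \<in> space M. enat n < \<tau> \<omega>} \<in> sets (F n)"
    and "{\<omega> \<in> space M. \<tau> \<omega> = enat n} \<in> sets (F n)"
proof -
  have le: "{\<omega> \<in> space M. \<tau> \<omega> \<le> enat n} \<in> sets (F n)" for n
    using stopping_timeD[OF assms, of "enat n"] by (simp add: Measurable.pred_def)
  then show "{\<omega> \<in> space M. \<tau> \<omega> \<le> enat n} \<in> sets (F n)" .
  have "{\<omega> \<in> space M. enat n < \<tau> \<omega>} = space (F n) - {\<omega> \<in> space M. \<tau> \<omega> \<le> enat n}" by auto
  then show "{\<omega> \<in> space M. enat n < \<tau> \<omega>} \<in> sets (F n)" using sets.compl_sets[OF le[of n]] by simp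
  show "{\<omega> \<in> space M. \<tau> \<omega> = enat n} \<in> sets (F n)"
  proof (cases n)
    case 0
    then have "{\<omega> \<in> space M. \<tau> \<omega> = enat n} = {\<omega> \<in> space M. \<tau> \<omega> \<le> enat n}"
      by (auto simp: zero_enat_def[symmetric])
    then show ?thesis using le by simp
  next
    case (Suc m)
    have "{\<omega> \<in> space M. \<tau> \<omega> = enat n} = {\<omega> \<in> space M. \<tau> \<omega> \<le> enat n} - {\<omega> \<in> space M. \<tau> \<omega> \<le> enat m}"
    proof (intro set_eqI)
      fix \<omega>
      show "\<omega> \<in> {\<omega> \<in> space M. \<tau> \<omega> = enat n} \<longleftrightarrow>
          \<omega> \<in> {\<omega> \<in> space M. \<tau> \<omega> \<le> enat n} - {\<omega> \<in> space M. \<tau> \<omega> \<le> enat m}"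
        unfolding Suc by (cases "\<tau> \<omega>") auto
    qed
    moreover have "{\<omega> \<in> space M. \<tau> \<omega> \<le> enat m} \<in> sets (F n)"
      using le[of m] sets_F_mono[of m n] Suc by auto
    ultimately show ?thesis using le[of n] by auto
  qed
qed

text \<open>Ville's inequality. Betting nothing after the hitting time is again a strategy; its wealth freezes at a
  value of at least \<open>1/\<alpha>\<close>, so Markov's inequality applies to it at every fixed time.\<close>
lemma ville:
  assumes \<gamma>: "strategy \<gamma>" and P: "P \<in> null_class M X \<mu>0" and \<alpha>: "0 < \<alpha>"
  shows "emeasure P {\<omega> \<in> space M. hitting_time X \<mu>0 \<gamma> \<alpha> \<omega> < \<infinity>} \<le> ennreal \<alpha>"
proof -
  define \<tau> where "\<tau> = hitting_time X \<mu>0 \<gamma> \<alpha>"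
  \<comment> \<open>The event \<open>i \<le> \<tau>\<close> is known at time \<open>i - 1\<close>, so stopping keeps the bets predictable.\<close>
  define \<gamma>' where "\<gamma>' i \<omega> = (if enat i \<le> \<tau> \<omega> then \<gamma> i \<omega> else 0)" for i \<omega>
  have iid: "P \<in> iid_laws M X" using null_classD[OF P] by simp
  have st: "stopping_time (nat_filtration M X) \<tau>" unfolding \<tau>_def by (rule hitting_time_stopping[OF \<gamma>])
  have \<gamma>': "strategy \<gamma>'"
    unfolding strategy_def predictable_process_def
  proof (intro conjI allI impI ballI)
    fix n :: nat assume "1 \<le> n"
    then obtain m where n: "n = Suc m" by (cases n) auto
    have eq: "enat n \<le> \<tau> \<omega> \<longleftrightarrow> enat m < \<tau> \<omega>" for \<omega> by (simp add: n Suc_ile_eq)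
    have [measurable]: "\<gamma> n \<in> borel_measurable (F m)" using strategyD(1)[OF \<gamma>] n by simp
    have [measurable]: "Measurable.pred (F m) (\<lambda>\<omega>. enat m < \<tau> \<omega>)"
      using stopping_time_sets(2)[OF st, of m] by (simp add: Measurable.pred_def)
    have "(\<lambda>\<omega>. if enat m < \<tau> \<omega> then \<gamma> n \<omega> else 0) \<in> borel_measurable (F m)" by measurable
    then show "\<gamma>' n \<in> borel_measurable (F (n - 1))" by (simp add: \<gamma>'_def[abs_def] eq n[symmetric], simp add: n)
  next
    fix n :: nat and \<omega> assume "1 \<le> n" "\<omega> \<in> space M"
    then show "\<gamma>' n \<omega> \<in> {0..1/\<mu>0}"
      using strategyD(2,3)[OF \<gamma>, of n \<omega>] mu0 by (simp add: \<gamma>'_def)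
  qed
  have bound: "emeasure P {\<omega> \<in> space M. \<tau> \<omega> \<le> enat n} \<le> ennreal \<alpha>" for n
  proof -
    have sub: "1/\<alpha> \<le> wealth X \<mu>0 \<gamma>' n \<omega>" if \<omega>: "\<omega> \<in> space M" "\<tau> \<omega> \<le> enat n" for \<omega>
    proof -
      obtain k where k: "\<tau> \<omega> = enat k" using \<omega>(2) enat_ile by blast
      have kn: "k \<le> n" using \<omega>(2) k by simp
      obtain j where j: "j \<in> {1..k}" "1/\<alpha> \<le> wealth X \<mu>0 \<gamma> j \<omega>"
        using hitting_time_le_iff[of \<gamma> \<alpha> \<omega> k] k unfolding \<tau>_def by auto
      have "\<tau> \<omega> \<le> enat j" unfolding \<tau>_def hitting_time_le_iff using j by auto
      then have "j = k" using j k by auto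
      have "wealth X \<mu>0 \<gamma>' n \<omega> = wealth X \<mu>0 \<gamma> k \<omega>"
        unfolding wealth_def using kn
        by (intro prod.mono_neutral_cong_right) (auto simp: \<gamma>'_def k)
      then show ?thesis using j \<open>j = k\<close> by simp
    qed
    have "emeasure P {\<omega> \<in> space M. \<tau> \<omega> \<le> enat n} \<le> emeasure P {\<omega> \<in> space P. 1 \<le> ennreal \<alpha> * ennreal (wealth X \<mu>0 \<gamma>' n \<omega>)}"
    proof (rule emeasure_mono)
      show "{\<omega> \<in> space M. \<tau> \<omega> \<le> enat n} \<subseteq> {\<omega> \<in> space P. 1 \<le> ennreal \<alpha> * ennreal (wealth X \<mu>0 \<gamma>' n \<omega>)}"
      proof safe
        fix \<omega> assume "\<omega> \<in> space M" "\<tau> \<omega> \<le> enat n"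
        then have "1 \<le> \<alpha> * wealth X \<mu>0 \<gamma>' n \<omega>" using sub[of \<omega>] \<alpha> by (simp add: field_simps)
        then show "1 \<le> ennreal \<alpha> * ennreal (wealth X \<mu>0 \<gamma>' n \<omega>)"
          using \<alpha> by (simp add: ennreal_mult'[symmetric] ennreal_1[symmetric] del: ennreal_1)
      qed (simp_all add: iid_lawsD(3)[OF iid])
      have [measurable]: "wealth X \<mu>0 \<gamma>' n \<in> borel_measurable P" by (rule F_measurable_P[OF iid wealth_F[OF \<gamma>']])
      show "{\<omega> \<in> space P. 1 \<le> ennreal \<alpha> * ennreal (wealth X \<mu>0 \<gamma>' n \<omega>)} \<in> sets P" by measurable
    qed
    also have "\<dots> \<le> ennreal \<alpha> * (\<integral>\<^sup>+\<omega>. ennreal (wealth X \<mu>0 \<gamma>' n \<omega>) \<partial>P)"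
      by (intro markov_inequality_space measurable_compose[OF F_measurable_P[OF iid wealth_F[OF \<gamma>']]]) measurable
    also have "\<dots> \<le> ennreal \<alpha> * 1" by (intro mult_left_mono nn_integral_wealth_le \<gamma>' P) simp
    finally show ?thesis by simp
  qed
  have "{\<omega> \<in> space M. \<tau> \<omega> < \<infinity>} = (\<Union>n. {\<omega> \<in> space M. \<tau> \<omega> \<le> enat n})"
  proof (intro set_eqI)
    fix \<omega>
    show "\<omega> \<in> {\<omega> \<in> space M. \<tau> \<omega> < \<infinity>} \<longleftrightarrow> \<omega> \<in> (\<Union>n. {\<omega> \<in> space M. \<tau> \<omega> \<le> enat n})"
      by (cases "\<tau> \<omega>") auto
  qed
  moreover have "(SUP n. emeasure P {\<omega> \<in> space M. \<tau> \<omega> \<le> enat n}) = emeasure P (\<Union>n. {\<omega> \<in> space M. \<tau> \<omega> \<le> enat n})"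
  proof (rule SUP_emeasure_incseq)
    show "range (\<lambda>n. {\<omega> \<in> space M. \<tau> \<omega> \<le> enat n}) \<subseteq> sets P"
      using stopping_time_sets(1)[OF st] sets_F_subset iid_lawsD(2)[OF iid] by auto
    show "incseq (\<lambda>n. {\<omega> \<in> space M. \<tau> \<omega> \<le> enat n})"
      by (auto simp: incseq_def intro: order_trans)
  qed
  ultimately show ?thesis using bound unfolding \<tau>_def by (metis (no_types, lifting) SUP_least)
qed

text \<open>The supremum in the regret is at least 0 (bet nothing), so a vanishing wealth would give infinite
  regret. Hence the extended-real condition amounts to a real inequality against each constant bet
  that does not go bankrupt.\<close>
lemma regret_bound:
  assumes "sublinear_portfolio_regret M X \<mu>0 \<gamma>"
  obtains r :: "nat \<Rightarrow> real" where "r \<in> o(\<lambda>n. real n)"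
    and "\<And>n \<omega> h. 1 \<le> n \<Longrightarrow> \<omega> \<in> space M \<Longrightarrow> h \<in> {0..1/\<mu>0} \<Longrightarrow>
      (\<And>i. i \<in> {1..n} \<Longrightarrow> 0 < 1 + h * (X i \<omega> - \<mu>0)) \<Longrightarrow>
      0 < wealth X \<mu>0 \<gamma> n \<omega> \<and>
      (\<Sum>i=1..n. ln (1 + h * (X i \<omega> - \<mu>0))) - r n \<le> ln (wealth X \<mu>0 \<gamma> n \<omega>)"
proof -
  obtain r :: "nat \<Rightarrow> real" where r: "r \<in> o(\<lambda>n. real n)"
    and reg: "\<And>n \<omega>. 1 \<le> n \<Longrightarrow> \<omega> \<in> space M \<Longrightarrow>
      (SUP g\<in>{0..1/\<mu>0}. \<Sum>i=1..n. elog (1 + g * (X i \<omega> - \<mu>0))) - elog (wealth X \<mu>0 \<gamma> n \<omega>) \<le> ereal (r n)"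
    using assms unfolding sublinear_portfolio_regret_def by blast
  show ?thesis
  proof (rule that[OF r])
    fix n \<omega> h
    assume n: "1 \<le> n" and \<omega>: "\<omega> \<in> space M" and h: "h \<in> {0..1/\<mu>0}"
      and pos: "\<And>i. i \<in> {1..n} \<Longrightarrow> 0 < 1 + h * (X i \<omega> - \<mu>0)"
    define S where "S = (SUP g\<in>{0..1/\<mu>0}. \<Sum>i=1..n. elog (1 + g * (X i \<omega> - \<mu>0)))"
    let ?s = "\<Sum>i=1..n. ln (1 + h * (X i \<omega> - \<mu>0))" and ?W = "wealth X \<mu>0 \<gamma> n \<omega>"
    have "ereal ?s = (\<Sum>i=1..n. elog (1 + h * (X i \<omega> - \<mu>0)))"
      unfolding sum_ereal[symmetric]
    proof (intro sum.cong refl)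
      fix i assume "i \<in> {1..n}"
      then show "ereal (ln (1 + h * (X i \<omega> - \<mu>0))) = elog (1 + h * (X i \<omega> - \<mu>0))"
        using pos[of i] by (simp add: elog_def)
    qed
    also have "\<dots> \<le> S" unfolding S_def using h by (rule SUP_upper)
    finally have s: "ereal ?s \<le> S" .
    have S: "S - elog ?W \<le> ereal (r n)" unfolding S_def by (rule reg[OF n \<omega>])
    have W: "0 < ?W"
    proof (rule ccontr)
      assume "\<not> 0 < ?W"
      then have "elog ?W = - \<infinity>" by (simp add: elog_def)
      with S s show False by (cases S) auto
    qed
    have "ereal ?s - ereal (ln ?W) \<le> S - elog ?W"
      using W s by (intro ereal_minus_mono) (auto simp: elog_def)
    also note S
    finally show "0 < ?W \<and> ?s - r n \<le> ln ?W" using W by simp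
  qed
qed

end

section \<open>Asymptotic growth under the alternative\<close>

text \<open>The optimal pair of the introduction: \<open>g\<close> is a growth-optimal bet under \<open>Q\<close>, and \<open>P\<close> is a null
  distribution whose marginal is the corresponding dual law. Its wealth process \<open>V\<close> is the likelihood ratio of
  \<open>Q\<close> against \<open>P\<close>.\<close>
locale growth_optimal = betting M X \<mu>0 + law: optimal_bet "distr Q borel (X 1)" \<mu>0 g
  for M :: "'a measure" and X and \<mu>0 and Q and g +
  fixes P :: "'a measure"
  assumes Q_iid: "Q \<in> iid_laws M X" and P_null: "P \<in> null_class M X \<mu>0"
    and P_law: "distr P borel (X 1) = law.dual_law"
begin

abbreviation V :: "nat \<Rightarrow> 'a \<Rightarrow> real" where "V \<equiv> wealth X \<mu>0 (\<lambda>_ _. g)"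

lemma P_iid: "P \<in> iid_laws M X" using null_classD[OF P_null] by simp

sublocale Q: prob_space Q using iid_lawsD(1)[OF Q_iid] .

lemma space_Q: "space Q = space M" and space_P: "space P = space M"
  using iid_lawsD(3) Q_iid P_iid by blast+

lemma strategy_const: "strategy (\<lambda>_ _. g)"
  using law.g_bets by (auto simp: strategy_def predictable_process_def)

lemma V_nonneg: "\<omega> \<in> space M \<Longrightarrow> 0 \<le> V n \<omega>"
  by (rule wealth_nonneg[OF strategy_const])

lemma V_F: "V n \<in> borel_measurable (F n)"
  by (rule wealth_F[OF strategy_const])

lemma factors_pos: "AE \<omega> in Q. \<forall>i\<ge>1. 0 < law.payoff g (X i \<omega>)"
proof -
  have "AE \<omega> in Q. 1 \<le> i \<longrightarrow> 0 < law.payoff g (X i \<omega>)" for i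
  proof (cases "1 \<le> i")
    case True
    have "AE x in distr Q borel (X i). 0 < law.payoff g x"
      unfolding iid_lawsD(5)[OF Q_iid True] by (rule law.payoff_pos)
    then show ?thesis using iid_lawsD(6)[OF Q_iid True] by (subst (asm) AE_distr_iff) auto
  qed simp
  then show ?thesis by (simp add: AE_all_countable)
qed

lemma V_pos: "AE \<omega> in Q. \<forall>n. 0 < V n \<omega>"
  using factors_pos by eventually_elim (auto simp: wealth_def intro!: prod_pos)

lemma change_of_measure:
  assumes "h \<in> borel_measurable (F n)"
  shows "(\<integral>\<^sup>+\<omega>. h \<omega> \<partial>Q) = (\<integral>\<^sup>+\<omega>. h \<omega> * ennreal (V n \<omega>) \<partial>P)"
proof -
  have "(\<integral>\<^sup>+\<omega>. h \<omega> \<partial>Q) = (\<integral>\<^sup>+\<omega>. h \<omega> * (\<Prod>i=1..n. law.f (X i \<omega>)) \<partial>P)"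
  proof (rule nn_integral_change_of_law[OF P_iid Q_iid _ _ assms])
    show "distr Q borel (X 1) = density (distr P borel (X 1)) law.f"
      unfolding P_law by (rule law.density_dual_law)
  qed measurable
  also have "\<dots> = (\<integral>\<^sup>+\<omega>. h \<omega> * ennreal (V n \<omega>) \<partial>P)"
  proof (intro nn_integral_cong)
    fix \<omega> assume "\<omega> \<in> space P"
    then have "(\<Prod>i=1..n. law.f (X i \<omega>)) = ennreal (\<Prod>i=1..n. law.payoff g (X i \<omega>))"
      using X_unit law.g_bets by (intro prod_ennreal law.payoff_nonneg) (auto simp: space_P)
    then show "h \<omega> * (\<Prod>i=1..n. law.f (X i \<omega>)) = h \<omega> * ennreal (V n \<omega>)"
      by (simp add: wealth_def)
  qed
  finally show ?thesis .
qed

text \<open>Equality may fail only where \<open>V n = 0\<close>, which \<open>P\<close> may charge and \<open>Q\<close> does not.\<close>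
lemma nn_integral_ratio_le:
  assumes Y[measurable]: "Y \<in> borel_measurable (F n)" and Y0: "\<And>\<omega>. \<omega> \<in> space M \<Longrightarrow> 0 \<le> Y \<omega>"
  shows "(\<integral>\<^sup>+\<omega>. ennreal (Y \<omega> / V n \<omega>) \<partial>Q) \<le> (\<integral>\<^sup>+\<omega>. ennreal (Y \<omega>) \<partial>P)"
proof -
  note [measurable] = V_F
  have "(\<integral>\<^sup>+\<omega>. ennreal (Y \<omega> / V n \<omega>) \<partial>Q) = (\<integral>\<^sup>+\<omega>. ennreal (Y \<omega> / V n \<omega>) * ennreal (V n \<omega>) \<partial>P)"
    by (rule change_of_measure) measurable
  also have "\<dots> \<le> (\<integral>\<^sup>+\<omega>. ennreal (Y \<omega>) \<partial>P)"
  proof (intro nn_integral_mono)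
    fix \<omega> assume "\<omega> \<in> space P"
    then have "0 \<le> V n \<omega>" "0 \<le> Y \<omega>" using V_nonneg Y0 by (auto simp: space_P)
    then show "ennreal (Y \<omega> / V n \<omega>) * ennreal (V n \<omega>) \<le> ennreal (Y \<omega>)"
      by (cases "V n \<omega> = 0") (simp_all add: ennreal_mult''[symmetric])
  qed
  finally show ?thesis .
qed

lemma eventually_below_V:
  assumes Y: "\<And>n. 1 \<le> n \<Longrightarrow> Y n \<in> borel_measurable (F n)"
    and Y0: "\<And>n \<omega>. 1 \<le> n \<Longrightarrow> \<omega> \<in> space M \<Longrightarrow> 0 \<le> Y n \<omega>"
    and EY: "\<And>n. 1 \<le> n \<Longrightarrow> (\<integral>\<^sup>+\<omega>. ennreal (Y n \<omega>) \<partial>P) \<le> 1" and \<delta>: "0 < \<delta>"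
  shows "AE \<omega> in Q. \<forall>\<^sub>F n in sequentially. Y n \<omega> < exp (real n * \<delta>) * V n \<omega>"
proof -
  define A where "A n = {\<omega> \<in> space Q. exp (real (Suc n) * \<delta>) \<le> Y (Suc n) \<omega> / V (Suc n) \<omega>}" for n
  have [measurable]: "Y (Suc n) \<in> borel_measurable Q" "V (Suc n) \<in> borel_measurable Q" for n
    using F_measurable_P[OF Q_iid Y[of "Suc n"]] F_measurable_P[OF Q_iid V_F] by auto
  have A: "A n \<in> sets Q" for n unfolding A_def by measurable
  have le: "measure Q (A n) \<le> exp (- \<delta>) ^ Suc n" for n
  proof -
    let ?c = "ennreal (exp (- (real (Suc n) * \<delta>)))"
    have "A n \<subseteq> {\<omega> \<in> space Q. 1 \<le> ?c * ennreal (Y (Suc n) \<omega> / V (Suc n) \<omega>)}"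
    proof
      fix \<omega> assume \<omega>: "\<omega> \<in> A n"
      then have "exp (- (real (Suc n) * \<delta>)) * exp (real (Suc n) * \<delta>) \<le> exp (- (real (Suc n) * \<delta>)) * (Y (Suc n) \<omega> / V (Suc n) \<omega>)"
        unfolding A_def by (intro mult_left_mono) auto
      then have "1 \<le> exp (- (real (Suc n) * \<delta>)) * (Y (Suc n) \<omega> / V (Suc n) \<omega>)"
        unfolding exp_add[symmetric] by simp
      then show "\<omega> \<in> {\<omega> \<in> space Q. 1 \<le> ?c * ennreal (Y (Suc n) \<omega> / V (Suc n) \<omega>)}"
        using \<omega> by (simp add: A_def ennreal_mult'[symmetric] ennreal_1[symmetric] del: ennreal_1)
    qed
    then have "emeasure Q (A n) \<le> emeasure Q {\<omega> \<in> space Q. 1 \<le> ?c * ennreal (Y (Suc n) \<omega> / V (Suc n) \<omega>)}"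
      by (rule emeasure_mono) measurable
    also have "\<dots> \<le> ?c * (\<integral>\<^sup>+\<omega>. ennreal (Y (Suc n) \<omega> / V (Suc n) \<omega>) \<partial>Q)"
      by (rule markov_inequality_space) measurable
    also have "\<dots> \<le> ?c * 1"
      by (intro mult_left_mono order_trans[OF nn_integral_ratio_le[OF Y Y0] EY]) auto
    finally have "ennreal (measure Q (A n)) \<le> ?c" by (simp add: Q.emeasure_eq_measure)
    then have "measure Q (A n) \<le> exp (real (Suc n) * (- \<delta>))" by simp
    then show ?thesis by (simp only: exp_of_nat_mult)
  qed
  have "summable (\<lambda>n. measure Q (A n))"
    by (rule summable_comparison_test'[of "\<lambda>n. exp (- \<delta>) ^ Suc n"])
      (use le \<delta> in \<open>auto intro!: summable_mult summable_geometric\<close>)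
  then have "AE \<omega> in Q. \<forall>\<^sub>F n in sequentially. \<omega> \<in> space Q - A n"
    using A by (intro borel_cantelli_AE1) (auto simp: Q.emeasure_eq_measure)
  then show ?thesis
    using V_pos
  proof eventually_elim
    case (elim \<omega>)
    have "\<forall>\<^sub>F n in sequentially. Y (Suc n) \<omega> < exp (real (Suc n) * \<delta>) * V (Suc n) \<omega>"
      using elim(1)
    proof eventually_elim
      case (elim n)
      have "0 < V (Suc n) \<omega>" using \<open>\<forall>n. 0 < V n \<omega>\<close> by blast
      then show ?case using elim by (simp add: A_def not_le pos_divide_less_eq)
    qed
    then show ?case by (rule eventually_sequentially_Suc[THEN iffD1])
  qed
qed

text \<open>Up to a factor \<open>e\<^bsup>n\<delta>\<^esup>\<close>, \<open>Y n\<close> is eventually below \<open>V n\<close>, whose log is a sum of i.i.d. terms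
  bounded above by truncated ones. The error \<open>3 \<delta>\<close> collects this factor, the truncation and the strong law.\<close>
lemma limsup_growth_le:
  assumes Y: "\<And>n. 1 \<le> n \<Longrightarrow> Y n \<in> borel_measurable (F n)"
    and Y0: "\<And>n \<omega>. 1 \<le> n \<Longrightarrow> \<omega> \<in> space M \<Longrightarrow> 0 \<le> Y n \<omega>"
    and EY: "\<And>n. 1 \<le> n \<Longrightarrow> (\<integral>\<^sup>+\<omega>. ennreal (Y n \<omega>) \<partial>P) \<le> 1"
  shows "AE \<omega> in Q. limsup (\<lambda>n. elog (Y n \<omega>) / ereal (real n)) \<le> ereal law.rate"
proof -
  have step: "AE \<omega> in Q. limsup (\<lambda>n. elog (Y n \<omega>) / ereal (real n)) \<le> ereal (law.rate + 3 * \<delta>)" if \<delta>: "0 < \<delta>" for \<delta>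
  proof -
    obtain \<epsilon> where \<epsilon>: "0 < \<epsilon>" "\<epsilon> \<le> 1"
      "(\<integral>x. ln (max (law.payoff g x) \<epsilon>) \<partial>distr Q borel (X 1)) \<le> law.rate + \<delta>"
      using law.truncated_rate[OF \<delta>] by blast
    define \<phi> where "\<phi> x = ln (max (law.payoff g x) \<epsilon>)" for x
    have [measurable]: "\<phi> \<in> borel_measurable borel" unfolding \<phi>_def by measurable
    have b: "\<bar>\<phi> x\<bar> \<le> \<bar>ln \<epsilon>\<bar> + \<bar>ln (1/\<mu>0)\<bar>" if "x \<in> {0..1}" for x
    proof -
      have "1 \<le> 1/\<mu>0" using mu0 by simp
      then have "max (law.payoff g x) \<epsilon> \<le> 1/\<mu>0"
        using law.payoff_le[OF law.g_bets that] \<epsilon>(2) by (auto intro: order_trans)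
      then have "\<phi> x \<le> ln (1/\<mu>0)" unfolding \<phi>_def using \<epsilon> by (intro ln_mono) auto
      moreover have "ln \<epsilon> \<le> \<phi> x" unfolding \<phi>_def using \<epsilon> by (intro ln_mono) auto
      ultimately show ?thesis by linarith
    qed
    have "AE \<omega> in Q. \<forall>\<^sub>F n in sequentially.
        \<bar>(\<Sum>i=1..n. \<phi> (X i \<omega>)) - real n * (\<integral>x. \<phi> x \<partial>distr Q borel (X 1))\<bar> < real n * \<delta>"
      by (rule strong_law_bounded[OF Q_iid _ b \<delta>]) measurable
    moreover have "AE \<omega> in Q. \<forall>\<^sub>F n in sequentially. Y n \<omega> < exp (real n * \<delta>) * V n \<omega>"
      by (rule eventually_below_V[OF Y Y0 EY \<delta>])
    ultimately show ?thesis
      using factors_pos V_pos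
    proof eventually_elim
      case (elim \<omega>)
      have "\<forall>\<^sub>F n in sequentially. elog (Y n \<omega>) / ereal (real n) \<le> ereal (law.rate + 3 * \<delta>)"
        using elim(1,2) eventually_gt_at_top[of "0::nat"]
      proof eventually_elim
        case (elim n)
        have pos: "0 < law.payoff g (X i \<omega>)" if "i \<in> {1..n}" for i
          using \<open>\<forall>i\<ge>1. 0 < law.payoff g (X i \<omega>)\<close> that by simp
        have "ln (V n \<omega>) = (\<Sum>i=1..n. ln (law.payoff g (X i \<omega>)))"
          unfolding wealth_def
        proof (rule ln_prod[OF finite_atLeastAtMost])
          show "law.payoff g (X i \<omega>) \<noteq> 0" if "i \<in> {1..n}" for i using pos[OF that] by simp
        qed
        also have "\<dots> \<le> (\<Sum>i=1..n. \<phi> (X i \<omega>))"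
          unfolding \<phi>_def using pos by (intro sum_mono ln_mono) auto
        also have "\<dots> \<le> real n * (law.rate + \<delta>) + real n * \<delta>"
        proof -
          have "real n * (\<integral>x. \<phi> x \<partial>distr Q borel (X 1)) \<le> real n * (law.rate + \<delta>)"
            using \<epsilon>(3) unfolding \<phi>_def by (intro mult_left_mono) auto
          then show ?thesis using elim(1) by linarith
        qed
        finally have V: "ln (V n \<omega>) \<le> real n * (law.rate + 2 * \<delta>)" by (simp add: algebra_simps)
        show ?case
        proof (cases "Y n \<omega> \<le> 0")
          case True
          then show ?thesis using elim(3) by (simp add: elog_def)
        next
          case False
          have Vp: "0 < V n \<omega>" using \<open>\<forall>n. 0 < V n \<omega>\<close> by blast
          have "ln (Y n \<omega>) \<le> ln (exp (real n * \<delta>) * V n \<omega>)"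
            using elim(2) False by (intro ln_mono) auto
          also have "\<dots> = real n * \<delta> + ln (V n \<omega>)" using Vp by (simp add: ln_mult)
          also have "\<dots> \<le> real n * (law.rate + 3 * \<delta>)" using V by (simp add: algebra_simps)
          finally have "ln (Y n \<omega>) / real n \<le> law.rate + 3 * \<delta>"
            using elim(3) by (simp add: pos_divide_le_eq mult.commute)
          then show ?thesis using False elim(3) by (simp add: elog_def)
        qed
      qed
      then show ?case by (rule Limsup_bounded)
    qed
  qed
  have "AE \<omega> in Q. \<forall>k::nat. limsup (\<lambda>n. elog (Y n \<omega>) / ereal (real n)) \<le> ereal (law.rate + 3 * (1 / (real k + 1)))"
    unfolding AE_all_countable by (intro allI step) simp
  then show ?thesis
  proof eventually_elim
    case (elim \<omega>)
    have "(\<lambda>k. 1 / (real k + 1)) \<longlonglongrightarrow> 0"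
      using LIMSEQ_ignore_initial_segment[OF lim_1_over_n, of 1] by (simp add: add.commute)
    then have "(\<lambda>k. law.rate + 3 * (1 / (real k + 1))) \<longlonglongrightarrow> law.rate + 3 * 0"
      by (intro tendsto_intros)
    then have "(\<lambda>k. ereal (law.rate + 3 * (1 / (real k + 1)))) \<longlonglongrightarrow> ereal law.rate" by simp
    then show ?case by (rule LIMSEQ_le_const) (use elim in blast)
  qed
qed

lemma ln_payoff_bounded:
  assumes t: "0 < t" "t < 1" and x: "x \<in> {0..1}"
  shows "\<bar>ln (law.payoff ((1 - t) * g) x)\<bar> \<le> \<bar>ln t\<bar> + \<bar>ln (1/\<mu>0)\<bar>"
proof -
  have "ln t \<le> ln (law.payoff ((1 - t) * g) x)"
    using law.shrunken_bet(2)[OF t x] t by (intro ln_mono) auto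
  moreover have "ln (law.payoff ((1 - t) * g) x) \<le> ln (1/\<mu>0)"
    using law.shrunken_bet(2)[OF t x] law.payoff_le[OF law.shrunken_bet(1)[OF t] x] t
    by (intro ln_mono) auto
  ultimately show ?thesis by linarith
qed

lemma regret_shrunken:
  assumes "sublinear_portfolio_regret M X \<mu>0 \<gamma>"
  obtains r :: "nat \<Rightarrow> real" where "r \<in> o(\<lambda>n. real n)"
    and "\<And>n \<omega> t. 1 \<le> n \<Longrightarrow> \<omega> \<in> space M \<Longrightarrow> 0 < t \<Longrightarrow> t < 1 \<Longrightarrow>
      0 < wealth X \<mu>0 \<gamma> n \<omega> \<and>
      (\<Sum>i=1..n. ln (law.payoff ((1 - t) * g) (X i \<omega>))) - r n \<le> ln (wealth X \<mu>0 \<gamma> n \<omega>)"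
proof -
  obtain r :: "nat \<Rightarrow> real" where r: "r \<in> o(\<lambda>n. real n)"
    and reg: "\<And>n \<omega> h. 1 \<le> n \<Longrightarrow> \<omega> \<in> space M \<Longrightarrow> h \<in> {0..1/\<mu>0} \<Longrightarrow>
      (\<And>i. i \<in> {1..n} \<Longrightarrow> 0 < 1 + h * (X i \<omega> - \<mu>0)) \<Longrightarrow>
      0 < wealth X \<mu>0 \<gamma> n \<omega> \<and>
      (\<Sum>i=1..n. ln (1 + h * (X i \<omega> - \<mu>0))) - r n \<le> ln (wealth X \<mu>0 \<gamma> n \<omega>)"
    using regret_bound[OF assms] by blast
  show ?thesis
  proof (rule that[OF r])
    fix n :: nat and \<omega> and t :: real
    assume n: "1 \<le> n" and \<omega>: "\<omega> \<in> space M" and t: "0 < t" "t < 1"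
    show "0 < wealth X \<mu>0 \<gamma> n \<omega> \<and>
      (\<Sum>i=1..n. ln (law.payoff ((1 - t) * g) (X i \<omega>))) - r n \<le> ln (wealth X \<mu>0 \<gamma> n \<omega>)"
    proof (rule reg[OF n \<omega> law.shrunken_bet(1)[OF t]])
      fix i assume "i \<in> {1..n}"
      then show "0 < law.payoff ((1 - t) * g) (X i \<omega>)"
        using law.shrunken_bet(2)[OF t X_unit[of i \<omega>]] \<omega> t by simp
    qed
  qed
qed

text \<open>Compare with the shrunken bets \<open>(1 - t) g\<close> and let \<open>t\<close> tend to 0. The same \<open>t\<close> also serves as
  tolerance in the strong law and for the regret, whence \<open>2 t\<close>.\<close>
lemma liminf_growth_ge:
  assumes "sublinear_portfolio_regret M X \<mu>0 \<gamma>"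
  shows "AE \<omega> in Q. ereal law.rate \<le> liminf (\<lambda>n. elog (wealth X \<mu>0 \<gamma> n \<omega>) / ereal (real n))"
proof -
  obtain r :: "nat \<Rightarrow> real" where r: "r \<in> o(\<lambda>n. real n)"
    and reg: "\<And>n \<omega> t. 1 \<le> n \<Longrightarrow> \<omega> \<in> space M \<Longrightarrow> 0 < t \<Longrightarrow> t < 1 \<Longrightarrow>
      0 < wealth X \<mu>0 \<gamma> n \<omega> \<and>
      (\<Sum>i=1..n. ln (law.payoff ((1 - t) * g) (X i \<omega>))) - r n \<le> ln (wealth X \<mu>0 \<gamma> n \<omega>)"
    using regret_shrunken[OF assms] by blast
  have step: "AE \<omega> in Q. ereal (law.rate + ln (1 - t) - 2 * t) \<le> liminf (\<lambda>n. elog (wealth X \<mu>0 \<gamma> n \<omega>) / ereal (real n))"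
    if t: "0 < t" "t < 1" for t
  proof -
    let ?\<phi> = "\<lambda>x. ln (law.payoff ((1 - t) * g) x)"
    have "AE \<omega> in Q. \<forall>\<^sub>F n in sequentially.
        \<bar>(\<Sum>i=1..n. ?\<phi> (X i \<omega>)) - real n * (\<integral>x. ?\<phi> x \<partial>distr Q borel (X 1))\<bar> < real n * t"
      by (rule strong_law_bounded[OF Q_iid _ ln_payoff_bounded[OF t] t(1)]) measurable
    then show ?thesis
      using AE_space
    proof eventually_elim
      case (elim \<omega>)
      have "\<forall>\<^sub>F n in sequentially. norm (r n) \<le> t * norm (real n)"
        using landau_o.smallD[OF r t(1)] .
      then have "\<forall>\<^sub>F n in sequentially.
          ereal (law.rate + ln (1 - t) - 2 * t) \<le> elog (wealth X \<mu>0 \<gamma> n \<omega>) / ereal (real n)"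
        using elim(1) eventually_ge_at_top[of "1::nat"]
      proof eventually_elim
        case (elim n)
        have W: "0 < wealth X \<mu>0 \<gamma> n \<omega>"
          "(\<Sum>i=1..n. ?\<phi> (X i \<omega>)) - r n \<le> ln (wealth X \<mu>0 \<gamma> n \<omega>)"
          using reg[OF elim(3) _ t, of \<omega>] \<open>\<omega> \<in> space Q\<close> by (auto simp: space_Q)
        have "real n * (law.rate + ln (1 - t)) \<le> real n * (\<integral>x. ?\<phi> x \<partial>distr Q borel (X 1))"
          using law.shrunken_bet(3)[OF t] by (intro mult_left_mono) auto
        moreover have "r n \<le> real n * t" using elim(1) by (simp add: mult.commute)
        ultimately have "real n * (law.rate + ln (1 - t)) - real n * t - real n * t \<le> ln (wealth X \<mu>0 \<gamma> n \<omega>)"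
          using elim(2) W(2) by linarith
        then have "(law.rate + ln (1 - t) - 2 * t) * real n \<le> ln (wealth X \<mu>0 \<gamma> n \<omega>)"
          by (simp add: algebra_simps)
        then have "law.rate + ln (1 - t) - 2 * t \<le> ln (wealth X \<mu>0 \<gamma> n \<omega>) / real n"
          using elim(3) by (subst pos_le_divide_eq) simp_all
        then show ?case using W(1) elim(3) by (simp add: elog_def)
      qed
      then show ?case by (rule Liminf_bounded)
    qed
  qed
  have "AE \<omega> in Q. \<forall>k::nat. ereal (law.rate + ln (1 - 1 / (real k + 2)) - 2 * (1 / (real k + 2)))
      \<le> liminf (\<lambda>n. elog (wealth X \<mu>0 \<gamma> n \<omega>) / ereal (real n))"
    unfolding AE_all_countable by (intro allI step) (simp_all add: field_simps)
  then show ?thesis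
  proof eventually_elim
    case (elim \<omega>)
    have t0: "(\<lambda>k. 1 / (real k + 2)) \<longlonglongrightarrow> 0"
      using LIMSEQ_ignore_initial_segment[OF lim_1_over_n, of 2] by (simp add: add.commute)
    have "(\<lambda>k. law.rate + ln (1 - 1 / (real k + 2)) - 2 * (1 / (real k + 2))) \<longlonglongrightarrow> law.rate + ln (1 - 0) - 2 * 0"
      by (intro tendsto_intros t0) simp
    then have "(\<lambda>k. ereal (law.rate + ln (1 - 1 / (real k + 2)) - 2 * (1 / (real k + 2)))) \<longlonglongrightarrow> ereal law.rate"
      by simp
    then show ?case by (rule LIMSEQ_le_const2) (use elim in blast)
  qed
qed

end

section \<open>Stopping times\<close>

context growth_optimal
begin

lemma stopping_events:
  assumes "stopping_time (nat_filtration M X) \<tau>"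
  shows "{\<omega> \<in> space M. enat n < \<tau> \<omega>} \<in> sets Q" "{\<omega> \<in> space M. \<tau> \<omega> = enat n} \<in> sets Q"
    "{\<omega> \<in> space M. \<tau> \<omega> = enat n} \<in> sets P"
  unfolding iid_lawsD(2)[OF Q_iid] iid_lawsD(2)[OF P_iid]
  by (rule subsetD[OF sets_F_subset stopping_time_sets(2)[OF assms]])
    (rule subsetD[OF sets_F_subset stopping_time_sets(3)[OF assms]])+

lemma mean_time_eq_suminf:
  assumes "stopping_time (nat_filtration M X) \<tau>"
  shows "(\<integral>\<^sup>+\<omega>. ennreal_of_enat (\<tau> \<omega>) \<partial>Q) = (\<Sum>n. ennreal (measure Q {\<omega> \<in> space M. enat n < \<tau> \<omega>}))"
proof -
  note [measurable] = stopping_events[OF assms]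
  have "(\<integral>\<^sup>+\<omega>. ennreal_of_enat (\<tau> \<omega>) \<partial>Q) = (\<integral>\<^sup>+\<omega>. (\<Sum>n. indicator {\<omega> \<in> space M. enat n < \<tau> \<omega>} \<omega>) \<partial>Q)"
    unfolding ennreal_of_enat_eq_suminf
    by (intro nn_integral_cong arg_cong[where f=suminf] ext) (simp add: indicator_def space_Q)
  also have "\<dots> = (\<Sum>n. \<integral>\<^sup>+\<omega>. indicator {\<omega> \<in> space M. enat n < \<tau> \<omega>} \<omega> \<partial>Q)"
    by (rule nn_integral_suminf) measurable
  finally show ?thesis
    unfolding nn_integral_indicator[OF stopping_events(1)[OF assms]] Q.emeasure_eq_measure .
qed

text \<open>On the event that \<open>\<tau> = n\<close>, the weight \<open>1 / V n\<close> turns \<open>Q\<close> back into \<open>P\<close>. The series has at most one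
  nonzero term; it stands for \<open>1 / V \<tau>\<close>.\<close>
lemma nn_integral_inverse_stopped_le:
  assumes \<tau>: "stopping_time (nat_filtration M X) \<tau>"
  shows "(\<integral>\<^sup>+\<omega>. (\<Sum>n. ennreal (indicator {\<omega> \<in> space M. \<tau> \<omega> = enat n} \<omega> / V n \<omega>)) \<partial>Q)
    \<le> emeasure P {\<omega> \<in> space M. \<tau> \<omega> < \<infinity>}"
proof -
  define E where "E n = {\<omega> \<in> space M. \<tau> \<omega> = enat n}" for n
  have EF[measurable]: "E n \<in> sets (F n)" for n unfolding E_def by (rule stopping_time_sets(3)[OF \<tau>])
  have [measurable]: "E n \<in> sets Q" "E n \<in> sets P" for n unfolding E_def using stopping_events[OF \<tau>] by auto
  have [measurable]: "V n \<in> borel_measurable Q" for n by (rule F_measurable_P[OF Q_iid V_F])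
  have "(\<integral>\<^sup>+\<omega>. (\<Sum>n. ennreal (indicator (E n) \<omega> / V n \<omega>)) \<partial>Q) = (\<Sum>n. \<integral>\<^sup>+\<omega>. ennreal (indicator (E n) \<omega> / V n \<omega>) \<partial>Q)"
    by (rule nn_integral_suminf) measurable
  also have "\<dots> \<le> (\<Sum>n. \<integral>\<^sup>+\<omega>. ennreal (indicator (E n) \<omega>) \<partial>P)"
    by (intro suminf_le nn_integral_ratio_le) auto
  also have "\<dots> = (\<Sum>n. emeasure P (E n))"
    by (simp add: ennreal_indicator)
  also have "\<dots> = emeasure P (\<Union>n. E n)"
  proof (rule suminf_emeasure)
    show "range E \<subseteq> sets P" by auto
    show "disjoint_family E" by (auto simp: disjoint_family_on_def E_def)
  qed
  also have "(\<Union>n. E n) = {\<omega> \<in> space M. \<tau> \<omega> < \<infinity>}"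
  proof (intro set_eqI)
    fix \<omega> show "\<omega> \<in> (\<Union>n. E n) \<longleftrightarrow> \<omega> \<in> {\<omega> \<in> space M. \<tau> \<omega> < \<infinity>}"
      by (cases "\<tau> \<omega>") (auto simp: E_def)
  qed
  finally show ?thesis unfolding E_def .
qed

text \<open>Wald's identity for \<open>ln (V \<tau>)\<close>. The \<open>n\<close>-th increment is counted on the event that \<open>\<tau> > n\<close>, which
  is decided at time \<open>n\<close> and so independent of it; absolute summability follows from
  \<open>E[\<tau>] < \<infinity>\<close> and the integrability of a single log return. The integrand \<open>L\<close> is obtained only up to a
  null set, which spares defining \<open>V\<close> at an infinite time.\<close>
lemma wald:
  assumes \<tau>: "stopping_time (nat_filtration M X) \<tau>"
    and fin: "(\<integral>\<^sup>+\<omega>. ennreal_of_enat (\<tau> \<omega>) \<partial>Q) = ennreal T" and T: "0 \<le> T"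
  obtains L where "integrable Q L" "(\<integral>\<omega>. L \<omega> \<partial>Q) = T * law.rate"
    "AE \<omega> in Q. \<exists>k. \<tau> \<omega> = enat k \<and> L \<omega> = ln (V k \<omega>)"
proof -
  define S where "S n = {\<omega> \<in> space M. enat n < \<tau> \<omega>}" for n
  define p where "p n = measure Q (S n)" for n
  define \<phi> where "\<phi> x = ln (law.payoff g x)" for x
  define y where "y n \<omega> = indicator (S n) \<omega> * \<phi> (X (Suc n) \<omega>)" for n \<omega>
  have [measurable]: "\<phi> \<in> borel_measurable borel" unfolding \<phi>_def by measurable
  have SF[measurable]: "S n \<in> sets (F n)" for n unfolding S_def by (rule stopping_time_sets(2)[OF \<tau>])
  have [measurable]: "S n \<in> sets Q" for n unfolding S_def by (rule stopping_events[OF \<tau>])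
  have sum: "(\<Sum>n. ennreal (p n)) = ennreal T"
    using fin unfolding mean_time_eq_suminf[OF \<tau>] p_def S_def .
  have p0: "0 \<le> p n" for n by (simp add: p_def)
  have p_summable: "summable p"
    by (rule summable_suminf_not_top) (use p0 sum in auto)
  have p_sum: "suminf p = T"
    using sum suminf_ennreal2[OF p0 p_summable] suminf_nonneg[OF p_summable p0] T by simp
  have int\<phi>: "integrable (distr Q borel (X 1)) \<phi>" "(\<integral>x. \<phi> x \<partial>distr Q borel (X 1)) = law.rate"
    unfolding \<phi>_def by (rule law.integrable_ln_payoff, rule law.rate_def[symmetric])
  have ind: "(\<lambda>\<omega>. indicator (S n) \<omega> :: real) \<in> borel_measurable (F n)"
    "integrable Q (\<lambda>\<omega>. indicator (S n) \<omega> :: real)" "(\<integral>\<omega>. indicator (S n) \<omega> \<partial>Q) = p n" for n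
    by (simp_all add: p_def Q.emeasure_eq_measure)
  have y_int: "integrable Q (y n)" and y_mean: "(\<integral>\<omega>. y n \<omega> \<partial>Q) = p n * law.rate" for n
    unfolding y_def using expectation_next[OF Q_iid ind(1) _ ind(2) int\<phi>(1), of n] ind(3) int\<phi>(2) by auto
  have abs_mean: "(\<integral>\<omega>. norm (y n \<omega>) \<partial>Q) = p n * (\<integral>x. \<bar>\<phi> x\<bar> \<partial>distr Q borel (X 1))" for n
  proof -
    have "(\<integral>\<omega>. norm (y n \<omega>) \<partial>Q) = (\<integral>\<omega>. indicator (S n) \<omega> * \<bar>\<phi> (X (Suc n) \<omega>)\<bar> \<partial>Q)"
      by (simp add: y_def abs_mult)
    also have "\<dots> = p n * (\<integral>x. \<bar>\<phi> x\<bar> \<partial>distr Q borel (X 1))"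
      using expectation_next(2)[OF Q_iid ind(1) _ ind(2) integrable_abs[OF int\<phi>(1)], of n] ind(3) by simp
    finally show ?thesis .
  qed
  have "AE \<omega> in Q. ennreal_of_enat (\<tau> \<omega>) \<noteq> \<infinity>"
  proof (rule nn_integral_noteq_infinite)
    show "(\<lambda>\<omega>. ennreal_of_enat (\<tau> \<omega>)) \<in> borel_measurable Q"
    proof -
      have "(\<lambda>\<omega>. \<Sum>n. indicator (S n) \<omega> :: ennreal) \<in> borel_measurable Q" by measurable
      then show ?thesis
        by (rule measurable_cong[THEN iffD1, rotated])
          (simp add: ennreal_of_enat_eq_suminf indicator_def of_bool_def S_def space_Q)
    qed
  qed (simp add: fin)
  then have path: "AE \<omega> in Q. \<exists>k. \<tau> \<omega> = enat k \<and> (\<forall>n\<ge>k. y n \<omega> = 0) \<and> (\<Sum>n<k. y n \<omega>) = ln (V k \<omega>)"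
    using factors_pos AE_space
  proof eventually_elim
    case (elim \<omega>)
    obtain k where k: "\<tau> \<omega> = enat k" using elim(1) by (cases "\<tau> \<omega>") auto
    have "(\<Sum>n<k. y n \<omega>) = (\<Sum>n<k. ln (law.payoff g (X (Suc n) \<omega>)))"
      using elim(3) by (intro sum.cong refl) (simp add: y_def S_def k \<phi>_def space_Q)
    also have "\<dots> = (\<Sum>i=1..k. ln (law.payoff g (X i \<omega>)))"
      by (rule sum.reindex_bij_witness[of _ "\<lambda>i. i - 1" Suc]) auto
    also have "\<dots> = ln (V k \<omega>)"
      unfolding wealth_def
    proof (rule ln_prod[OF finite_atLeastAtMost, symmetric])
      show "law.payoff g (X i \<omega>) \<noteq> 0" if "i \<in> {1..k}" for i using elim(2) that by (simp add: less_imp_neq[THEN not_sym])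
    qed
    finally show ?case using k by (intro exI[of _ k]) (simp add: y_def S_def)
  qed
  have summable_path: "AE \<omega> in Q. summable (\<lambda>n. norm (y n \<omega>))"
    using path
  proof eventually_elim
    case (elim \<omega>)
    then obtain k where "\<forall>n\<ge>k. y n \<omega> = 0" by blast
    then show ?case by (intro summable_finite[of "{..<k}"]) auto
  qed
  have summable_mean: "summable (\<lambda>n. \<integral>\<omega>. norm (y n \<omega>) \<partial>Q)"
    unfolding abs_mean by (rule summable_mult2[OF p_summable])
  show ?thesis
  proof (rule that)
    show "integrable Q (\<lambda>\<omega>. \<Sum>n. y n \<omega>)"
      by (rule integrable_suminf[OF y_int summable_path summable_mean])
    have "(\<integral>\<omega>. (\<Sum>n. y n \<omega>) \<partial>Q) = (\<Sum>n. \<integral>\<omega>. y n \<omega> \<partial>Q)"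
      by (rule integral_suminf[OF y_int summable_path summable_mean])
    also have "\<dots> = T * law.rate"
      unfolding y_mean using suminf_mult2[OF p_summable, of law.rate] by (simp add: p_sum)
    finally show "(\<integral>\<omega>. (\<Sum>n. y n \<omega>) \<partial>Q) = T * law.rate" .
    show "AE \<omega> in Q. \<exists>k. \<tau> \<omega> = enat k \<and> (\<Sum>n. y n \<omega>) = ln (V k \<omega>)"
      using path
    proof eventually_elim
      case (elim \<omega>)
      then obtain k where k: "\<tau> \<omega> = enat k" "\<forall>n\<ge>k. y n \<omega> = 0" "(\<Sum>n<k. y n \<omega>) = ln (V k \<omega>)" by blast
      then have "(\<Sum>n. y n \<omega>) = (\<Sum>n<k. y n \<omega>)" by (intro suminf_finite) auto
      then show ?case using k by auto
    qed
  qed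
qed

text \<open>Jensen's inequality enters through the tangent \<open>ln V \<ge> ln (1/\<alpha>) + 1 - 1 / (\<alpha> V)\<close> at \<open>V = 1/\<alpha>\<close>,
  which brings in only the expectation of \<open>1 / V \<tau>\<close>.\<close>
lemma mean_stopping_time_ge:
  assumes \<tau>: "stopping_time (nat_filtration M X) \<tau>" and \<alpha>: "0 < \<alpha>"
    and err: "emeasure P {\<omega> \<in> space M. \<tau> \<omega> < \<infinity>} \<le> ennreal \<alpha>"
  shows "ennreal (ln (1/\<alpha>) / law.rate) \<le> (\<integral>\<^sup>+\<omega>. ennreal_of_enat (\<tau> \<omega>) \<partial>Q)"
proof (cases "\<integral>\<^sup>+\<omega>. ennreal_of_enat (\<tau> \<omega>) \<partial>Q" rule: ennreal_cases)
  case (real T)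
  obtain L where L: "integrable Q L" "(\<integral>\<omega>. L \<omega> \<partial>Q) = T * law.rate"
    "AE \<omega> in Q. \<exists>k. \<tau> \<omega> = enat k \<and> L \<omega> = ln (V k \<omega>)"
    using wald[OF \<tau> real(2,1)] by blast
  define R where "R \<omega> = (\<Sum>n. ennreal (indicator {\<omega> \<in> space M. \<tau> \<omega> = enat n} \<omega> / V n \<omega>))" for \<omega>
  note [measurable] = stopping_events[OF \<tau>] F_measurable_P[OF Q_iid V_F]
  have [measurable]: "R \<in> borel_measurable Q" unfolding R_def by measurable
  have RI: "(\<integral>\<^sup>+\<omega>. R \<omega> \<partial>Q) \<le> ennreal \<alpha>"
    using order_trans[OF nn_integral_inverse_stopped_le[OF \<tau>] err] unfolding R_def .
  have R_eq: "R \<omega> = ennreal (1 / V k \<omega>)" if "\<omega> \<in> space M" "\<tau> \<omega> = enat k" for \<omega> k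
  proof -
    have "R \<omega> = (\<Sum>n\<in>{k}. ennreal (indicator {\<omega> \<in> space M. \<tau> \<omega> = enat n} \<omega> / V n \<omega>))"
      unfolding R_def by (rule suminf_finite) (use that in auto)
    then show ?thesis using that by simp
  qed
  have le_nn: "(\<integral>\<^sup>+\<omega>. ennreal (enn2real (R \<omega>)) \<partial>Q) \<le> ennreal \<alpha>"
    by (rule order_trans[OF nn_integral_mono RI]) (simp add: ennreal_enn2real_if)
  have intR: "integrable Q (\<lambda>\<omega>. enn2real (R \<omega>))"
    by (rule integrableI_nonneg) (use le_nn in \<open>auto intro: le_less_trans\<close>)
  have "ennreal (\<integral>\<omega>. enn2real (R \<omega>) \<partial>Q) \<le> ennreal \<alpha>"
    using le_nn nn_integral_eq_integral[OF intR] by simp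
  then have ER: "(\<integral>\<omega>. enn2real (R \<omega>) \<partial>Q) \<le> \<alpha>" using \<alpha> by simp
  have "ln (1/\<alpha>) + 1 - \<alpha> / \<alpha> \<le> ln (1/\<alpha>) + 1 - (\<integral>\<omega>. enn2real (R \<omega>) \<partial>Q) / \<alpha>"
    using ER \<alpha> by (intro diff_left_mono divide_right_mono) auto
  also have "\<dots> = (\<integral>\<omega>. ln (1/\<alpha>) + 1 - enn2real (R \<omega>) / \<alpha> \<partial>Q)"
    using intR by (simp add: Q.prob_space)
  also have "\<dots> \<le> (\<integral>\<omega>. L \<omega> \<partial>Q)"
  proof (rule integral_mono_AE)
    show "AE \<omega> in Q. ln (1/\<alpha>) + 1 - enn2real (R \<omega>) / \<alpha> \<le> L \<omega>"
      using L(3) V_pos AE_space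
    proof eventually_elim
      case (elim \<omega>)
      then obtain k where k: "\<tau> \<omega> = enat k" "L \<omega> = ln (V k \<omega>)" by blast
      have V: "0 < V k \<omega>" using elim(2) by blast
      have R: "enn2real (R \<omega>) = 1 / V k \<omega>"
        using R_eq[OF _ k(1)] elim(3) V by (simp add: space_Q)
      \<comment> \<open>the tangent inequality at \<open>V = 1/\<alpha>\<close>\<close>
      have "ln (1 / (\<alpha> * V k \<omega>)) \<le> 1 / (\<alpha> * V k \<omega>) - 1"
        using V \<alpha> by (intro ln_le_minus_one) simp
      moreover have "ln (1 / (\<alpha> * V k \<omega>)) = ln (1/\<alpha>) - ln (V k \<omega>)"
        using V \<alpha> by (simp add: ln_div ln_mult)
      ultimately show ?case unfolding R k(2) by (simp add: mult.commute)
    qed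
  qed (use intR L in auto)
  finally have "ln (1/\<alpha>) \<le> T * law.rate" using \<alpha> L(2) by simp
  then have "ln (1/\<alpha>) / law.rate \<le> T" using law.rate_pos by (simp add: pos_divide_le_eq)
  then show ?thesis unfolding real(2) by (rule ennreal_leI)
next
  case top
  then show ?thesis by simp
qed

text \<open>A shrunken bet has growth rate \<open>m \<ge> b + 2 \<delta>\<close> with bounded log returns. If \<open>n\<close> exceeds both
  \<open>ln (1/\<alpha>) / b\<close> and the time from which the regret stays below \<open>n \<delta>\<close>, not having reached \<open>1/\<alpha>\<close>
  by time \<open>n\<close> forces the sum of log returns to fall \<open>n \<delta>\<close> short of its mean. Such events have geometrically
  decaying probability, uniformly in \<open>\<alpha>\<close>, and contribute a bounded amount to the tail sum for the mean.\<close>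
lemma mean_hitting_time_le:
  assumes \<gamma>: "strategy \<gamma>" and regret: "sublinear_portfolio_regret M X \<mu>0 \<gamma>"
    and b: "0 < b" "b < law.rate"
  obtains C where "0 \<le> C"
    "\<And>\<alpha>. 0 < \<alpha> \<Longrightarrow> \<alpha> < 1 \<Longrightarrow> (\<integral>\<^sup>+\<omega>. ennreal_of_enat (hitting_time X \<mu>0 \<gamma> \<alpha> \<omega>) \<partial>Q) \<le> ennreal (ln (1/\<alpha>) / b + C)"
proof -
  \<comment> \<open>\<open>t\<close> is such that shrinking costs half of the gap between \<open>b\<close> and the rate; the other half is
    \<open>2 * \<delta>\<close>, shared by the regret and the deviation from the mean.\<close>
  define t where "t = 1 - exp ((b - law.rate) / 2)"
  define \<delta> where "\<delta> = (law.rate - b) / 4"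
  have t: "0 < t" "t < 1" using b by (auto simp: t_def)
  have \<delta>: "0 < \<delta>" using b by (simp add: \<delta>_def)
  define \<phi> where "\<phi> x = ln (law.payoff ((1 - t) * g) x)" for x
  define m where "m = (\<integral>x. \<phi> x \<partial>distr Q borel (X 1))"
  have \<phi>_meas [measurable]: "\<phi> \<in> borel_measurable borel" unfolding \<phi>_def by measurable
  have m: "b + 2 * \<delta> \<le> m"
    using law.shrunken_bet(3)[OF t] unfolding m_def \<phi>_def by (simp add: t_def \<delta>_def field_simps)
  obtain r :: "nat \<Rightarrow> real" where r: "r \<in> o(\<lambda>n. real n)"
    and reg: "\<And>n \<omega> t. 1 \<le> n \<Longrightarrow> \<omega> \<in> space M \<Longrightarrow> 0 < t \<Longrightarrow> t < 1 \<Longrightarrow>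
      0 < wealth X \<mu>0 \<gamma> n \<omega> \<and>
      (\<Sum>i=1..n. ln (law.payoff ((1 - t) * g) (X i \<omega>))) - r n \<le> ln (wealth X \<mu>0 \<gamma> n \<omega>)"
    using regret_shrunken[OF regret] by blast
  have "\<forall>\<^sub>F n in sequentially. norm (r n) \<le> \<delta> * norm (real n)"
    using landau_o.smallD[OF r \<delta>] .
  then obtain N where N: "\<And>n. N \<le> n \<Longrightarrow> \<bar>r n\<bar> \<le> \<delta> * real n"
    by (auto simp: eventually_sequentially)
  have \<phi>b: "\<bar>\<phi> x\<bar> \<le> \<bar>ln t\<bar> + \<bar>ln (1/\<mu>0)\<bar>" if "x \<in> {0..1}" for x
    unfolding \<phi>_def by (rule ln_payoff_bounded[OF t that])
  obtain \<rho> where \<rho>: "0 < \<rho>" "\<rho> < 1"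
    and tail: "\<And>n. measure Q {\<omega> \<in> space Q. real n * \<delta> \<le> \<bar>(\<Sum>i=1..n. \<phi> (X i \<omega>)) - real n * m\<bar>} \<le> 2 * \<rho> ^ n"
    using hoeffding_iid[OF Q_iid \<phi>_meas \<phi>b \<delta>, folded m_def] by blast
  define C where "C = real N + 2 + 2 / (1 - \<rho>)"
  show ?thesis
  proof (rule that)
    show "0 \<le> C" using \<rho> by (simp add: C_def)
    fix \<alpha> :: real assume \<alpha>: "0 < \<alpha>" "\<alpha> < 1"
    define A where "A = ln (1/\<alpha>) / b"
    have A0: "0 \<le> A" using \<alpha> b by (simp add: A_def)
    define K where "K = nat \<lceil>A\<rceil> + N + 1"
    let ?\<tau> = "hitting_time X \<mu>0 \<gamma> \<alpha>"
    let ?E = "\<lambda>n. {\<omega> \<in> space M. enat n < ?\<tau> \<omega>}"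
    have st: "stopping_time (nat_filtration M X) ?\<tau>" by (rule hitting_time_stopping[OF \<gamma>])
    have late: "measure Q (?E n) \<le> 2 * \<rho> ^ n" if "K \<le> n" for n
    proof -
      have n: "1 \<le> n" "N \<le> n" "A \<le> real n" using that by (auto simp: K_def) linarith
      have "?E n \<subseteq> {\<omega> \<in> space Q. real n * \<delta> \<le> \<bar>(\<Sum>i=1..n. \<phi> (X i \<omega>)) - real n * m\<bar>}"
      proof safe
        fix \<omega> assume \<omega>: "\<omega> \<in> space M" and "enat n < ?\<tau> \<omega>"
        then have "\<not> ?\<tau> \<omega> \<le> enat n" by simp
        then have "\<not> 1/\<alpha> \<le> wealth X \<mu>0 \<gamma> n \<omega>" unfolding hitting_time_le_iff using n(1) by auto
        then have "wealth X \<mu>0 \<gamma> n \<omega> < 1/\<alpha>" by (rule not_le_imp_less)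
        moreover have W: "0 < wealth X \<mu>0 \<gamma> n \<omega>"
          "(\<Sum>i=1..n. \<phi> (X i \<omega>)) - r n \<le> ln (wealth X \<mu>0 \<gamma> n \<omega>)"
          using reg[OF n(1) \<omega> t] by (auto simp: \<phi>_def)
        ultimately have "ln (wealth X \<mu>0 \<gamma> n \<omega>) < ln (1/\<alpha>)" using \<alpha> by (subst ln_less_cancel_iff) auto
        moreover have "ln (1/\<alpha>) \<le> real n * b" using n(3) b by (simp add: A_def pos_divide_le_eq)
        moreover have "r n \<le> real n * \<delta>" using N[OF n(2)] by (simp add: mult.commute)
        moreover have "real n * (b + 2 * \<delta>) \<le> real n * m" using m by (intro mult_left_mono) auto
        ultimately have "(\<Sum>i=1..n. \<phi> (X i \<omega>)) - real n * m \<le> - (real n * \<delta>)"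
          using W(2) unfolding distrib_left by linarith
        then show "real n * \<delta> \<le> \<bar>(\<Sum>i=1..n. \<phi> (X i \<omega>)) - real n * m\<bar>" by linarith
      qed (simp add: space_Q)
      then have "measure Q (?E n) \<le> measure Q {\<omega> \<in> space Q. real n * \<delta> \<le> \<bar>(\<Sum>i=1..n. \<phi> (X i \<omega>)) - real n * m\<bar>}"
      proof (rule Q.finite_measure_mono)
        have "(\<lambda>\<omega>. \<Sum>i=1..n. \<phi> (X i \<omega>)) \<in> borel_measurable Q"
          using iid_lawsD(6)[OF Q_iid] by (intro borel_measurable_sum measurable_compose[OF _ \<phi>_meas]) auto
        note [measurable] = this
        show "{\<omega> \<in> space Q. real n * \<delta> \<le> \<bar>(\<Sum>i=1..n. \<phi> (X i \<omega>)) - real n * m\<bar>} \<in> sets Q" by measurable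
      qed
      also have "\<dots> \<le> 2 * \<rho> ^ n" by (rule tail)
      finally show ?thesis .
    qed
    have p_le: "measure Q (?E n) \<le> (if n < K then 1 else 0) + 2 * \<rho> ^ n" for n
    proof (cases "n < K")
      case True
      then show ?thesis using Q.prob_le_1[of "?E n"] \<rho> by (simp add: add_increasing2)
    qed (use late[of n] in simp)
    have s1: "(\<lambda>n. if n < K then 1 else 0 :: real) sums real K"
      using sums_If_finite_set[of "{..<K}" "\<lambda>_. 1 :: real"] by simp
    have s2: "(\<lambda>n. 2 * \<rho> ^ n) sums (2 * (1 / (1 - \<rho>)))"
      using \<rho> by (intro sums_mult geometric_sums) simp
    have s: "(\<lambda>n. (if n < K then 1 else 0) + 2 * \<rho> ^ n) sums (real K + 2 * (1 / (1 - \<rho>)))"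
      by (rule sums_add[OF s1 s2])
    have "(\<integral>\<^sup>+\<omega>. ennreal_of_enat (?\<tau> \<omega>) \<partial>Q) = (\<Sum>n. ennreal (measure Q (?E n)))"
      by (rule mean_time_eq_suminf[OF st])
    also have "\<dots> \<le> (\<Sum>n. ennreal ((if n < K then 1 else 0) + 2 * \<rho> ^ n))"
      by (intro suminf_le ennreal_leI p_le) auto
    also have "\<dots> = ennreal (real K + 2 * (1 / (1 - \<rho>)))"
      using \<rho> sums_unique[OF s] by (subst suminf_ennreal2) (auto intro: sums_summable[OF s])
    also have "\<dots> \<le> ennreal (A + C)"
      using A0 by (intro ennreal_leI) (simp add: K_def C_def, linarith)
    finally show "(\<integral>\<^sup>+\<omega>. ennreal_of_enat (?\<tau> \<omega>) \<partial>Q) \<le> ennreal (ln (1/\<alpha>) / b + C)"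
      unfolding A_def .
  qed
qed

lemma scaled_mean_time_ge:
  assumes "stopping_time (nat_filtration M X) \<tau>" and \<alpha>: "0 < \<alpha>" "\<alpha> < 1"
    and "emeasure P {\<omega> \<in> space M. \<tau> \<omega> < \<infinity>} \<le> ennreal \<alpha>"
  shows "ereal (1 / law.rate) \<le> scaled_mean_time Q \<alpha> \<tau>"
proof -
  have l: "0 < ln (1/\<alpha>)" using \<alpha> by simp
  have "ereal (1 / law.rate) = ereal (ln (1/\<alpha>) / law.rate) / ereal (ln (1/\<alpha>))"
    using l by simp
  also have "ereal (ln (1/\<alpha>) / law.rate) = enn2ereal (ennreal (ln (1/\<alpha>) / law.rate))"
    using l law.rate_pos by (simp add: enn2ereal_ennreal)
  also have "\<dots> / ereal (ln (1/\<alpha>)) \<le> scaled_mean_time Q \<alpha> \<tau>"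
    unfolding scaled_mean_time_def using mean_stopping_time_ge[OF assms(1) \<alpha>(1) assms(4)] l
    by (intro ereal_divide_right_mono) (simp_all add: less_eq_ennreal.rep_eq)
  finally show ?thesis .
qed

text \<open>The lower bound is that for arbitrary stopping times with error probability \<open>\<alpha>\<close>, by Ville's
  inequality. For the upper bound, let \<open>b = 1/w\<close> increase to the optimal rate; the constant \<open>C\<close>
  vanishes on the scale of \<open>ln (1/\<alpha>)\<close>.\<close>
lemma scaled_mean_hitting_time_tendsto:
  assumes \<gamma>: "strategy \<gamma>" and regret: "sublinear_portfolio_regret M X \<mu>0 \<gamma>"
  shows "((\<lambda>\<alpha>. scaled_mean_time Q \<alpha> (hitting_time X \<mu>0 \<gamma> \<alpha>)) \<longlongrightarrow> ereal (1 / law.rate)) (at_right 0)"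
proof (rule order_tendstoI)
  fix l assume l: "l < ereal (1 / law.rate)"
  have "\<forall>\<^sub>F \<alpha> in at_right 0. \<alpha> \<in> {0<..<1::real}" by (rule eventually_at_right_real) simp
  then show "\<forall>\<^sub>F \<alpha> in at_right 0. l < scaled_mean_time Q \<alpha> (hitting_time X \<mu>0 \<gamma> \<alpha>)"
  proof eventually_elim
    case (elim \<alpha>)
    have "ereal (1 / law.rate) \<le> scaled_mean_time Q \<alpha> (hitting_time X \<mu>0 \<gamma> \<alpha>)"
      using elim by (intro scaled_mean_time_ge hitting_time_stopping \<gamma> ville P_null) auto
    then show ?case using l by simp
  qed
next
  fix u assume "ereal (1 / law.rate) < u"
  then obtain v where v: "ereal (1 / law.rate) < ereal v" "ereal v < u"
    using ereal_dense2 by blast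
  define w where "w = (1 / law.rate + v) / 2"
  have w: "1 / law.rate < w" "w < v" "0 < w" using v(1) law.rate_pos by (auto simp: w_def add_pos_pos field_simps)
  have b: "0 < 1/w" "1/w < law.rate" using w law.rate_pos by (auto simp: field_simps)
  obtain C where C: "0 \<le> C"
    "\<And>\<alpha>. 0 < \<alpha> \<Longrightarrow> \<alpha> < 1 \<Longrightarrow> (\<integral>\<^sup>+\<omega>. ennreal_of_enat (hitting_time X \<mu>0 \<gamma> \<alpha> \<omega>) \<partial>Q) \<le> ennreal (ln (1/\<alpha>) / (1/w) + C)"
    using mean_hitting_time_le[OF \<gamma> regret b] by blast
  define a where "a = exp (- ((C + 1) / (v - w)))"
  have a: "0 < a" by (simp add: a_def)
  have "\<forall>\<^sub>F \<alpha> in at_right 0. \<alpha> \<in> {0<..<min 1 a}" by (rule eventually_at_right_real) (use a in simp)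
  then show "\<forall>\<^sub>F \<alpha> in at_right 0. scaled_mean_time Q \<alpha> (hitting_time X \<mu>0 \<gamma> \<alpha>) < u"
  proof eventually_elim
    case (elim \<alpha>)
    then have \<alpha>: "0 < \<alpha>" "\<alpha> < 1" "\<alpha> < a" by auto
    have l: "0 < ln (1/\<alpha>)" using \<alpha> by simp
    have "ln \<alpha> < ln a" using \<alpha> a by simp
    moreover have "ln a = - ((C + 1) / (v - w))" unfolding a_def by (rule ln_exp)
    moreover have "ln (1/\<alpha>) = - ln \<alpha>" using \<alpha>(1) by (simp add: ln_div)
    ultimately have "(C + 1) / (v - w) < ln (1/\<alpha>)" by linarith
    then have "C < (v - w) * ln (1/\<alpha>)" using w(2) by (simp add: pos_divide_less_eq mult.commute)
    then have lt: "ln (1/\<alpha>) * w + C < v * ln (1/\<alpha>)" by (simp add: algebra_simps)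
    have nn: "0 \<le> ln (1/\<alpha>) * w + C" using l w C(1) by (intro add_nonneg_nonneg mult_nonneg_nonneg) auto
    have "enn2ereal (\<integral>\<^sup>+\<omega>. ennreal_of_enat (hitting_time X \<mu>0 \<gamma> \<alpha> \<omega>) \<partial>Q) \<le> enn2ereal (ennreal (ln (1/\<alpha>) * w + C))"
      using C(2)[OF \<alpha>(1,2)] by (simp add: less_eq_ennreal.rep_eq)
    then have "scaled_mean_time Q \<alpha> (hitting_time X \<mu>0 \<gamma> \<alpha>) \<le> enn2ereal (ennreal (ln (1/\<alpha>) * w + C)) / ereal (ln (1/\<alpha>))"
      unfolding scaled_mean_time_def using l by (intro ereal_divide_right_mono) auto
    also have "\<dots> = ereal ((ln (1/\<alpha>) * w + C) / ln (1/\<alpha>))"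
      using nn l by (simp add: enn2ereal_ennreal)
    also have "\<dots> < ereal v" using lt l by (simp add: pos_divide_less_eq)
    also have "\<dots> < u" by (rule v(2))
    finally show ?case .
  qed
qed

end

section \<open>The optimality theorem\<close>

lemma log_growth_eq_law:
  assumes [measurable]: "X 1 \<in> borel_measurable Q"
  shows "log_growth Q X \<mu>0 h = eexpectation (distr Q borel (X 1)) (\<lambda>x. elog (1 + h * (x - \<mu>0)))"
proof -
  have [measurable]: "elog \<in> borel_measurable borel" unfolding elog_def[abs_def] by measurable
  have "(\<integral>\<^sup>+x. e2ennreal (elog (1 + h * (x - \<mu>0))) \<partial>distr Q borel (X 1))
      = (\<integral>\<^sup>+\<omega>. e2ennreal (elog (1 + h * (X 1 \<omega> - \<mu>0))) \<partial>Q)"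
    by (rule nn_integral_distr[OF assms]) measurable
  moreover have "(\<integral>\<^sup>+x. e2ennreal (- elog (1 + h * (x - \<mu>0))) \<partial>distr Q borel (X 1))
      = (\<integral>\<^sup>+\<omega>. e2ennreal (- elog (1 + h * (X 1 \<omega> - \<mu>0))) \<partial>Q)"
    by (rule nn_integral_distr[OF assms]) measurable
  ultimately show ?thesis unfolding log_growth_def eexpectation_def by (simp only:)
qed

theorem corollary4p1:
  fixes M :: "'a measure" and X \<gamma> :: "nat \<Rightarrow> 'a \<Rightarrow> real" and \<mu>0 :: real
  assumes "0 < \<mu>0" and "\<mu>0 \<le> 1"
    and "bounded_observations M X"
    and "predictable_process M X \<gamma>"
    and "\<forall>n\<ge>1. \<forall>\<omega>\<in>space M. \<gamma> n \<omega> \<in> {0..1/\<mu>0}"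
    and "sublinear_portfolio_regret M X \<mu>0 \<gamma>"
  shows "\<forall>Q\<in>alt_class M X \<mu>0.
    (\<exists>\<gamma>\<^sub>Q. is_arg_max (log_growth Q X \<mu>0) (\<lambda>g. g \<in> {0..1/\<mu>0}) \<gamma>\<^sub>Q) \<and>
    (AE \<omega> in Q. (\<lambda>n. elog (wealth X \<mu>0 \<gamma> n \<omega>) / ereal (real n))
        \<longlonglongrightarrow> (SUP g\<in>{0..1/\<mu>0}. log_growth Q X \<mu>0 g)) \<and>
    (\<forall>W'. e_process M X \<mu>0 W' \<longrightarrow>
      (AE \<omega> in Q. limsup (\<lambda>n. elog (W' n \<omega>) / ereal (real n))
        \<le> (SUP g\<in>{0..1/\<mu>0}. log_growth Q X \<mu>0 g))) \<and>
    (\<forall>\<gamma>\<^sub>Q. is_arg_max (log_growth Q X \<mu>0) (\<lambda>g. g \<in> {0..1/\<mu>0}) \<gamma>\<^sub>Q \<longrightarrow>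
      ((\<lambda>\<alpha>. scaled_mean_time Q \<alpha> (hitting_time X \<mu>0 \<gamma> \<alpha>))
        \<longlongrightarrow> 1 / log_growth Q X \<mu>0 \<gamma>\<^sub>Q) (at_right 0) \<and>
      (\<forall>\<alpha>\<in>{0<..<1}. \<forall>\<tau>'. stopping_time (nat_filtration M X) \<tau>' \<and>
          (SUP P\<in>null_class M X \<mu>0. emeasure P {\<omega>\<in>space M. \<tau>' \<omega> < \<infinity>}) \<le> ennreal \<alpha> \<longrightarrow>
          scaled_mean_time Q \<alpha> \<tau>' \<ge> 1 / log_growth Q X \<mu>0 \<gamma>\<^sub>Q))"
proof
  fix Q assume Q: "Q \<in> alt_class M X \<mu>0"
  interpret betting M X \<mu>0
    using assms(1-3) by unfold_locales (auto simp: bounded_observations_def)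
  have \<gamma>: "strategy \<gamma>" using assms(4,5) by (simp add: strategy_def)
  have Q_iid: "Q \<in> iid_laws M X" and mean: "\<mu>0 < (\<integral>\<omega>. X 1 \<omega> \<partial>Q)" using Q by (auto simp: alt_class_def)
  have X1: "X 1 \<in> borel_measurable Q" using iid_lawsD(6)[OF Q_iid] by simp
  interpret Q: prob_space Q using iid_lawsD(1)[OF Q_iid] .
  interpret law: favorable_law "distr Q borel (X 1)" \<mu>0
  proof (intro favorable_law.intro favorable_law_axioms.intro)
    show "prob_space (distr Q borel (X 1))" by (rule Q.prob_space_distr[OF X1])
    show "\<mu>0 < (\<integral>x. x \<partial>distr Q borel (X 1))" using mean X1 by (simp add: integral_distr)
    show "AE x in distr Q borel (X 1). x \<in> {0..1}" by (rule law_unit[OF Q_iid])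
  qed (simp_all add: assms)
  have growth: "log_growth Q X \<mu>0 = law.growth" by (rule ext, rule log_growth_eq_law[where X=X and Q=Q, OF X1])
  \<comment> \<open>The null class contains a distribution with the dual marginal because the measurable space carries
    every i.i.d. law on \<open>[0,1]\<close>.\<close>
  have dual: "\<exists>P. growth_optimal M X \<mu>0 Q g P" if g: "is_arg_max (log_growth Q X \<mu>0) (\<lambda>g. g \<in> {0..1/\<mu>0}) g" for g
  proof -
    interpret opt: optimal_bet "distr Q borel (X 1)" \<mu>0 g
      by unfold_locales (use g in \<open>simp add: growth\<close>)
    obtain P where P: "P \<in> iid_laws M X" "distr P borel (X 1) = opt.dual_law"
      using assms(3) opt.prob_space_dual_law opt.unit_dual_law opt.sets_dual_law
      unfolding bounded_observations_def by blast
    have "(\<integral>\<omega>. X 1 \<omega> \<partial>P) = (\<integral>x. x \<partial>opt.dual_law)"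
      unfolding P(2)[symmetric] using iid_lawsD(6)[OF P(1), of 1] by (simp add: integral_distr)
    then have "P \<in> null_class M X \<mu>0" using P(1) opt.mean_dual_law by (simp add: null_class_def)
    then have "growth_optimal M X \<mu>0 Q g P" by unfold_locales (use Q_iid P in auto)
    then show ?thesis ..
  qed
  have ex: "\<exists>g. is_arg_max (log_growth Q X \<mu>0) (\<lambda>g. g \<in> {0..1/\<mu>0}) g"
    unfolding growth by (rule law.growth_arg_max_ex)
  then obtain g where g: "is_arg_max (log_growth Q X \<mu>0) (\<lambda>g. g \<in> {0..1/\<mu>0}) g" ..
  obtain P where "growth_optimal M X \<mu>0 Q g P" using dual[OF g] ..
  then interpret opt: growth_optimal M X \<mu>0 Q g P .
  have sup: "(SUP h\<in>{0..1/\<mu>0}. log_growth Q X \<mu>0 h) = ereal opt.law.rate"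
    unfolding growth opt.law.growth_eq_rate[symmetric]
    by (intro antisym SUP_least SUP_upper opt.law.growth_le opt.law.g_bets)
  have "AE \<omega> in Q. (\<lambda>n. elog (wealth X \<mu>0 \<gamma> n \<omega>) / ereal (real n)) \<longlonglongrightarrow> ereal opt.law.rate"
  proof -
    have "AE \<omega> in Q. limsup (\<lambda>n. elog (wealth X \<mu>0 \<gamma> n \<omega>) / ereal (real n)) \<le> ereal opt.law.rate"
      by (intro opt.limsup_growth_le wealth_F wealth_nonneg nn_integral_wealth_le \<gamma> opt.P_null)
    then show ?thesis using opt.liminf_growth_ge[OF assms(6)]
    proof eventually_elim
      case (elim \<omega>)
      let ?f = "\<lambda>n. elog (wealth X \<mu>0 \<gamma> n \<omega>) / ereal (real n)"
      have "liminf ?f \<le> limsup ?f" by (rule Liminf_le_Limsup) simp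
      then show ?case
        using elim by (intro Liminf_eq_Limsup antisym) (auto intro: order_trans)
    qed
  qed
  moreover have "AE \<omega> in Q. limsup (\<lambda>n. elog (W' n \<omega>) / ereal (real n)) \<le> ereal opt.law.rate"
    if W': "e_process M X \<mu>0 W'" for W'
  proof (rule opt.limsup_growth_le)
    show "W' n \<in> borel_measurable (F n)" if "1 \<le> n" for n
      using W' that by (simp add: e_process_def adapted_process_def)
    show "0 \<le> W' n \<omega>" if "1 \<le> n" "\<omega> \<in> space M" for n \<omega>
      using W' that by (simp add: e_process_def nonneg_process_def)
    show "(\<integral>\<^sup>+\<omega>. ennreal (W' n \<omega>) \<partial>P) \<le> 1" if "1 \<le> n" for n
      by (rule nn_integral_e_process_le[OF W' opt.P_null that])
  qed
  moreover have "((\<lambda>\<alpha>. scaled_mean_time Q \<alpha> (hitting_time X \<mu>0 \<gamma> \<alpha>)) \<longlongrightarrow> 1 / log_growth Q X \<mu>0 h) (at_right 0) \<and>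
      (\<forall>\<alpha>\<in>{0<..<1}. \<forall>\<tau>'. stopping_time (nat_filtration M X) \<tau>' \<and>
          (SUP P\<in>null_class M X \<mu>0. emeasure P {\<omega>\<in>space M. \<tau>' \<omega> < \<infinity>}) \<le> ennreal \<alpha> \<longrightarrow>
          scaled_mean_time Q \<alpha> \<tau>' \<ge> 1 / log_growth Q X \<mu>0 h)"
    if h: "is_arg_max (log_growth Q X \<mu>0) (\<lambda>g. g \<in> {0..1/\<mu>0}) h" for h
  proof -
    obtain P' where "growth_optimal M X \<mu>0 Q h P'" using dual[OF h] ..
    then interpret opt': growth_optimal M X \<mu>0 Q h P' .
    have rate: "1 / log_growth Q X \<mu>0 h = ereal (1 / opt'.law.rate)"
      using opt'.law.rate_pos unfolding growth opt'.law.growth_eq_rate by (simp add: one_ereal_def)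
    show ?thesis unfolding rate
    proof (intro conjI ballI allI impI)
      show "((\<lambda>\<alpha>. scaled_mean_time Q \<alpha> (hitting_time X \<mu>0 \<gamma> \<alpha>)) \<longlongrightarrow> ereal (1 / opt'.law.rate)) (at_right 0)"
        by (rule opt'.scaled_mean_hitting_time_tendsto[OF \<gamma> assms(6)])
    next
      fix \<alpha> :: real and \<tau>' :: "'a \<Rightarrow> enat"
      assume \<alpha>: "\<alpha> \<in> {0<..<1}" and \<tau>': "stopping_time (nat_filtration M X) \<tau>' \<and>
          (SUP P\<in>null_class M X \<mu>0. emeasure P {\<omega>\<in>space M. \<tau>' \<omega> < \<infinity>}) \<le> ennreal \<alpha>"
      have "emeasure P' {\<omega>\<in>space M. \<tau>' \<omega> < \<infinity>} \<le> ennreal \<alpha>"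
        using \<tau>' SUP_upper[OF opt'.P_null] by (meson order_trans)
      then show "ereal (1 / opt'.law.rate) \<le> scaled_mean_time Q \<alpha> \<tau>'"
        using \<alpha> \<tau>' by (intro opt'.scaled_mean_time_ge) auto
    qed
  qed
  ultimately show "(\<exists>\<gamma>\<^sub>Q. is_arg_max (log_growth Q X \<mu>0) (\<lambda>g. g \<in> {0..1/\<mu>0}) \<gamma>\<^sub>Q) \<and>
    (AE \<omega> in Q. (\<lambda>n. elog (wealth X \<mu>0 \<gamma> n \<omega>) / ereal (real n))
        \<longlonglongrightarrow> (SUP g\<in>{0..1/\<mu>0}. log_growth Q X \<mu>0 g)) \<and>
    (\<forall>W'. e_process M X \<mu>0 W' \<longrightarrow>
      (AE \<omega> in Q. limsup (\<lambda>n. elog (W' n \<omega>) / ereal (real n))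
        \<le> (SUP g\<in>{0..1/\<mu>0}. log_growth Q X \<mu>0 g))) \<and>
    (\<forall>\<gamma>\<^sub>Q. is_arg_max (log_growth Q X \<mu>0) (\<lambda>g. g \<in> {0..1/\<mu>0}) \<gamma>\<^sub>Q \<longrightarrow>
      ((\<lambda>\<alpha>. scaled_mean_time Q \<alpha> (hitting_time X \<mu>0 \<gamma> \<alpha>))
        \<longlongrightarrow> 1 / log_growth Q X \<mu>0 \<gamma>\<^sub>Q) (at_right 0) \<and>
      (\<forall>\<alpha>\<in>{0<..<1}. \<forall>\<tau>'. stopping_time (nat_filtration M X) \<tau>' \<and>
          (SUP P\<in>null_class M X \<mu>0. emeasure P {\<omega>\<in>space M. \<tau>' \<omega> < \<infinity>}) \<le> ennreal \<alpha> \<longrightarrow>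
          scaled_mean_time Q \<alpha> \<tau>' \<ge> 1 / log_growth Q X \<mu>0 \<gamma>\<^sub>Q))"
    using ex unfolding sup by blast
qed

end
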